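(* Let $\mathscr{V}$ be a topological category over $\mathsf{Set}$, with topological functor $|-| : \mathscr{V} \to \mathsf{Set}$, equipped with a symmetric monoidal structure $(\otimes, I)$ such that $|-|$ is strict symmetric monoidal with respect to the cartesian structure on $\mathsf{Set}$, and let $\mathcal{S}$ be a set. Let $\mathcal{T} = (\Sigma, \mathcal{E})$ be a $\mathscr{V}$-enriched $\mathcal{S}$-sorted equational theory with underlying classical $\mathcal{S}$-sorted equational theory $|\mathcal{T}| = (|\Sigma|, |\mathcal{E}|)$. Then $U^{\mathcal{T}} : \mathcal{T}\text{-}\mathsf{Alg} \to \mathscr{V}^{\mathcal{S}}$ has a left adjoint $F^{\mathcal{T}} : \mathscr{V}^{\mathcal{S}} \to \mathcal{T}\text{-}\mathsf{Alg}$, and the resulting adjunction $F^{\mathcal{T}} \dashv U^{\mathcal{T}}$ is a lifting of the adjunction $F^{|\mathcal{T}|} \dashv U^{|\mathcal{T}|} : |\mathcal{T}|\text{-}\mathsf{Alg} \to \mathsf{Set}^{\mathcal{S}}$ (along $|-|^{\mathcal{T}}$ and $|-|^{\mathcal{S}}$). In particular, $|-|^{\mathcal{T}} \circ F^{\mathcal{T}} = F^{|\mathcal{T}|} \circ |-|^{\mathcal{S}}$ strictly. For each object $X$ of $\mathscr{V}^{\mathcal{S}}$, the free $\mathcal{T}$-algebra $F^{\mathcal{T}} X$ on $X$ is the domain of the initial lift of the $|-|^{\mathcal{T}}$-structured source $$\left(f^\sharp : F^{|\mathcal{T}|}|X| \to |A|^{\mathcal{T}}\right)_{(A, f) \in X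 \downarrow U^{\mathcal{T}}}.$$ In particular, the carrier object $U^{\mathcal{T}} F^{\mathcal{T}} X$ of $\mathscr{V}^{\mathcal{S}}$ is the domain of the initial lift of the $|-|^{\mathcal{S}}$-structured source $$\left(f^\sharp : \mathsf{Term}_{|\Sigma|}(|X|)/{\sim^{|\mathcal{E}|}} \to |A|^{\mathcal{S}}\right)_{(A, f) \in X \downarrow U^{\mathcal{T}}},$$ where $\sim^{|\mathcal{E}|}$ is the $|\Sigma|$-congruence on the $|\Sigma|$-algebra $F^{|\Sigma|}(|X|)$ generated by $|\mathcal{E}|$.
   Context: Topological categories. A concrete category over a category $\mathscr{X}$ is a category $\mathscr{V}$ with a faithful functor $|-| : \mathscr{V} \to \mathscr{X}$; an $\mathscr{X}$-morphism $f : |V| \to |W|$ is $\mathscr{V}$-admissible if it lifts (uniquely) to a morphism $V \to W$. The fibre $\mathsf{Fib}(X)$ is the preordered class of objects $V$ with $|V| = X$, where $V \leq V'$ iff $1_X$ is an admissible morphism $V \to V'$; $\mathscr{V}$ is amnestic if all fibres are partially ordered. A (possibly large) source $(f_i : V \to V_i)_{i}$ is initial if for all $W$ and $f : |W| \to |V|$, $f$ is admissible iff all $f_i \circ f$ are. $\mathscr{V}$ (or $|-|$) is topological over $\mathscr{X}$ if it is amnestic and every (possibly large) structured source $(f_i : X \to |V_i|)_i$ has an initial lift: an object $V$ (the domain of the lift) with $|V| = X$, each $f_i$ admissible $V \to V_i$, and $(f_i : V \to V_i)_i$ initial. When $\mathscr{X} = \mathsf{Set}$, the indiscrete object $\mathsf{Indisc}\,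 Y$ on a set $Y$ is the greatest element of $\mathsf{Fib}(Y)$; every function $|V| \to Y$ is admissible as a morphism $V \to \mathsf{Indisc}\,Y$. The category $\mathscr{V}^{\mathcal{S}}$ is topological over $\mathsf{Set}^{\mathcal{S}}$ via $|-|^{\mathcal{S}}$ (often written $|-|$), $|(V_S)_{S}| = (|V_S|)_{S}$. One has $|X \otimes Y| = |X| \times |Y|$, $|X \times Y| = |X| \times |Y|$, and $|I|$ is a singleton. $\mathcal{S}^*$ is the set of finite sequences of elements of $\mathcal{S}$. Signatures. A $\mathscr{V}$-enriched $\mathcal{S}$-sorted signature is a set $\Sigma$ of operation symbols, each equipped with a type $((S_1, \ldots, S_n), S, P)$: input sorts $(S_1,\ldots,S_n) \in \mathcal{S}^*$, output sort $S \in \mathcal{S}$, parameter object $P \in \mathrm{ob}\,\mathscr{V}$. A $\Sigma$-algebra is an object $A = (A_S)_{S}$ of $\mathscr{V}^{\mathcal{S}}$ with, for each $\sigma \in \Sigma$ of type $((S_1, \ldots, S_n), S, P)$, a $\mathscr{V}$-morphism $\sigma^A : P \otimes (A_{S_1} \times \cdots \times A_{S_n}) \to A_S$. A morphism $f : A \to B$ of $\Sigma$-algebras is a morphism of $\mathscr{V}^{\mathcal{S}}$ with $f_S \circ \sigma^A = \sigma^B \circ (1_P \otimes (f_{S_1} \times \cdots \times f_{S_n}))$ for all $\sigma$. These form $\Sigma\text{-}\mathsf{Alg}$, with forgetful functor $U^\Sigma$ to $\mathscr{V}^{\mathcal{S}}$. A classical $\mathcal{S}$-sorted signature is the case $\mathscr{V}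 = \mathsf{Set}$ (cartesian) with all parameters equal to the one-point set (omitted from notation). $|\Sigma|$ is the classical signature with an operation symbol $\sigma_p$ with input sorts $(S_1,\ldots,S_n)$ and output sort $S$ for each $\sigma \in \Sigma$ of type $((S_1,\ldots,S_n),S,P)$ and each $p \in |P|$. Each $\Sigma$-algebra $A$ has an underlying $|\Sigma|$-algebra $|A|$ with carrier $(|A_S|)_S$ and $\sigma_p^{|A|} = \sigma^A(p, -)$. Enriched theories. For $P \in \mathrm{ob}\,\mathscr{V}$ and $\overline{S} = (S_1, \ldots, S_n) \in \mathcal{S}^*$, let $P \otimes U^{\overline{S}} : \Sigma\text{-}\mathsf{Alg} \to \mathscr{V}$ be $A \mapsto P \otimes (A_{S_1} \times \cdots \times A_{S_n})$, and $U^S$ be $A \mapsto A_S$. An algebraic $\Sigma$-operation of type $(\overline{S}, S, P)$ is a natural transformation $\omega : P \otimes U^{\overline{S}} \Rightarrow U^S$. An algebraic $\Sigma$-equation $\omega \doteq \nu$ is a pair of algebraic $\Sigma$-operations of the same type; $A$ satisfies it if $\omega_A = \nu_A$. A $\mathscr{V}$-enriched $\mathcal{S}$-sorted equational theory is a pair $\mathcal{T} = (\Sigma, \mathcal{E})$ with $\mathcal{E}$ a set of algebraic $\Sigma$-equations; $\mathcal{T}\text{-}\mathsf{Alg} \subseteq \Sigma\text{-}\mathsf{Alg}$ is the full subcategory of $\mathcal{T}$-algebras, i.e. $\Sigma$-algebras satisfying all equations in $\mathcal{E}$, and $U^{\mathcal{T}}$ is the restriction of $U^\Sigma$. Classical theories.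 For a classical signature, with fixed pairwise disjoint countably infinite sets of variables for each sort, a context $\overline{v}$ is a finite list $v_1 : S_1, \ldots, v_n : S_n$ of pairwise distinct sorted variables. Terms in context: each $[\overline{v} \vdash v_i : S_i]$, and $[\overline{v} \vdash \tau(t_1, \ldots, t_m) : T]$ for an operation symbol $\tau$ with input sorts $T_1, \ldots, T_m$, output sort $T$, and terms $[\overline{v} \vdash t_j : T_j]$. In an algebra $A$ a term $[\overline{v} \vdash t : S]$ is interpreted as a function $t^A : A_{S_1} \times \cdots \times A_{S_n} \to A_S$ in the usual recursive way. A syntactic equation $[\overline{v} \vdash s \doteq t : S]$ is satisfied by $A$ if $s^A = t^A$. A classical $\mathcal{S}$-sorted equational theory is a classical signature with a set of syntactic equations in context; its algebras are those satisfying these equations. Underlying classical theory $|\mathcal{T}| = (|\Sigma|, |\mathcal{E}|)$. For a $|\Sigma|$-algebra $D$, let $D^{\mathsf{Indisc}}$ be the $\Sigma$-algebra with carrier $(\mathsf{Indisc}\, D_S)_S$ and operations with underlying functions $(p, d_1, \ldots, d_n) \mapsto \sigma_p^D(d_1, \ldots, d_n)$. For an algebraic $\Sigma$-operation $\omega$ of type $((S_1, \ldots, S_n), S, P)$, $p \in |P|$, and a context $\overline{v} \equiv v_1 : S_1, \ldots, v_n : S_n$ of distinct variables, let $D$ be the $|\Sigma|$-algebra of $|\Sigma|$-terms in context $\overline{v}$ and let $t_{\omega, p} := \omega_{D^{\mathsf{Indisc}}}(p, v_1, \ldots, v_n) \in D_S$. Then $|\mathcal{E}|$ consists of the syntactic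 equations $[\overline{v} \vdash t_{\omega, p} \doteq t_{\nu, p} : S]$ for all $(\omega \doteq \nu) \in \mathcal{E}$ with parameter $P$ and all $p \in |P|$. A $\Sigma$-algebra $A$ is a $\mathcal{T}$-algebra iff $|A|$ is a $|\mathcal{T}|$-algebra, so $A \mapsto |A|$ gives a faithful functor $|-|^{\mathcal{T}} : \mathcal{T}\text{-}\mathsf{Alg} \to |\mathcal{T}|\text{-}\mathsf{Alg}$. Classical free algebras. For an $\mathcal{S}$-sorted set $Y$, $\mathsf{Term}_{|\Sigma|}(Y)$ is the $\mathcal{S}$-sorted set of ground terms with constants from $Y$ (generated by $Y_S \subseteq \mathsf{Term}_{|\Sigma|}(Y)_S$ and closure under formal application of operation symbols); it carries the free $|\Sigma|$-algebra $F^{|\Sigma|} Y$. A $|\Sigma|$-congruence on a $|\Sigma|$-algebra $D$ is a family of equivalence relations $(\sim_S)_S$ on the sets $D_S$ compatible with all operations; the congruence $\sim^{|\mathcal{E}|}$ generated by $|\mathcal{E}|$ is the smallest one with $s^D(d_1, \ldots, d_n) \sim_S t^D(d_1, \ldots, d_n)$ for all $[\overline{v} \vdash s \doteq t : S]$ in $|\mathcal{E}|$ and all $d_i \in D_{S_i}$. The free $|\mathcal{T}|$-algebra $F^{|\mathcal{T}|} Y$ is the quotient algebra $F^{|\Sigma|} Y/{\sim^{|\mathcal{E}|}}$, with carrier $\mathsf{Term}_{|\Sigma|}(Y)/{\sim^{|\mathcal{E}|}}$ and unit $y \mapsto [y]$. $X \downarrow U^{\mathcal{T}}$ is the class of pairs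 $(A, f)$ with $A$ a $\mathcal{T}$-algebra and $f : X \to U^{\mathcal{T}} A$ a morphism of $\mathscr{V}^{\mathcal{S}}$; $f^\sharp : F^{|\mathcal{T}|}|X| \to |A|^{\mathcal{T}}$ is the unique $|\mathcal{T}|$-algebra morphism corresponding to the $\mathcal{S}$-sorted function $f : |X| \to |A|$ (also regarded as an $\mathcal{S}$-sorted function). Lifting of adjunctions. Given adjunctions $(\eta, \varepsilon) : F \dashv G : \mathscr{A} \to \mathscr{B}$ and $(\eta', \varepsilon') : F' \dashv G' : \mathscr{A}' \to \mathscr{B}'$ and functors $T : \mathscr{A} \to \mathscr{A}'$, $R : \mathscr{B} \to \mathscr{B}'$, the first is a lifting of the second along $T, R$ if $G'T = RG$, $F'R = TF$, $R\eta = \eta' R$ and $T\varepsilon = \varepsilon' T$. *)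

theory Defs
  imports "HOL-Library.FuncSet" "HOL-Library.Countable_Set" "HOL-Library.Nat_Bijection"
begin

section \<open>Categories, functors and adjunctions\<close>

record ('o, 'm) cat =
  Obj :: "'o set"
  Arr :: "'m set"
  Dom :: "'m \<Rightarrow> 'o"
  Cod :: "'m \<Rightarrow> 'o"
  Id :: "'o \<Rightarrow> 'm"
  Cmp :: "'m \<Rightarrow> 'm \<Rightarrow> 'm" (infixl "\<cdot>\<index>" 70)

text \<open>Composition is in applicative order: \<open>g \<cdot> f\<close> is \<open>g\<close> after \<open>f\<close>.\<close>

definition hom :: "('o, 'm) cat \<Rightarrow> 'o \<Rightarrow> 'o \<Rightarrow> 'm set" where
  "hom C a b = {f \<in> Arr C. Dom C f = a \<and> Cod C f = b}"

locale category =
  fixes C :: "('o, 'm) cat" (structure)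
  assumes Dom_Obj: "f \<in> Arr C \<Longrightarrow> Dom C f \<in> Obj C"
    and Cod_Obj: "f \<in> Arr C \<Longrightarrow> Cod C f \<in> Obj C"
    and Id_hom: "a \<in> Obj C \<Longrightarrow> Id C a \<in> hom C a a"
    and Cmp_hom: "f \<in> hom C a b \<Longrightarrow> g \<in> hom C b c \<Longrightarrow> g \<cdot> f \<in> hom C a c"
    and Id_left: "f \<in> hom C a b \<Longrightarrow> Id C b \<cdot> f = f"
    and Id_right: "f \<in> hom C a b \<Longrightarrow> f \<cdot> Id C a = f"
    and Cmp_assoc: "f \<in> hom C a b \<Longrightarrow> g \<in> hom C b c \<Longrightarrow> h \<in> hom C c d \<Longrightarrow> (h \<cdot> g) \<cdot> f = h \<cdot> (g \<cdot> f)"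

definition iso_arr :: "('o, 'm) cat \<Rightarrow> 'o \<Rightarrow> 'o \<Rightarrow> 'm \<Rightarrow> bool" where
  "iso_arr C a b f \<longleftrightarrow> f \<in> hom C a b \<and>
     (\<exists>g \<in> hom C b a. g \<cdot>\<^bsub>C\<^esub> f = Id C a \<and> f \<cdot>\<^bsub>C\<^esub> g = Id C b)"

record ('o, 'm, 'p, 'n) func =
  FO :: "'o \<Rightarrow> 'p"
  FA :: "'m \<Rightarrow> 'n"

locale is_functor = dom: category C + cod: category D
  for C :: "('o, 'm) cat" and D :: "('p, 'n) cat" +
  fixes F :: "('o, 'm, 'p, 'n) func"
  assumes FA_hom: "f \<in> hom C a b \<Longrightarrow> FA F f \<in> hom D (FO F a) (FO F b)"
    and FO_Obj: "a \<in> Obj C \<Longrightarrow> FO F a \<in> Obj D"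
    and FA_Id: "a \<in> Obj C \<Longrightarrow> FA F (Id C a) = Id D (FO F a)"
    and FA_Cmp: "f \<in> hom C a b \<Longrightarrow> g \<in> hom C b c \<Longrightarrow> FA F (g \<cdot>\<^bsub>C\<^esub> f) = FA F g \<cdot>\<^bsub>D\<^esub> FA F f"

definition faithful :: "('o, 'm) cat \<Rightarrow> ('o, 'm, 'p, 'n) func \<Rightarrow> bool" where
  "faithful C F \<longleftrightarrow> (\<forall>a b. \<forall>f \<in> hom C a b. \<forall>g \<in> hom C a b. FA F f = FA F g \<longrightarrow> f = g)"

definition id_func :: "('o, 'm, 'o, 'm) func" where
  "id_func = \<lparr>FO = (\<lambda>a. a), FA = (\<lambda>f. f)\<rparr>"

definition comp_func :: "('p, 'n, 'q, 'k) func \<Rightarrow> ('o, 'm, 'p, 'n) func \<Rightarrow> ('o, 'm, 'q, 'k) func"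
  (infixl "\<circ>\<^sub>F" 60) where
  "G \<circ>\<^sub>F F = \<lparr>FO = FO G \<circ> FO F, FA = FA G \<circ> FA F\<rparr>"

text \<open>Equality of two functors with domain \<open>C\<close>; their values outside \<open>C\<close> are irrelevant.\<close>

definition func_eq :: "('o, 'm) cat \<Rightarrow> ('o, 'm, 'p, 'n) func \<Rightarrow> ('o, 'm, 'p, 'n) func \<Rightarrow> bool" where
  "func_eq C F G \<longleftrightarrow> (\<forall>a \<in> Obj C. FO F a = FO G a) \<and> (\<forall>f \<in> Arr C. FA F f = FA G f)"

definition nat_trans ::
  "('o, 'm) cat \<Rightarrow> ('p, 'n) cat \<Rightarrow> ('o, 'm, 'p, 'n) func \<Rightarrow> ('o, 'm, 'p, 'n) func \<Rightarrow> ('o \<Rightarrow> 'n) \<Rightarrow> bool" where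
  "nat_trans C D F G \<eta> \<longleftrightarrow>
     (\<forall>a \<in> Obj C. \<eta> a \<in> hom D (FO F a) (FO G a)) \<and>
     (\<forall>a b. \<forall>f \<in> hom C a b. FA G f \<cdot>\<^bsub>D\<^esub> \<eta> a = \<eta> b \<cdot>\<^bsub>D\<^esub> FA F f)"

text \<open>\<open>F \<stileturn> G : A \<rightarrow> B\<close> with unit \<open>\<eta>\<close> and counit \<open>\<epsilon>\<close>.\<close>

definition adjunction ::
  "('a, 'm) cat \<Rightarrow> ('b, 'n) cat \<Rightarrow> ('b, 'n, 'a, 'm) func \<Rightarrow> ('a, 'm, 'b, 'n) func
     \<Rightarrow> ('b \<Rightarrow> 'n) \<Rightarrow> ('a \<Rightarrow> 'm) \<Rightarrow> bool" where
  "adjunction A B F G \<eta> \<epsilon> \<longleftrightarrow>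
     is_functor B A F \<and> is_functor A B G \<and>
     nat_trans B B id_func (G \<circ>\<^sub>F F) \<eta> \<and> nat_trans A A (F \<circ>\<^sub>F G) id_func \<epsilon> \<and>
     (\<forall>b \<in> Obj B. \<epsilon> (FO F b) \<cdot>\<^bsub>A\<^esub> FA F (\<eta> b) = Id A (FO F b)) \<and>
     (\<forall>a \<in> Obj A. FA G (\<epsilon> a) \<cdot>\<^bsub>B\<^esub> \<eta> (FO G a) = Id B (FO G a))"

text \<open>The adjunction \<open>F \<stileturn> G : A \<rightarrow> B\<close> is a lifting of \<open>F' \<stileturn> G' : A' \<rightarrow> B'\<close> along
  \<open>T : A \<rightarrow> A'\<close> and \<open>R : B \<rightarrow> B'\<close>.\<close>

definition adjunction_lifting ::
  "('a, 'm) cat \<Rightarrow> ('b, 'n) cat \<Rightarrow> ('b, 'n, 'a, 'm) func \<Rightarrow> ('a, 'm, 'b, 'n) func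
     \<Rightarrow> ('b \<Rightarrow> 'n) \<Rightarrow> ('a \<Rightarrow> 'm)
   \<Rightarrow> ('c, 'k) cat \<Rightarrow> ('d, 'l) cat \<Rightarrow> ('d, 'l, 'c, 'k) func \<Rightarrow> ('c, 'k, 'd, 'l) func
     \<Rightarrow> ('d \<Rightarrow> 'l) \<Rightarrow> ('c \<Rightarrow> 'k)
   \<Rightarrow> ('a, 'm, 'c, 'k) func \<Rightarrow> ('b, 'n, 'd, 'l) func \<Rightarrow> bool" where
  "adjunction_lifting A B F G \<eta> \<epsilon> A' B' F' G' \<eta>' \<epsilon>' T R \<longleftrightarrow>
     adjunction A B F G \<eta> \<epsilon> \<and> adjunction A' B' F' G' \<eta>' \<epsilon>' \<and>
     is_functor A A' T \<and> is_functor B B' R \<and>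
     func_eq A (G' \<circ>\<^sub>F T) (R \<circ>\<^sub>F G) \<and>
     func_eq B (F' \<circ>\<^sub>F R) (T \<circ>\<^sub>F F) \<and>
     (\<forall>b \<in> Obj B. FA R (\<eta> b) = \<eta>' (FO R b)) \<and>
     (\<forall>a \<in> Obj A. FA T (\<epsilon> a) = \<epsilon>' (FO T a))"

definition full_subcat :: "('o, 'm) cat \<Rightarrow> ('o \<Rightarrow> bool) \<Rightarrow> ('o, 'm) cat" where
  "full_subcat C P = C\<lparr>Obj := {a \<in> Obj C. P a}, Arr := {f \<in> Arr C. P (Dom C f) \<and> P (Cod C f)}\<rparr>"

text \<open>The power \<open>C\<^sup>S\<close>; families are functions that are undefined outside \<open>S\<close>, so that equality of
  families is equality of functions.\<close>

definition pow_cat :: "'s set \<Rightarrow> ('o, 'm) cat \<Rightarrow> ('s \<Rightarrow> 'o, 's \<Rightarrow> 'm) cat" where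
  "pow_cat S C = \<lparr>Obj = S \<rightarrow>\<^sub>E Obj C, Arr = S \<rightarrow>\<^sub>E Arr C,
     Dom = (\<lambda>f. \<lambda>s\<in>S. Dom C (f s)), Cod = (\<lambda>f. \<lambda>s\<in>S. Cod C (f s)),
     Id = (\<lambda>a. \<lambda>s\<in>S. Id C (a s)), Cmp = (\<lambda>g f. \<lambda>s\<in>S. g s \<cdot>\<^bsub>C\<^esub> f s)\<rparr>"

definition pow_func :: "'s set \<Rightarrow> ('o, 'm, 'p, 'n) func \<Rightarrow> ('s \<Rightarrow> 'o, 's \<Rightarrow> 'm, 's \<Rightarrow> 'p, 's \<Rightarrow> 'n) func" where
  "pow_func S F = \<lparr>FO = (\<lambda>a. \<lambda>s\<in>S. FO F (a s)), FA = (\<lambda>f. \<lambda>s\<in>S. FA F (f s))\<rparr>"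

text \<open>The category of objects \<open>A \<in> Ob\<close> with a carrier \<open>car A\<close> in \<open>B\<close>, where the morphisms
  \<open>A \<rightarrow> A'\<close> are the \<open>B\<close>-morphisms \<open>car A \<rightarrow> car A'\<close> that satisfy \<open>P\<close>.\<close>

definition struct_cat ::
  "('b, 'n) cat \<Rightarrow> 'a set \<Rightarrow> ('a \<Rightarrow> 'b) \<Rightarrow> ('a \<Rightarrow> 'n \<Rightarrow> 'a \<Rightarrow> bool) \<Rightarrow> ('a, 'a \<times> 'n \<times> 'a) cat" where
  "struct_cat B Ob car P = \<lparr>Obj = Ob,
     Arr = {(A, f, A'). A \<in> Ob \<and> A' \<in> Ob \<and> f \<in> hom B (car A) (car A') \<and> P A f A'},
     Dom = (\<lambda>(A, f, A'). A), Cod = (\<lambda>(A, f, A'). A'),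
     Id = (\<lambda>A. (A, Id B (car A), A)),
     Cmp = (\<lambda>(A1, g, A2) (A0, f, A1'). (A0, g \<cdot>\<^bsub>B\<^esub> f, A2))\<rparr>"

definition struct_forget :: "('a \<Rightarrow> 'b) \<Rightarrow> ('a, 'a \<times> 'n \<times> 'a, 'b, 'n) func" where
  "struct_forget car = \<lparr>FO = car, FA = (\<lambda>(A, f, A'). f)\<rparr>"

definition is_product :: "('o, 'm) cat \<Rightarrow> 'o list \<Rightarrow> 'o \<Rightarrow> 'm list \<Rightarrow> bool" where
  "is_product C as p \<pi>s \<longleftrightarrow> p \<in> Obj C \<and> list_all2 (\<lambda>\<pi> a. \<pi> \<in> hom C p a) \<pi>s as \<and>
     (\<forall>w \<in> Obj C. \<forall>gs. list_all2 (\<lambda>g a. g \<in> hom C w a) gs as \<longrightarrow>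
        (\<exists>!h. h \<in> hom C w p \<and> gs = map (\<lambda>\<pi>. \<pi> \<cdot>\<^bsub>C\<^esub> h) \<pi>s))"

section \<open>Topological categories\<close>

definition admissible ::
  "('v, 'm) cat \<Rightarrow> ('x, 'n) cat \<Rightarrow> ('v, 'm, 'x, 'n) func \<Rightarrow> 'v \<Rightarrow> 'v \<Rightarrow> 'n \<Rightarrow> bool" where
  "admissible V X U a b f \<longleftrightarrow> f \<in> hom X (FO U a) (FO U b) \<and> (\<exists>g \<in> hom V a b. FA U g = f)"

text \<open>The order on the fibre over \<open>FO U a\<close>.\<close>

definition fib_le :: "('v, 'm) cat \<Rightarrow> ('x, 'n) cat \<Rightarrow> ('v, 'm, 'x, 'n) func \<Rightarrow> 'v \<Rightarrow> 'v \<Rightarrow> bool" where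
  "fib_le V X U a b \<longleftrightarrow> FO U a = FO U b \<and> admissible V X U a b (Id X (FO U a))"

text \<open>A structured source with domain \<open>x\<close> is given by the set of its components
  \<open>(b, f : x \<rightarrow> FO U b)\<close>. Initiality depends only on this set, which need not be small.\<close>

definition structured_source ::
  "('v, 'm) cat \<Rightarrow> ('x, 'n) cat \<Rightarrow> ('v, 'm, 'x, 'n) func \<Rightarrow> 'x \<Rightarrow> ('v \<times> 'n) set \<Rightarrow> bool" where
  "structured_source V X U x K \<longleftrightarrow> x \<in> Obj X \<and> (\<forall>(b, f) \<in> K. b \<in> Obj V \<and> f \<in> hom X x (FO U b))"

definition initial_source ::
  "('v, 'm) cat \<Rightarrow> ('x, 'n) cat \<Rightarrow> ('v, 'm, 'x, 'n) func \<Rightarrow> 'v \<Rightarrow> ('v \<times> 'n) set \<Rightarrow> bool" where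
  "initial_source V X U a K \<longleftrightarrow>
     (\<forall>(b, f) \<in> K. admissible V X U a b f) \<and>
     (\<forall>w \<in> Obj V. \<forall>g \<in> hom X (FO U w) (FO U a).
        admissible V X U w a g \<longleftrightarrow> (\<forall>(b, f) \<in> K. admissible V X U w b (f \<cdot>\<^bsub>X\<^esub> g)))"

definition initial_lift_domain ::
  "('v, 'm) cat \<Rightarrow> ('x, 'n) cat \<Rightarrow> ('v, 'm, 'x, 'n) func \<Rightarrow> 'x \<Rightarrow> ('v \<times> 'n) set \<Rightarrow> 'v \<Rightarrow> bool" where
  "initial_lift_domain V X U x K a \<longleftrightarrow> a \<in> Obj V \<and> FO U a = x \<and> initial_source V X U a K"

locale topological = is_functor V X U
  for V :: "('v, 'm) cat" and X :: "('x, 'n) cat" and U :: "('v, 'm, 'x, 'n) func" +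
  assumes faithful: "faithful V U"
    and amnestic: "a \<in> Obj V \<Longrightarrow> b \<in> Obj V \<Longrightarrow> fib_le V X U a b \<Longrightarrow> fib_le V X U b a \<Longrightarrow> a = b"
    and initial_lift: "structured_source V X U x K \<Longrightarrow> \<exists>a. initial_lift_domain V X U x K a"

section \<open>Symmetric monoidal categories\<close>

record ('o, 'm) monoidal =
  tensO :: "'o \<Rightarrow> 'o \<Rightarrow> 'o" (infixr "\<otimes>\<index>" 75)
  tensA :: "'m \<Rightarrow> 'm \<Rightarrow> 'm" (infixr "\<odot>\<index>" 75)
  tunit :: 'o
  assr :: "'o \<Rightarrow> 'o \<Rightarrow> 'o \<Rightarrow> 'm"
  lunit :: "'o \<Rightarrow> 'm"
  runit :: "'o \<Rightarrow> 'm"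
  braid :: "'o \<Rightarrow> 'o \<Rightarrow> 'm"

text \<open>\<open>\<odot>\<close> is the tensor product of morphisms; the structure isomorphisms are
  \<open>(a \<otimes> b) \<otimes> c \<rightarrow> a \<otimes> (b \<otimes> c)\<close>, \<open>I \<otimes> a \<rightarrow> a\<close>, \<open>a \<otimes> I \<rightarrow> a\<close> and \<open>a \<otimes> b \<rightarrow> b \<otimes> a\<close>.\<close>

locale symmetric_monoidal = category C
  for C :: "('o, 'm) cat" (structure) +
  fixes M :: "('o, 'm) monoidal"
  assumes tens_Obj: "a \<in> Obj C \<Longrightarrow> b \<in> Obj C \<Longrightarrow> a \<otimes>\<^bsub>M\<^esub> b \<in> Obj C"
    and unit_Obj: "tunit M \<in> Obj C"
    and tens_hom: "f \<in> hom C a b \<Longrightarrow> f' \<in> hom C a' b' \<Longrightarrow>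
          f \<odot>\<^bsub>M\<^esub> f' \<in> hom C (a \<otimes>\<^bsub>M\<^esub> a') (b \<otimes>\<^bsub>M\<^esub> b')"
    and tens_Id: "a \<in> Obj C \<Longrightarrow> b \<in> Obj C \<Longrightarrow> Id C a \<odot>\<^bsub>M\<^esub> Id C b = Id C (a \<otimes>\<^bsub>M\<^esub> b)"
    and tens_Cmp: "f \<in> hom C a b \<Longrightarrow> g \<in> hom C b c \<Longrightarrow> f' \<in> hom C a' b' \<Longrightarrow> g' \<in> hom C b' c' \<Longrightarrow>
          (g \<cdot> f) \<odot>\<^bsub>M\<^esub> (g' \<cdot> f') = (g \<odot>\<^bsub>M\<^esub> g') \<cdot> (f \<odot>\<^bsub>M\<^esub> f')"
    and assr_iso: "a \<in> Obj C \<Longrightarrow> b \<in> Obj C \<Longrightarrow> c \<in> Obj C \<Longrightarrow>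
          iso_arr C ((a \<otimes>\<^bsub>M\<^esub> b) \<otimes>\<^bsub>M\<^esub> c) (a \<otimes>\<^bsub>M\<^esub> (b \<otimes>\<^bsub>M\<^esub> c)) (assr M a b c)"
    and lunit_iso: "a \<in> Obj C \<Longrightarrow> iso_arr C (tunit M \<otimes>\<^bsub>M\<^esub> a) a (lunit M a)"
    and runit_iso: "a \<in> Obj C \<Longrightarrow> iso_arr C (a \<otimes>\<^bsub>M\<^esub> tunit M) a (runit M a)"
    and braid_iso: "a \<in> Obj C \<Longrightarrow> b \<in> Obj C \<Longrightarrow> iso_arr C (a \<otimes>\<^bsub>M\<^esub> b) (b \<otimes>\<^bsub>M\<^esub> a) (braid M a b)"
    and assr_nat: "f \<in> hom C a a' \<Longrightarrow> g \<in> hom C b b' \<Longrightarrow> h \<in> hom C c c' \<Longrightarrow>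
          assr M a' b' c' \<cdot> ((f \<odot>\<^bsub>M\<^esub> g) \<odot>\<^bsub>M\<^esub> h) = (f \<odot>\<^bsub>M\<^esub> (g \<odot>\<^bsub>M\<^esub> h)) \<cdot> assr M a b c"
    and lunit_nat: "f \<in> hom C a a' \<Longrightarrow> lunit M a' \<cdot> (Id C (tunit M) \<odot>\<^bsub>M\<^esub> f) = f \<cdot> lunit M a"
    and runit_nat: "f \<in> hom C a a' \<Longrightarrow> runit M a' \<cdot> (f \<odot>\<^bsub>M\<^esub> Id C (tunit M)) = f \<cdot> runit M a"
    and braid_nat: "f \<in> hom C a a' \<Longrightarrow> g \<in> hom C b b' \<Longrightarrow>
          braid M a' b' \<cdot> (f \<odot>\<^bsub>M\<^esub> g) = (g \<odot>\<^bsub>M\<^esub> f) \<cdot> braid M a b"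
    and pentagon: "a \<in> Obj C \<Longrightarrow> b \<in> Obj C \<Longrightarrow> c \<in> Obj C \<Longrightarrow> d \<in> Obj C \<Longrightarrow>
          assr M a b (c \<otimes>\<^bsub>M\<^esub> d) \<cdot> assr M (a \<otimes>\<^bsub>M\<^esub> b) c d =
          (Id C a \<odot>\<^bsub>M\<^esub> assr M b c d) \<cdot> assr M a (b \<otimes>\<^bsub>M\<^esub> c) d \<cdot> (assr M a b c \<odot>\<^bsub>M\<^esub> Id C d)"
    and triangle: "a \<in> Obj C \<Longrightarrow> b \<in> Obj C \<Longrightarrow>
          (Id C a \<odot>\<^bsub>M\<^esub> lunit M b) \<cdot> assr M a (tunit M) b = runit M a \<odot>\<^bsub>M\<^esub> Id C b"
    and hexagon: "a \<in> Obj C \<Longrightarrow> b \<in> Obj C \<Longrightarrow> c \<in> Obj C \<Longrightarrow>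
          assr M b c a \<cdot> braid M a (b \<otimes>\<^bsub>M\<^esub> c) \<cdot> assr M a b c =
          (Id C b \<odot>\<^bsub>M\<^esub> braid M a c) \<cdot> assr M b a c \<cdot> (braid M a b \<odot>\<^bsub>M\<^esub> Id C c)"
    and symmetry: "a \<in> Obj C \<Longrightarrow> b \<in> Obj C \<Longrightarrow> braid M b a \<cdot> braid M a b = Id C (a \<otimes>\<^bsub>M\<^esub> b)"

locale strict_symmetric_monoidal_functor =
  is_functor C D F + dom: symmetric_monoidal C M + cod: symmetric_monoidal D N
  for C :: "('o, 'm) cat" and M :: "('o, 'm) monoidal"
    and D :: "('p, 'n) cat" and N :: "('p, 'n) monoidal" and F :: "('o, 'm, 'p, 'n) func" +
  assumes strict_tensO: "a \<in> Obj C \<Longrightarrow> b \<in> Obj C \<Longrightarrow> FO F (a \<otimes>\<^bsub>M\<^esub> b) = FO F a \<otimes>\<^bsub>N\<^esub> FO F b"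
    and strict_tensA: "f \<in> Arr C \<Longrightarrow> g \<in> Arr C \<Longrightarrow> FA F (f \<odot>\<^bsub>M\<^esub> g) = FA F f \<odot>\<^bsub>N\<^esub> FA F g"
    and strict_tunit: "FO F (tunit M) = tunit N"
    and strict_assr: "a \<in> Obj C \<Longrightarrow> b \<in> Obj C \<Longrightarrow> c \<in> Obj C \<Longrightarrow>
          FA F (assr M a b c) = assr N (FO F a) (FO F b) (FO F c)"
    and strict_lunit: "a \<in> Obj C \<Longrightarrow> FA F (lunit M a) = lunit N (FO F a)"
    and strict_runit: "a \<in> Obj C \<Longrightarrow> FA F (runit M a) = runit N (FO F a)"
    and strict_braid: "a \<in> Obj C \<Longrightarrow> b \<in> Obj C \<Longrightarrow> FA F (braid M a b) = braid N (FO F a) (FO F b)"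

section \<open>The category of sets\<close>

text \<open>A type in this class is a universe of sets. The predicate \<open>small\<close> singles out the collections
  that are sets, and \<open>encode_set\<close> turns such a collection into an element of the universe. The
  axioms are the closure properties of the sets in any model of ZFC (separation, replacement, union,
  infinity, and that a set is itself an element determined by its members); closure under power
  sets is not needed. So \<open>set_cat\<close> below is the category of sets if the type is a model of ZFC, and
  otherwise the category of sets of some regular size. A model for which no axioms beyond those of
  HOL are needed is given in \<open>set_universe_exists\<close>.\<close>

class set_universe =
  fixes small :: "'a set \<Rightarrow> bool"
    and encode_set :: "'a set \<Rightarrow> 'a"
  assumes small_subset: "small X \<Longrightarrow> Y \<subseteq> X \<Longrightarrow> small Y"
    and small_image: "small X \<Longrightarrow> small (f ` X)"
    and small_UN: "small X \<Longrightarrow> (\<And>x. x \<in> X \<Longrightarrow> small (G x)) \<Longrightarrow> small (\<Union>x\<in>X. G x)"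
    and small_infinite: "\<exists>X. small X \<and> infinite X"
    and encode_set_inj: "small X \<Longrightarrow> small Y \<Longrightarrow> encode_set X = encode_set Y \<Longrightarrow> X = Y"

lemma set_universe_exists:
  "\<exists>(sm :: nat set set \<Rightarrow> bool) enc. class.set_universe sm enc"
proof -
  define enc :: "nat set set \<Rightarrow> nat set" where
    "enc X = (if X = {} then {}
       else insert 0 {Suc (prod_encode (n, k)) | n k. k \<in> from_nat_into X n})" for X
  have decode: "X = range (\<lambda>n. {k. Suc (prod_encode (n, k)) \<in> enc X})" if "countable X" "X \<noteq> {}" for X
  proof -
    have "{k. Suc (prod_encode (n, k)) \<in> enc X} = from_nat_into X n" for n
      using that by (auto simp: enc_def)
    then show ?thesis
      using that by (simp add: range_from_nat_into)
  qed
  have "enc X = {} \<longleftrightarrow> X = {}" for X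
    by (simp add: enc_def)
  then have inj: "X = Y" if "countable X" "countable Y" "enc X = enc Y" for X Y
    using decode that by metis
  have "infinite (range (\<lambda>n::nat. {n}))" "countable (range (\<lambda>n::nat. {n}))"
    by (auto simp: finite_image_iff inj_on_def)
  then have ex: "\<exists>X :: nat set set. countable X \<and> infinite X"
    by blast
  have "class.set_universe (countable :: nat set set \<Rightarrow> bool) enc"
    by unfold_locales (use inj ex in \<open>auto intro: countable_subset\<close>)
  then show ?thesis by blast
qed

text \<open>Kuratowski pairs, tuples, the numerals used to index variables, and cartesian products.\<close>

definition pair :: "'u::set_universe \<Rightarrow> 'u \<Rightarrow> 'u" where
  "pair a b = encode_set {encode_set {a}, encode_set {a, b}}"

definition pfst :: "'u::set_universe \<Rightarrow> 'u" where "pfst z = (THE a. \<exists>b. z = pair a b)"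
definition psnd :: "'u::set_universe \<Rightarrow> 'u" where "psnd z = (THE b. \<exists>a. z = pair a b)"

definition point :: "'u::set_universe" where "point = encode_set {}"

definition tup :: "'u::set_universe list \<Rightarrow> 'u" where "tup xs = foldr pair xs point"
definition untup :: "'u::set_universe \<Rightarrow> 'u list" where "untup = inv tup"

definition numeral_of :: "nat \<Rightarrow> 'u::set_universe" where
  "numeral_of n = tup (replicate n point)"

definition cart :: "'u::set_universe set \<Rightarrow> 'u set \<Rightarrow> 'u set" where
  "cart A B = (\<lambda>(a, b). pair a b) ` (A \<times> B)"

definition tuples :: "'u::set_universe set list \<Rightarrow> 'u set" where
  "tuples As = tup ` listset As"

type_synonym 'u set_arrow = "'u set \<times> ('u \<Rightarrow> 'u) \<times> 'u set"

definition set_arr :: "'u set \<Rightarrow> ('u \<Rightarrow> 'u) \<Rightarrow> 'u set \<Rightarrow> 'u set_arrow" where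
  "set_arr A f B = (A, restrict f A, B)"

definition app :: "'u set_arrow \<Rightarrow> 'u \<Rightarrow> 'u" where "app f = fst (snd f)"

definition set_cat :: "('u::set_universe set, 'u set_arrow) cat" where
  "set_cat = \<lparr>Obj = {A. small A},
     Arr = {(A, f, B). small A \<and> small B \<and> f \<in> A \<rightarrow>\<^sub>E B},
     Dom = (\<lambda>(A, f, B). A), Cod = (\<lambda>(A, f, B). B),
     Id = (\<lambda>A. set_arr A (\<lambda>x. x) A),
     Cmp = (\<lambda>(B, g, C) (A, f, B'). (A, compose A g f, C))\<rparr>"

definition set_cartesian :: "('u::set_universe set, 'u set_arrow) monoidal" where
  "set_cartesian = \<lparr>tensO = cart,
     tensA = (\<lambda>(A, f, B) (A', f', B').
        set_arr (cart A A') (\<lambda>z. pair (f (pfst z)) (f' (psnd z))) (cart B B')),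
     tunit = {point},
     assr = (\<lambda>A B C. set_arr (cart (cart A B) C)
        (\<lambda>z. pair (pfst (pfst z)) (pair (psnd (pfst z)) (psnd z))) (cart A (cart B C))),
     lunit = (\<lambda>A. set_arr (cart {point} A) psnd A),
     runit = (\<lambda>A. set_arr (cart A {point}) pfst A),
     braid = (\<lambda>A B. set_arr (cart A B) (\<lambda>z. pair (psnd z) (pfst z)) (cart B A))\<rparr>"

section \<open>Classical signatures, algebras and equational theories\<close>

text \<open>Sorts are elements of the universe. In a classical algebra an operation symbol with input sorts
  \<open>[S\<^sub>1, \<dots>, S\<^sub>n]\<close> is interpreted as a function on lists \<open>[d\<^sub>1, \<dots>, d\<^sub>n]\<close>.\<close>

record ('o, 'u) csig =
  cops :: "'o set"
  cins :: "'o \<Rightarrow> 'u list"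
  cout :: "'o \<Rightarrow> 'u"

type_synonym ('o, 'u) calg = "('u \<Rightarrow> 'u set) \<times> ('o \<Rightarrow> 'u list \<Rightarrow> 'u)"

definition args :: "('u \<Rightarrow> 'x set) \<Rightarrow> 'u list \<Rightarrow> 'x list set" where
  "args D ss = listset (map D ss)"

definition classical_algebras :: "'u::set_universe set \<Rightarrow> ('o, 'u) csig \<Rightarrow> ('o, 'u) calg set" where
  "classical_algebras S \<Sigma> = {A. fst A \<in> Obj (pow_cat S set_cat) \<and>
     snd A \<in> (\<Pi>\<^sub>E \<tau> \<in> cops \<Sigma>. args (fst A) (cins \<Sigma> \<tau>) \<rightarrow>\<^sub>E fst A (cout \<Sigma> \<tau>))}"

definition classical_alg_cat ::
  "'u::set_universe set \<Rightarrow> ('o, 'u) csig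
     \<Rightarrow> (('o, 'u) calg, ('o, 'u) calg \<times> ('u \<Rightarrow> 'u set_arrow) \<times> ('o, 'u) calg) cat" where
  "classical_alg_cat S \<Sigma> = struct_cat (pow_cat S set_cat) (classical_algebras S \<Sigma>) fst
     (\<lambda>A f B. \<forall>\<tau> \<in> cops \<Sigma>. \<forall>ds \<in> args (fst A) (cins \<Sigma> \<tau>).
        app (f (cout \<Sigma> \<tau>)) (snd A \<tau> ds) = snd B \<tau> (map2 (\<lambda>s d. app (f s) d) (cins \<Sigma> \<tau>) ds))"

datatype ('o, 'x) trm = Var 'x | Op 'o "('o, 'x) trm list"

text \<open>\<open>wsorted \<Sigma> Y t s\<close>: \<open>t\<close> is a term of sort \<open>s\<close> whose leaves of sort \<open>s'\<close> come from \<open>Y s'\<close>. This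
  covers both terms in context (leaves are variables) and ground terms with constants from \<open>Y\<close>.\<close>

inductive wsorted :: "('o, 'u) csig \<Rightarrow> ('u \<Rightarrow> 'x set) \<Rightarrow> ('o, 'x) trm \<Rightarrow> 'u \<Rightarrow> bool"
  for \<Sigma> :: "('o, 'u) csig" and Y :: "'u \<Rightarrow> 'x set" where
  "x \<in> Y s \<Longrightarrow> wsorted \<Sigma> Y (Var x) s"
| "\<tau> \<in> cops \<Sigma> \<Longrightarrow> list_all2 (wsorted \<Sigma> Y) ts (cins \<Sigma> \<tau>) \<Longrightarrow> wsorted \<Sigma> Y (Op \<tau> ts) (cout \<Sigma> \<tau>)"

text \<open>A variable is a pair of an index and its sort, so each sort has countably many variables and
  different sorts have different variables. A context is a list of distinct variables.\<close>

type_synonym 'u var = "nat \<times> 'u"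

definition ctx_vars :: "'u var list \<Rightarrow> 'u \<Rightarrow> 'u var set" where
  "ctx_vars vs s = {v \<in> set vs. snd v = s}"

record ('o, 'u) ceqn =
  cctx :: "'u var list"
  clhs :: "('o, 'u var) trm"
  crhs :: "('o, 'u var) trm"
  csrt :: 'u

primrec eval_trm :: "('o, 'u) calg \<Rightarrow> ('x \<Rightarrow> 'u) \<Rightarrow> ('o, 'x) trm \<Rightarrow> 'u" where
  "eval_trm A \<rho> (Var x) = \<rho> x"
| "eval_trm A \<rho> (Op \<tau> ts) = snd A \<tau> (map (eval_trm A \<rho>) ts)"

definition term_fun :: "('o, 'u) calg \<Rightarrow> 'u var list \<Rightarrow> ('o, 'u var) trm \<Rightarrow> 'u list \<Rightarrow> 'u" where
  "term_fun A vs t ds = eval_trm A (\<lambda>v. the (map_of (zip vs ds) v)) t"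

definition csatisfies :: "('o, 'u) calg \<Rightarrow> ('o, 'u) ceqn \<Rightarrow> bool" where
  "csatisfies A e \<longleftrightarrow> (\<forall>ds \<in> args (fst A) (map snd (cctx e)).
     term_fun A (cctx e) (clhs e) ds = term_fun A (cctx e) (crhs e) ds)"

definition classical_theory_cat ::
  "'u::set_universe set \<Rightarrow> ('o, 'u) csig \<Rightarrow> ('o, 'u) ceqn set
     \<Rightarrow> (('o, 'u) calg, ('o, 'u) calg \<times> ('u \<Rightarrow> 'u set_arrow) \<times> ('o, 'u) calg) cat" where
  "classical_theory_cat S \<Sigma> E = full_subcat (classical_alg_cat S \<Sigma>) (\<lambda>A. \<forall>e \<in> E. csatisfies A e)"

definition classical_forget ::
  "(('o, 'u) calg, ('o, 'u) calg \<times> ('u \<Rightarrow> 'u set_arrow) \<times> ('o, 'u) calg,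
    'u \<Rightarrow> 'u set, 'u \<Rightarrow> 'u set_arrow) func" where
  "classical_forget = struct_forget fst"

subsection \<open>Free algebras\<close>

text \<open>Terms are represented in the universe, given encodings \<open>oe\<close> of the operation symbols and \<open>xe\<close>
  of the leaves. The tags make the two kinds of terms distinct.\<close>

definition enc_leaf :: "'u::set_universe \<Rightarrow> 'u" where
  "enc_leaf x = pair point x"

definition enc_op :: "'u::set_universe \<Rightarrow> 'u list \<Rightarrow> 'u" where
  "enc_op c ts = pair (encode_set {point}) (pair c (tup ts))"

primrec enc_trm :: "('o \<Rightarrow> 'u::set_universe) \<Rightarrow> ('x \<Rightarrow> 'u) \<Rightarrow> ('o, 'x) trm \<Rightarrow> 'u" where
  "enc_trm oe xe (Var x) = enc_leaf (xe x)"
| "enc_trm oe xe (Op \<tau> ts) = enc_op (oe \<tau>) (map (enc_trm oe xe) ts)"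

definition term_carrier ::
  "'u::set_universe set \<Rightarrow> ('o, 'u) csig \<Rightarrow> ('o \<Rightarrow> 'u) \<Rightarrow> ('x \<Rightarrow> 'u) \<Rightarrow> ('u \<Rightarrow> 'x set) \<Rightarrow> 'u \<Rightarrow> 'u set" where
  "term_carrier S \<Sigma> oe xe Y = (\<lambda>s\<in>S. enc_trm oe xe ` {t. wsorted \<Sigma> Y t s})"

definition term_alg ::
  "'u::set_universe set \<Rightarrow> ('o, 'u) csig \<Rightarrow> ('o \<Rightarrow> 'u) \<Rightarrow> ('x \<Rightarrow> 'u) \<Rightarrow> ('u \<Rightarrow> 'x set) \<Rightarrow> ('o, 'u) calg" where
  "term_alg S \<Sigma> oe xe Y = (term_carrier S \<Sigma> oe xe Y,
     \<lambda>\<tau> \<in> cops \<Sigma>. \<lambda>ts \<in> args (term_carrier S \<Sigma> oe xe Y) (cins \<Sigma> \<tau>). enc_op (oe \<tau>) ts)"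

definition congruence ::
  "'u set \<Rightarrow> ('o, 'u) csig \<Rightarrow> ('o, 'u) calg \<Rightarrow> ('u \<Rightarrow> 'u rel) \<Rightarrow> bool" where
  "congruence S \<Sigma> D R \<longleftrightarrow> (\<forall>s \<in> S. equiv (fst D s) (R s)) \<and>
     (\<forall>\<tau> \<in> cops \<Sigma>. \<forall>ds \<in> args (fst D) (cins \<Sigma> \<tau>). \<forall>ds' \<in> args (fst D) (cins \<Sigma> \<tau>).
        (\<forall>i < length (cins \<Sigma> \<tau>). (ds ! i, ds' ! i) \<in> R (cins \<Sigma> \<tau> ! i)) \<longrightarrow>
        (snd D \<tau> ds, snd D \<tau> ds') \<in> R (cout \<Sigma> \<tau>))"

definition contains_eqns :: "('o, 'u) calg \<Rightarrow> ('o, 'u) ceqn set \<Rightarrow> ('u \<Rightarrow> 'u rel) \<Rightarrow> bool" where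
  "contains_eqns D E R \<longleftrightarrow> (\<forall>e \<in> E. \<forall>ds \<in> args (fst D) (map snd (cctx e)).
     (term_fun D (cctx e) (clhs e) ds, term_fun D (cctx e) (crhs e) ds) \<in> R (csrt e))"

definition generated_congruence ::
  "'u set \<Rightarrow> ('o, 'u) csig \<Rightarrow> ('o, 'u) calg \<Rightarrow> ('o, 'u) ceqn set \<Rightarrow> 'u \<Rightarrow> 'u rel" where
  "generated_congruence S \<Sigma> D E =
     (\<lambda>s. \<Inter>{R s | R. congruence S \<Sigma> D R \<and> contains_eqns D E R})"

definition quotient_carrier ::
  "'u::set_universe set \<Rightarrow> ('u \<Rightarrow> 'u set) \<Rightarrow> ('u \<Rightarrow> 'u rel) \<Rightarrow> 'u \<Rightarrow> 'u set" where
  "quotient_carrier S D R = (\<lambda>s\<in>S. encode_set ` (D s // R s))"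

definition class_of :: "('u \<Rightarrow> 'u rel) \<Rightarrow> 'u \<Rightarrow> 'u \<Rightarrow> 'u::set_universe" where
  "class_of R s d = encode_set (R s `` {d})"

definition quotient_alg ::
  "'u::set_universe set \<Rightarrow> ('o, 'u) csig \<Rightarrow> ('o, 'u) calg \<Rightarrow> ('u \<Rightarrow> 'u rel) \<Rightarrow> ('o, 'u) calg" where
  "quotient_alg S \<Sigma> D R = (quotient_carrier S (fst D) R,
     \<lambda>\<tau> \<in> cops \<Sigma>. \<lambda>cs \<in> args (quotient_carrier S (fst D) R) (cins \<Sigma> \<tau>).
       THE c. \<exists>ds \<in> args (fst D) (cins \<Sigma> \<tau>).
         cs = map2 (class_of R) (cins \<Sigma> \<tau>) ds \<and> c = class_of R (cout \<Sigma> \<tau>) (snd D \<tau> ds))"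

text \<open>The free algebra of the theory \<open>(\<Sigma>, E)\<close> on an \<open>S\<close>-sorted set \<open>Y\<close>, its unit, and the extension of
  an \<open>S\<close>-sorted function \<open>f\<close> from \<open>Y\<close> to the carrier of \<open>A\<close>.\<close>

definition free_sig_alg ::
  "'u::set_universe set \<Rightarrow> ('o, 'u) csig \<Rightarrow> ('o \<Rightarrow> 'u) \<Rightarrow> ('u \<Rightarrow> 'u set) \<Rightarrow> ('o, 'u) calg" where
  "free_sig_alg S \<Sigma> oe Y = term_alg S \<Sigma> oe (\<lambda>y. y) Y"

definition free_congruence ::
  "'u::set_universe set \<Rightarrow> ('o, 'u) csig \<Rightarrow> ('o, 'u) ceqn set \<Rightarrow> ('o \<Rightarrow> 'u) \<Rightarrow> ('u \<Rightarrow> 'u set) \<Rightarrow> 'u \<Rightarrow> 'u rel" where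
  "free_congruence S \<Sigma> E oe Y = generated_congruence S \<Sigma> (free_sig_alg S \<Sigma> oe Y) E"

definition free_alg ::
  "'u::set_universe set \<Rightarrow> ('o, 'u) csig \<Rightarrow> ('o, 'u) ceqn set \<Rightarrow> ('o \<Rightarrow> 'u) \<Rightarrow> ('u \<Rightarrow> 'u set) \<Rightarrow> ('o, 'u) calg" where
  "free_alg S \<Sigma> E oe Y = quotient_alg S \<Sigma> (free_sig_alg S \<Sigma> oe Y) (free_congruence S \<Sigma> E oe Y)"

definition free_unit ::
  "'u::set_universe set \<Rightarrow> ('o, 'u) csig \<Rightarrow> ('o, 'u) ceqn set \<Rightarrow> ('o \<Rightarrow> 'u) \<Rightarrow> ('u \<Rightarrow> 'u set)
     \<Rightarrow> 'u \<Rightarrow> 'u set_arrow" where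
  "free_unit S \<Sigma> E oe Y = (\<lambda>s\<in>S. set_arr (Y s)
     (\<lambda>y. class_of (free_congruence S \<Sigma> E oe Y) s (enc_leaf y)) (fst (free_alg S \<Sigma> E oe Y) s))"

definition sharp ::
  "'u::set_universe set \<Rightarrow> ('o, 'u) csig \<Rightarrow> ('o, 'u) ceqn set \<Rightarrow> ('o \<Rightarrow> 'u) \<Rightarrow> ('u \<Rightarrow> 'u set)
     \<Rightarrow> ('o, 'u) calg \<Rightarrow> ('u \<Rightarrow> 'u set_arrow)
     \<Rightarrow> ('o, 'u) calg \<times> ('u \<Rightarrow> 'u set_arrow) \<times> ('o, 'u) calg" where
  "sharp S \<Sigma> E oe Y A f =
     (THE h. h \<in> hom (classical_theory_cat S \<Sigma> E) (free_alg S \<Sigma> E oe Y) A \<and>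
        FA classical_forget h \<cdot>\<^bsub>pow_cat S set_cat\<^esub> free_unit S \<Sigma> E oe Y = f)"

definition free_func ::
  "'u::set_universe set \<Rightarrow> ('o, 'u) csig \<Rightarrow> ('o, 'u) ceqn set \<Rightarrow> ('o \<Rightarrow> 'u)
     \<Rightarrow> ('u \<Rightarrow> 'u set, 'u \<Rightarrow> 'u set_arrow,
         ('o, 'u) calg, ('o, 'u) calg \<times> ('u \<Rightarrow> 'u set_arrow) \<times> ('o, 'u) calg) func" where
  "free_func S \<Sigma> E oe = \<lparr>FO = free_alg S \<Sigma> E oe,
     FA = (\<lambda>f. sharp S \<Sigma> E oe (Dom (pow_cat S set_cat) f)
        (free_alg S \<Sigma> E oe (Cod (pow_cat S set_cat) f))
        (free_unit S \<Sigma> E oe (Cod (pow_cat S set_cat) f) \<cdot>\<^bsub>pow_cat S set_cat\<^esub> f))\<rparr>"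

definition free_counit ::
  "'u::set_universe set \<Rightarrow> ('o, 'u) csig \<Rightarrow> ('o, 'u) ceqn set \<Rightarrow> ('o \<Rightarrow> 'u)
     \<Rightarrow> ('o, 'u) calg \<Rightarrow> ('o, 'u) calg \<times> ('u \<Rightarrow> 'u set_arrow) \<times> ('o, 'u) calg" where
  "free_counit S \<Sigma> E oe A = sharp S \<Sigma> E oe (fst A) A (Id (pow_cat S set_cat) (fst A))"

section \<open>Enriched signatures, algebras and equational theories\<close>

record ('u, 'v) esig =
  ops :: "'u set"
  ins :: "'u \<Rightarrow> 'u list"
  out :: "'u \<Rightarrow> 'u"
  par :: "'u \<Rightarrow> 'v"

type_synonym ('u, 'v, 'm) alg = "('u \<Rightarrow> 'v) \<times> ('u \<Rightarrow> 'm)"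

text \<open>A pair of families \<open>elhs\<close>, \<open>erhs\<close> of morphisms indexed by algebras, of type
  \<open>(eins, eout, epar)\<close>.\<close>

record ('u, 'v, 'm) eeqn =
  eins :: "'u list"
  eout :: 'u
  epar :: 'v
  elhs :: "('u, 'v, 'm) alg \<Rightarrow> 'm"
  erhs :: "('u, 'v, 'm) alg \<Rightarrow> 'm"

definition small_family :: "'u::set_universe itself \<Rightarrow> 'e set \<Rightarrow> bool" where
  "small_family TYPE('u) E \<longleftrightarrow> (\<exists>(I :: 'u set) g. small I \<and> E = g ` I)"

context
  fixes V :: "('v, 'm) cat" and U :: "('v, 'm, 'u::set_universe set, 'u set_arrow) func"
    and M :: "('v, 'm) monoidal"
begin

definition lift_arr :: "'v \<Rightarrow> 'v \<Rightarrow> 'u set_arrow \<Rightarrow> 'm" where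
  "lift_arr a b h = (THE m. m \<in> hom V a b \<and> FA U m = h)"

text \<open>The product of \<open>as\<close> in \<open>V\<close> whose underlying set is the product of the underlying sets and
  whose projections are the projections of sets. The elements of the latter are encoded tuples, also
  if \<open>as\<close> has length one.\<close>

definition set_proj :: "'u set list \<Rightarrow> nat \<Rightarrow> 'u set_arrow" where
  "set_proj As i = set_arr (tuples As) (\<lambda>z. untup z ! i) (As ! i)"

definition fprod :: "'v list \<Rightarrow> 'v" where
  "fprod as = (THE p. FO U p = tuples (map (FO U) as) \<and>
     (\<exists>\<pi>s. is_product V as p \<pi>s \<and> (\<forall>i < length as. FA U (\<pi>s ! i) = set_proj (map (FO U) as) i)))"

definition fproj :: "'v list \<Rightarrow> nat \<Rightarrow> 'm" where
  "fproj as i = lift_arr (fprod as) (as ! i) (set_proj (map (FO U) as) i)"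

definition fprod_arr :: "'m list \<Rightarrow> 'm" where
  "fprod_arr fs = (let as = map (Dom V) fs; bs = map (Cod V) fs in
     THE h. h \<in> hom V (fprod as) (fprod bs) \<and>
       (\<forall>i < length fs. fproj bs i \<cdot>\<^bsub>V\<^esub> h = fs ! i \<cdot>\<^bsub>V\<^esub> fproj as i))"

text \<open>\<open>P \<otimes> (A\<^sub>S\<^sub>1 \<times> \<dots> \<times> A\<^sub>S\<^sub>n)\<close> and \<open>1\<^sub>P \<otimes> (f\<^sub>S\<^sub>1 \<times> \<dots> \<times> f\<^sub>S\<^sub>n)\<close>.\<close>

definition arg_obj :: "'v \<Rightarrow> 'u list \<Rightarrow> ('u \<Rightarrow> 'v) \<Rightarrow> 'v" where
  "arg_obj P ss A = P \<otimes>\<^bsub>M\<^esub> fprod (map A ss)"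

definition arg_arr :: "'v \<Rightarrow> 'u list \<Rightarrow> ('u \<Rightarrow> 'm) \<Rightarrow> 'm" where
  "arg_arr P ss f = Id V P \<odot>\<^bsub>M\<^esub> fprod_arr (map f ss)"

definition signature :: "'u set \<Rightarrow> ('u, 'v) esig \<Rightarrow> bool" where
  "signature S \<Sigma> \<longleftrightarrow> small (ops \<Sigma>) \<and>
     (\<forall>\<sigma> \<in> ops \<Sigma>. set (ins \<Sigma> \<sigma>) \<subseteq> S \<and> out \<Sigma> \<sigma> \<in> S \<and> par \<Sigma> \<sigma> \<in> Obj V)"

definition algebras :: "'u set \<Rightarrow> ('u, 'v) esig \<Rightarrow> ('u, 'v, 'm) alg set" where
  "algebras S \<Sigma> = {A. fst A \<in> Obj (pow_cat S V) \<and>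
     snd A \<in> (\<Pi>\<^sub>E \<sigma> \<in> ops \<Sigma>. hom V (arg_obj (par \<Sigma> \<sigma>) (ins \<Sigma> \<sigma>) (fst A)) (fst A (out \<Sigma> \<sigma>)))}"

definition alg_cat ::
  "'u set \<Rightarrow> ('u, 'v) esig
     \<Rightarrow> (('u, 'v, 'm) alg, ('u, 'v, 'm) alg \<times> ('u \<Rightarrow> 'm) \<times> ('u, 'v, 'm) alg) cat" where
  "alg_cat S \<Sigma> = struct_cat (pow_cat S V) (algebras S \<Sigma>) fst
     (\<lambda>A f B. \<forall>\<sigma> \<in> ops \<Sigma>.
        f (out \<Sigma> \<sigma>) \<cdot>\<^bsub>V\<^esub> snd A \<sigma> = snd B \<sigma> \<cdot>\<^bsub>V\<^esub> arg_arr (par \<Sigma> \<sigma>) (ins \<Sigma> \<sigma>) f)"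

definition args_func ::
  "'v \<Rightarrow> 'u list \<Rightarrow> (('u, 'v, 'm) alg, ('u, 'v, 'm) alg \<times> ('u \<Rightarrow> 'm) \<times> ('u, 'v, 'm) alg, 'v, 'm) func" where
  "args_func P ss = \<lparr>FO = (\<lambda>A. arg_obj P ss (fst A)), FA = (\<lambda>(A, f, B). arg_arr P ss f)\<rparr>"

definition sort_func ::
  "'u \<Rightarrow> (('u, 'v, 'm) alg, ('u, 'v, 'm) alg \<times> ('u \<Rightarrow> 'm) \<times> ('u, 'v, 'm) alg, 'v, 'm) func" where
  "sort_func s = \<lparr>FO = (\<lambda>A. fst A s), FA = (\<lambda>(A, f, B). f s)\<rparr>"

definition algebraic_operation ::
  "'u set \<Rightarrow> ('u, 'v) esig \<Rightarrow> 'u list \<Rightarrow> 'u \<Rightarrow> 'v \<Rightarrow> (('u, 'v, 'm) alg \<Rightarrow> 'm) \<Rightarrow> bool" where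
  "algebraic_operation S \<Sigma> ss s P \<omega> \<longleftrightarrow> set ss \<subseteq> S \<and> s \<in> S \<and> P \<in> Obj V \<and>
     nat_trans (alg_cat S \<Sigma>) V (args_func P ss) (sort_func s) \<omega>"

definition equational_theory ::
  "'u set \<Rightarrow> ('u, 'v) esig \<Rightarrow> ('u, 'v, 'm) eeqn set \<Rightarrow> bool" where
  "equational_theory S \<Sigma> E \<longleftrightarrow> signature S \<Sigma> \<and> small_family TYPE('u) E \<and>
     (\<forall>e \<in> E. algebraic_operation S \<Sigma> (eins e) (eout e) (epar e) (elhs e) \<and>
              algebraic_operation S \<Sigma> (eins e) (eout e) (epar e) (erhs e))"

definition theory_cat ::
  "'u set \<Rightarrow> ('u, 'v) esig \<Rightarrow> ('u, 'v, 'm) eeqn set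
     \<Rightarrow> (('u, 'v, 'm) alg, ('u, 'v, 'm) alg \<times> ('u \<Rightarrow> 'm) \<times> ('u, 'v, 'm) alg) cat" where
  "theory_cat S \<Sigma> E = full_subcat (alg_cat S \<Sigma>) (\<lambda>A. \<forall>e \<in> E. elhs e A = erhs e A)"

definition theory_forget ::
  "(('u, 'v, 'm) alg, ('u, 'v, 'm) alg \<times> ('u \<Rightarrow> 'm) \<times> ('u, 'v, 'm) alg, 'u \<Rightarrow> 'v, 'u \<Rightarrow> 'm) func" where
  "theory_forget = struct_forget fst"

section \<open>The underlying classical theory\<close>

text \<open>The operation symbol \<open>\<sigma>\<^sub>p\<close> is the pair \<open>(\<sigma>, p)\<close>.\<close>

definition und_sig :: "('u, 'v) esig \<Rightarrow> ('u \<times> 'u, 'u) csig" where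
  "und_sig \<Sigma> = \<lparr>cops = (SIGMA \<sigma>:ops \<Sigma>. FO U (par \<Sigma> \<sigma>)),
     cins = (\<lambda>(\<sigma>, p). ins \<Sigma> \<sigma>), cout = (\<lambda>(\<sigma>, p). out \<Sigma> \<sigma>)\<rparr>"

definition enc_op_symbol :: "'u \<times> 'u \<Rightarrow> 'u" where "enc_op_symbol = (\<lambda>(\<sigma>, p). pair \<sigma> p)"
definition enc_var :: "'u var \<Rightarrow> 'u" where "enc_var = (\<lambda>(n, s). pair (numeral_of n) s)"

definition und_alg :: "'u set \<Rightarrow> ('u, 'v) esig \<Rightarrow> ('u, 'v, 'm) alg \<Rightarrow> ('u \<times> 'u, 'u) calg" where
  "und_alg S \<Sigma> A = (FO (pow_func S U) (fst A),
     \<lambda>(\<sigma>, p) \<in> cops (und_sig \<Sigma>). \<lambda>ds \<in> args (FO (pow_func S U) (fst A)) (ins \<Sigma> \<sigma>).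
       app (FA U (snd A \<sigma>)) (pair p (tup ds)))"

definition und_func ::
  "'u set \<Rightarrow> ('u, 'v) esig
     \<Rightarrow> (('u, 'v, 'm) alg, ('u, 'v, 'm) alg \<times> ('u \<Rightarrow> 'm) \<times> ('u, 'v, 'm) alg,
         ('u \<times> 'u, 'u) calg, ('u \<times> 'u, 'u) calg \<times> ('u \<Rightarrow> 'u set_arrow) \<times> ('u \<times> 'u, 'u) calg) func" where
  "und_func S \<Sigma> = \<lparr>FO = und_alg S \<Sigma>,
     FA = (\<lambda>(A, f, B). (und_alg S \<Sigma> A, FA (pow_func S U) f, und_alg S \<Sigma> B))\<rparr>"

definition indisc :: "'u set \<Rightarrow> 'v" where
  "indisc Y = (THE a. a \<in> Obj V \<and> FO U a = Y \<and>
     (\<forall>b \<in> Obj V. FO U b = Y \<longrightarrow> fib_le V set_cat U b a))"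

definition indisc_alg :: "'u set \<Rightarrow> ('u, 'v) esig \<Rightarrow> ('u \<times> 'u, 'u) calg \<Rightarrow> ('u, 'v, 'm) alg" where
  "indisc_alg S \<Sigma> D = (let A = (\<lambda>s\<in>S. indisc (fst D s)) in (A,
     \<lambda>\<sigma> \<in> ops \<Sigma>. lift_arr (arg_obj (par \<Sigma> \<sigma>) (ins \<Sigma> \<sigma>) A) (A (out \<Sigma> \<sigma>))
       (set_arr (cart (FO U (par \<Sigma> \<sigma>)) (tuples (map (fst D) (ins \<Sigma> \<sigma>))))
          (\<lambda>z. snd D (\<sigma>, pfst z) (untup (psnd z))) (fst D (out \<Sigma> \<sigma>)))))"

text \<open>The context \<open>v\<^sub>1 : S\<^sub>1, \<dots>, v\<^sub>n : S\<^sub>n\<close>, the algebra of terms in this context, and the term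
  \<open>t\<^sub>\<omega>\<^sub>,\<^sub>p\<close>, decoded from an element of that algebra.\<close>

definition var_ctx :: "'u list \<Rightarrow> 'u var list" where
  "var_ctx ss = List.enumerate 0 ss"

definition ctx_alg :: "'u set \<Rightarrow> ('u, 'v) esig \<Rightarrow> 'u list \<Rightarrow> ('u \<times> 'u, 'u) calg" where
  "ctx_alg S \<Sigma> ss = term_alg S (und_sig \<Sigma>) enc_op_symbol enc_var (ctx_vars (var_ctx ss))"

definition op_term ::
  "'u set \<Rightarrow> ('u, 'v) esig \<Rightarrow> 'u list \<Rightarrow> 'u \<Rightarrow> (('u, 'v, 'm) alg \<Rightarrow> 'm) \<Rightarrow> 'u \<Rightarrow> ('u \<times> 'u, 'u var) trm" where
  "op_term S \<Sigma> ss s \<omega> p = (THE t. wsorted (und_sig \<Sigma>) (ctx_vars (var_ctx ss)) t s \<and>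
     enc_trm enc_op_symbol enc_var t =
       app (FA U (\<omega> (indisc_alg S \<Sigma> (ctx_alg S \<Sigma> ss))))
         (pair p (tup (map (\<lambda>v. enc_trm enc_op_symbol enc_var (Var v)) (var_ctx ss)))))"

definition und_eqns ::
  "'u set \<Rightarrow> ('u, 'v) esig \<Rightarrow> ('u, 'v, 'm) eeqn set \<Rightarrow> ('u \<times> 'u, 'u) ceqn set" where
  "und_eqns S \<Sigma> E = {\<lparr>cctx = var_ctx (eins e),
      clhs = op_term S \<Sigma> (eins e) (eout e) (elhs e) p,
      crhs = op_term S \<Sigma> (eins e) (eout e) (erhs e) p, csrt = eout e\<rparr>
    | e p. e \<in> E \<and> p \<in> FO U (epar e)}"

text \<open>The objects of the comma category of an object \<open>X\<close> of \<open>V\<^sup>S\<close> over the forgetful functor.\<close>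

definition comma ::
  "'u set \<Rightarrow> ('u, 'v) esig \<Rightarrow> ('u, 'v, 'm) eeqn set \<Rightarrow> ('u \<Rightarrow> 'v) \<Rightarrow> (('u, 'v, 'm) alg \<times> ('u \<Rightarrow> 'm)) set" where
  "comma S \<Sigma> E X = {(A, f). A \<in> Obj (theory_cat S \<Sigma> E) \<and> f \<in> hom (pow_cat S V) X (FO theory_forget A)}"

definition und_sharp ::
  "'u set \<Rightarrow> ('u, 'v) esig \<Rightarrow> ('u, 'v, 'm) eeqn set \<Rightarrow> ('u \<Rightarrow> 'v) \<Rightarrow> ('u, 'v, 'm) alg \<Rightarrow> ('u \<Rightarrow> 'm)
     \<Rightarrow> ('u \<times> 'u, 'u) calg \<times> ('u \<Rightarrow> 'u set_arrow) \<times> ('u \<times> 'u, 'u) calg" where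
  "und_sharp S \<Sigma> E X A f = sharp S (und_sig \<Sigma>) (und_eqns S \<Sigma> E) enc_op_symbol
     (FO (pow_func S U) X) (und_alg S \<Sigma> A) (FA (pow_func S U) f)"

end

end

theory Submission
  imports Defs
begin

text \<open>The functor from algebras of the enriched theory to algebras of the underlying classical theory
  is topological: the initial lift of a structured source is formed on carriers, and the operations
  of the given classical algebra are admissible for it, since their composites with the components
  of the source are. That the result satisfies the equations can be checked on underlying
  classical algebras, because an algebraic operation is given by terms. So both vertical
  functors are topological, the forgetful functor preserves initial lifts, and the adjunction lifts
  by Wyler's taut lift theorem from the classical one, which is constructed from terms modulo
  the generated congruence.\<close>

section \<open>Powers, categories of structures and full subcategories\<close>

text \<open>The theorem asks for equalities of objects, not isomorphisms: underlying algebras of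
  free algebras must equal the classical free algebras, and the initial lift must be unique.
  Amnesticity provides this, and the same uniqueness gives meaning to the definite descriptions
  behind \<open>fprod\<close> and \<open>indisc\<close>.

  Faithfulness is the second recurring device: an equation between morphisms of \<open>V\<close> is
  an equation between functions. So homomorphisms on both levels are compared as bare families of
  functions (\<open>sorted_hom\<close>), and elements of argument objects are encoded pairs
  \<open>pair p (tup ds)\<close>, exactly so because \<open>U\<close> is strict monoidal.

  The main obstacle is that an algebraic operation is only a natural transformation and carries no
  syntax. Every classical homomorphism into \<open>D\<close> is a morphism into the indiscrete
  algebra on \<open>D\<close>, so naturality becomes available along evaluation of terms, which is
  not a morphism into an arbitrary algebra. A second obstacle is size: terms must form a small set
  in a universe whose axioms do not include power sets. Finite arities and countably many stages
  suffice.\<close>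

lemma homD:
  assumes "f \<in> hom C a b"
  shows "f \<in> Arr C" "Dom C f = a" "Cod C f = b"
  using assms by (auto simp: hom_def)

lemma (in category) hom_Obj:
  assumes "f \<in> hom C a b"
  shows "a \<in> Obj C" "b \<in> Obj C"
  using assms Dom_Obj Cod_Obj by (auto simp: hom_def)

lemma Obj_pow_cat: "Obj (pow_cat S C) = S \<rightarrow>\<^sub>E Obj C"
  by (simp add: pow_cat_def)

lemma Id_pow_cat: "Id (pow_cat S C) a = (\<lambda>s\<in>S. Id C (a s))"
  by (simp add: pow_cat_def)

lemma Cmp_pow_cat: "g \<cdot>\<^bsub>pow_cat S C\<^esub> f = (\<lambda>s\<in>S. g s \<cdot>\<^bsub>C\<^esub> f s)"
  by (simp add: pow_cat_def)

lemma restrict_eq_iff: "restrict g S = a \<longleftrightarrow> a \<in> extensional S \<and> (\<forall>s\<in>S. g s = a s)"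
  by (auto simp: restrict_def extensional_def fun_eq_iff)

text \<open>Domain and codomain in the power are computed by restriction to \<open>S\<close>, which
  is why extensionality of \<open>a\<close> and \<open>b\<close> appears along with that of
  \<open>f\<close>.\<close>

lemma hom_pow_cat_iff:
  "f \<in> hom (pow_cat S C) a b \<longleftrightarrow>
     a \<in> extensional S \<and> b \<in> extensional S \<and> f \<in> extensional S \<and> (\<forall>s\<in>S. f s \<in> hom C (a s) (b s))"
  by (auto simp: hom_def pow_cat_def PiE_def restrict_eq_iff)

lemma category_pow_cat:
  assumes "category C"
  shows "category (pow_cat S C)"
proof -
  interpret category C by fact
  show ?thesis
  proof
    fix f assume "f \<in> Arr (pow_cat S C)"
    then show "Dom (pow_cat S C) f \<in> Obj (pow_cat S C)" "Cod (pow_cat S C) f \<in> Obj (pow_cat S C)"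
      using Dom_Obj Cod_Obj by (auto simp: pow_cat_def PiE_iff)
  next
    fix f a b assume "f \<in> hom (pow_cat S C) a b"
    then show "Id (pow_cat S C) b \<cdot>\<^bsub>pow_cat S C\<^esub> f = f" "f \<cdot>\<^bsub>pow_cat S C\<^esub> Id (pow_cat S C) a = f"
      using Id_left Id_right
      by (auto simp: hom_pow_cat_iff Id_pow_cat Cmp_pow_cat intro!: extensionalityI[of _ S])
  next
    fix f g h a b c d
    assume "f \<in> hom (pow_cat S C) a b" "g \<in> hom (pow_cat S C) b c" "h \<in> hom (pow_cat S C) c d"
    then show "h \<cdot>\<^bsub>pow_cat S C\<^esub> g \<cdot>\<^bsub>pow_cat S C\<^esub> f = h \<cdot>\<^bsub>pow_cat S C\<^esub> (g \<cdot>\<^bsub>pow_cat S C\<^esub> f)"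
      by (auto simp: hom_pow_cat_iff Cmp_pow_cat intro!: restrict_ext Cmp_assoc)
  qed (auto simp: hom_pow_cat_iff Id_pow_cat Cmp_pow_cat Obj_pow_cat PiE_iff intro: Id_hom Cmp_hom)
qed

lemma is_functor_pow_func:
  assumes "is_functor C D F"
  shows "is_functor (pow_cat S C) (pow_cat S D) (pow_func S F)"
proof -
  interpret is_functor C D F by fact
  interpret C: category "pow_cat S C" by (rule category_pow_cat) unfold_locales
  interpret D: category "pow_cat S D" by (rule category_pow_cat) unfold_locales
  show ?thesis
  proof
    fix f g a b c
    assume "f \<in> hom (pow_cat S C) a b" "g \<in> hom (pow_cat S C) b c"
    then show "FA (pow_func S F) (g \<cdot>\<^bsub>pow_cat S C\<^esub> f)
        = FA (pow_func S F) g \<cdot>\<^bsub>pow_cat S D\<^esub> FA (pow_func S F) f"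
      by (auto simp: pow_func_def hom_pow_cat_iff Cmp_pow_cat intro!: restrict_ext FA_Cmp)
  qed (auto simp: hom_pow_cat_iff Id_pow_cat Cmp_pow_cat Obj_pow_cat PiE_iff pow_func_def
         intro: FA_hom FO_Obj intro!: restrict_ext FA_Id)
qed

lemma Obj_struct_cat [simp]: "Obj (struct_cat B Ob car P) = Ob"
  by (simp add: struct_cat_def)

lemma hom_struct_cat_iff:
  "f \<in> hom (struct_cat B Ob car P) a b \<longleftrightarrow>
     a \<in> Ob \<and> b \<in> Ob \<and> (\<exists>g \<in> hom B (car a) (car b). P a g b \<and> f = (a, g, b))"
  by (auto simp: hom_def struct_cat_def)

lemma category_struct_cat:
  assumes "category B"
    and car: "\<And>a. a \<in> Ob \<Longrightarrow> car a \<in> Obj B"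
    and P_Id: "\<And>a. a \<in> Ob \<Longrightarrow> P a (Id B (car a)) a"
    and P_Cmp: "\<And>a b c f g. \<lbrakk>a \<in> Ob; b \<in> Ob; c \<in> Ob; f \<in> hom B (car a) (car b);
        g \<in> hom B (car b) (car c); P a f b; P b g c\<rbrakk> \<Longrightarrow> P a (g \<cdot>\<^bsub>B\<^esub> f) c"
  shows "category (struct_cat B Ob car P)"
proof -
  interpret category B by fact
  show ?thesis
  proof
    fix f a b assume f: "f \<in> hom (struct_cat B Ob car P) a b"
    show "Id (struct_cat B Ob car P) b \<cdot>\<^bsub>struct_cat B Ob car P\<^esub> f = f"
      "f \<cdot>\<^bsub>struct_cat B Ob car P\<^esub> Id (struct_cat B Ob car P) a = f"
      using f Id_left Id_right by (auto simp: hom_struct_cat_iff) (auto simp: struct_cat_def)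
    fix g c assume g: "g \<in> hom (struct_cat B Ob car P) b c"
    show "g \<cdot>\<^bsub>struct_cat B Ob car P\<^esub> f \<in> hom (struct_cat B Ob car P) a c"
      using f g Cmp_hom P_Cmp
      unfolding hom_struct_cat_iff by (auto simp: struct_cat_def)
    fix h d assume h: "h \<in> hom (struct_cat B Ob car P) c d"
    show "h \<cdot>\<^bsub>struct_cat B Ob car P\<^esub> g \<cdot>\<^bsub>struct_cat B Ob car P\<^esub> f
        = h \<cdot>\<^bsub>struct_cat B Ob car P\<^esub> (g \<cdot>\<^bsub>struct_cat B Ob car P\<^esub> f)"
      using f g h Cmp_assoc by (auto simp: hom_struct_cat_iff) (auto simp: struct_cat_def)
  next
    fix a assume "a \<in> Obj (struct_cat B Ob car P)"
    then show "Id (struct_cat B Ob car P) a \<in> hom (struct_cat B Ob car P) a a"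
      using Id_hom car P_Id unfolding hom_struct_cat_iff by (auto simp: struct_cat_def)
  qed (auto simp: struct_cat_def)
qed

lemma is_functor_struct_forget:
  assumes "category B" "category (struct_cat B Ob car P)"
    and "\<And>a. a \<in> Ob \<Longrightarrow> car a \<in> Obj B"
  shows "is_functor (struct_cat B Ob car P) B (struct_forget car)"
proof -
  interpret B: category B by fact
  interpret A: category "struct_cat B Ob car P" by fact
  show ?thesis
  proof
    fix f g a b c
    assume "f \<in> hom (struct_cat B Ob car P) a b" "g \<in> hom (struct_cat B Ob car P) b c"
    then show "FA (struct_forget car) (g \<cdot>\<^bsub>struct_cat B Ob car P\<^esub> f)
        = FA (struct_forget car) g \<cdot>\<^bsub>B\<^esub> FA (struct_forget car) f"
      by (auto simp: hom_struct_cat_iff) (auto simp: struct_cat_def struct_forget_def)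
  qed (auto simp: hom_struct_cat_iff struct_forget_def assms(3), auto simp: struct_cat_def)
qed

lemma full_subcat_simps [simp]:
  "Obj (full_subcat C P) = {a \<in> Obj C. P a}"
  "Dom (full_subcat C P) = Dom C" "Cod (full_subcat C P) = Cod C"
  "Id (full_subcat C P) = Id C" "Cmp (full_subcat C P) = Cmp C"
  by (auto simp: full_subcat_def)

lemma hom_full_subcat_iff: "f \<in> hom (full_subcat C P) a b \<longleftrightarrow> f \<in> hom C a b \<and> P a \<and> P b"
  by (auto simp: hom_def full_subcat_def)

lemma category_full_subcat:
  assumes "category C"
  shows "category (full_subcat C P)"
proof -
  interpret category C by fact
  show ?thesis
    by standard (auto simp: hom_full_subcat_iff Id_left Id_right Cmp_assoc
        intro: Id_hom Cmp_hom Dom_Obj Cod_Obj, auto simp: full_subcat_def Dom_Obj Cod_Obj)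
qed

lemma is_functor_full_subcat:
  assumes "is_functor C D F" and PQ: "\<And>a. a \<in> Obj C \<Longrightarrow> P a \<Longrightarrow> Q (FO F a)"
  shows "is_functor (full_subcat C P) (full_subcat D Q) F"
proof -
  interpret is_functor C D F by fact
  interpret C: category "full_subcat C P" by (rule category_full_subcat) unfold_locales
  interpret D: category "full_subcat D Q" by (rule category_full_subcat) unfold_locales
  show ?thesis
    by standard (auto simp: hom_full_subcat_iff intro: FA_hom FO_Obj FA_Id FA_Cmp PQ dest: dom.hom_Obj)
qed

text \<open>With the trivial predicate on the target, \<open>is_functor_full_subcat\<close> also
  restricts a functor on its source alone, as happens for the forgetful functors of
  theories.\<close>

lemma full_subcat_top: "full_subcat C (\<lambda>_. True) = C"
  by (simp add: full_subcat_def)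

section \<open>Adjunctions from universal arrows\<close>

text \<open>A universal arrow from every \<open>b\<close> to \<open>G\<close>, with extension as a
  chosen function \<open>sh\<close>: \<open>sh_unit\<close> is existence and
  \<open>sh_unique\<close> is uniqueness, stated as recovery of \<open>h\<close> from its composite
  with the unit. The classical and the lifted adjunction are both instances, so naturality and the
  triangle laws are proved once.\<close>

locale universal_arrows = is_functor A B G
  for A :: "('a, 'm) cat" and B :: "('b, 'n) cat" and G :: "('a, 'm, 'b, 'n) func" +
  fixes Fo :: "'b \<Rightarrow> 'a" and \<eta> :: "'b \<Rightarrow> 'n" and sh :: "'b \<Rightarrow> 'a \<Rightarrow> 'n \<Rightarrow> 'm"
  assumes Fo_Obj: "b \<in> Obj B \<Longrightarrow> Fo b \<in> Obj A"
    and unit_hom: "b \<in> Obj B \<Longrightarrow> \<eta> b \<in> hom B b (FO G (Fo b))"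
    and sh_hom: "b \<in> Obj B \<Longrightarrow> a \<in> Obj A \<Longrightarrow> f \<in> hom B b (FO G a) \<Longrightarrow> sh b a f \<in> hom A (Fo b) a"
    and sh_unit: "b \<in> Obj B \<Longrightarrow> a \<in> Obj A \<Longrightarrow> f \<in> hom B b (FO G a) \<Longrightarrow>
          FA G (sh b a f) \<cdot>\<^bsub>B\<^esub> \<eta> b = f"
    and sh_unique: "b \<in> Obj B \<Longrightarrow> a \<in> Obj A \<Longrightarrow> h \<in> hom A (Fo b) a \<Longrightarrow>
          sh b a (FA G h \<cdot>\<^bsub>B\<^esub> \<eta> b) = h"
begin

text \<open>The formulas for \<open>left_adj\<close> and \<open>counit\<close> have the shape of
  \<open>free_func\<close> and \<open>free_counit\<close>, so that the classical instance agrees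
  with these by unfolding.\<close>

definition left_adj :: "('b, 'n, 'a, 'm) func" where
  "left_adj = \<lparr>FO = Fo, FA = (\<lambda>f. sh (Dom B f) (Fo (Cod B f)) (\<eta> (Cod B f) \<cdot>\<^bsub>B\<^esub> f))\<rparr>"

definition counit :: "'a \<Rightarrow> 'm" where
  "counit a = sh (FO G a) a (Id B (FO G a))"

text \<open>\<open>sh\<close> recovers both morphisms from the same composite with the unit. The
  functor laws, naturality of the counit and one triangle law reduce to this cancellation.\<close>

lemma ext_unit:
  assumes "b \<in> Obj B" "h \<in> hom A (Fo b) a" "h' \<in> hom A (Fo b) a"
    and "FA G h \<cdot>\<^bsub>B\<^esub> \<eta> b = FA G h' \<cdot>\<^bsub>B\<^esub> \<eta> b"
  shows "h = h'"
  using assms sh_unique dom.hom_Obj by metis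

lemma FO_left_adj [simp]: "FO left_adj = Fo"
  by (simp add: left_adj_def)

lemma left_adj_arr:
  assumes "f \<in> hom B b b'"
  shows "FA left_adj f \<in> hom A (Fo b) (Fo b')"
    and "FA G (FA left_adj f) \<cdot>\<^bsub>B\<^esub> \<eta> b = \<eta> b' \<cdot>\<^bsub>B\<^esub> f"
proof -
  have "\<eta> b' \<cdot>\<^bsub>B\<^esub> f \<in> hom B b (FO G (Fo b'))"
    using assms unit_hom cod.hom_Obj cod.Cmp_hom by metis
  then show "FA left_adj f \<in> hom A (Fo b) (Fo b')"
    and "FA G (FA left_adj f) \<cdot>\<^bsub>B\<^esub> \<eta> b = \<eta> b' \<cdot>\<^bsub>B\<^esub> f"
    using assms sh_hom sh_unit cod.hom_Obj[OF assms] Fo_Obj homD[OF assms]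
    by (auto simp: left_adj_def)
qed

lemma counit_arr:
  assumes "a \<in> Obj A"
  shows "counit a \<in> hom A (Fo (FO G a)) a"
    and "FA G (counit a) \<cdot>\<^bsub>B\<^esub> \<eta> (FO G a) = Id B (FO G a)"
  using assms sh_hom sh_unit FO_Obj cod.Id_hom by (auto simp: counit_def)

lemma G_Cmp_unit:
  assumes "b \<in> Obj B" "h \<in> hom A (Fo b) a" "k \<in> hom A a a'"
  shows "FA G (k \<cdot>\<^bsub>A\<^esub> h) \<cdot>\<^bsub>B\<^esub> \<eta> b = FA G k \<cdot>\<^bsub>B\<^esub> (FA G h \<cdot>\<^bsub>B\<^esub> \<eta> b)"
  using FA_Cmp[OF assms(2,3)] cod.Cmp_assoc[OF unit_hom[OF assms(1)] FA_hom[OF assms(2)] FA_hom[OF assms(3)]]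
  by simp

lemma is_functor_left_adj: "is_functor B A left_adj"
proof
  fix b assume b: "b \<in> Obj B"
  then have Id: "Id B b \<in> hom B b b"
    by (rule cod.Id_hom)
  show "FA left_adj (Id B b) = Id A (FO left_adj b)"
    using left_adj_arr[OF Id] dom.Id_hom[OF Fo_Obj[OF b]] FA_Id[OF Fo_Obj[OF b]]
      cod.Id_left[OF unit_hom[OF b]] cod.Id_right[OF unit_hom[OF b]]
    by (intro ext_unit[OF b, of _ "Fo b"]) auto
next
  fix f g b b' b'' assume fg: "f \<in> hom B b b'" "g \<in> hom B b' b''"
  then have b: "b \<in> Obj B" "b' \<in> Obj B" "b'' \<in> Obj B"
    using cod.hom_Obj by auto
  note gf = cod.Cmp_hom[OF fg]
  show "FA left_adj (g \<cdot>\<^bsub>B\<^esub> f) = FA left_adj g \<cdot>\<^bsub>A\<^esub> FA left_adj f"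
  proof (rule ext_unit[OF b(1)])
    show "FA left_adj (g \<cdot>\<^bsub>B\<^esub> f) \<in> hom A (Fo b) (Fo b'')"
      by (rule left_adj_arr(1)[OF gf])
    show "FA left_adj g \<cdot>\<^bsub>A\<^esub> FA left_adj f \<in> hom A (Fo b) (Fo b'')"
      using fg left_adj_arr(1) dom.Cmp_hom by blast
    have "FA G (FA left_adj g \<cdot>\<^bsub>A\<^esub> FA left_adj f) \<cdot>\<^bsub>B\<^esub> \<eta> b = FA G (FA left_adj g) \<cdot>\<^bsub>B\<^esub> (\<eta> b' \<cdot>\<^bsub>B\<^esub> f)"
      using G_Cmp_unit[OF b(1) left_adj_arr(1)[OF fg(1)] left_adj_arr(1)[OF fg(2)]]
        left_adj_arr(2)[OF fg(1)] by simp
    also have "\<dots> = (FA G (FA left_adj g) \<cdot>\<^bsub>B\<^esub> \<eta> b') \<cdot>\<^bsub>B\<^esub> f"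
      using cod.Cmp_assoc[OF fg(1) unit_hom[OF b(2)] FA_hom[OF left_adj_arr(1)[OF fg(2)]]] by simp
    also have "\<dots> = (\<eta> b'' \<cdot>\<^bsub>B\<^esub> g) \<cdot>\<^bsub>B\<^esub> f"
      using left_adj_arr(2)[OF fg(2)] by simp
    also have "\<dots> = \<eta> b'' \<cdot>\<^bsub>B\<^esub> (g \<cdot>\<^bsub>B\<^esub> f)"
      using cod.Cmp_assoc[OF fg unit_hom[OF b(3)]] .
    finally show "FA G (FA left_adj (g \<cdot>\<^bsub>B\<^esub> f)) \<cdot>\<^bsub>B\<^esub> \<eta> b
        = FA G (FA left_adj g \<cdot>\<^bsub>A\<^esub> FA left_adj f) \<cdot>\<^bsub>B\<^esub> \<eta> b"
      using left_adj_arr(2)[OF gf] by simp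
  qed
qed (use left_adj_arr(1) Fo_Obj in auto)

text \<open>Naturality of the unit is the defining property of \<open>left_adj\<close> on morphisms,
  and the triangle law at \<open>G\<close> is that of the counit. The two remaining laws concern
  morphisms out of a free object, so they are compared after composition with the unit.\<close>

lemma adjunction_left_adj: "adjunction A B left_adj G \<eta> counit"
  unfolding adjunction_def nat_trans_def
proof (intro conjI ballI allI)
  show "is_functor B A left_adj" by (rule is_functor_left_adj)
  show "is_functor A B G" by unfold_locales
next
  fix b assume "b \<in> Obj B"
  then show "\<eta> b \<in> hom B (FO id_func b) (FO (G \<circ>\<^sub>F left_adj) b)"
    by (simp add: id_func_def comp_func_def unit_hom)
next
  fix b b' f assume "f \<in> hom B b b'"
  then show "FA (G \<circ>\<^sub>F left_adj) f \<cdot>\<^bsub>B\<^esub> \<eta> b = \<eta> b' \<cdot>\<^bsub>B\<^esub> FA id_func f"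
    by (simp add: id_func_def comp_func_def left_adj_arr)
next
  fix a assume "a \<in> Obj A"
  then show "counit a \<in> hom A (FO (left_adj \<circ>\<^sub>F G) a) (FO id_func a)"
    and "FA G (counit a) \<cdot>\<^bsub>B\<^esub> \<eta> (FO G a) = Id B (FO G a)"
    by (simp_all add: id_func_def comp_func_def counit_arr)
next
  fix a a' f assume f: "f \<in> hom A a a'"
  then have a: "a \<in> Obj A" "a' \<in> Obj A"
    using dom.hom_Obj by auto
  note b = FO_Obj[OF a(1)]
  note Gf = FA_hom[OF f]
  have "f \<cdot>\<^bsub>A\<^esub> counit a = counit a' \<cdot>\<^bsub>A\<^esub> FA left_adj (FA G f)"
  proof (rule ext_unit[OF b])
    show "f \<cdot>\<^bsub>A\<^esub> counit a \<in> hom A (Fo (FO G a)) a'"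
      using counit_arr(1)[OF a(1)] f by (rule dom.Cmp_hom)
    show "counit a' \<cdot>\<^bsub>A\<^esub> FA left_adj (FA G f) \<in> hom A (Fo (FO G a)) a'"
      using left_adj_arr(1)[OF Gf] counit_arr(1)[OF a(2)] by (rule dom.Cmp_hom)
    have "FA G (f \<cdot>\<^bsub>A\<^esub> counit a) \<cdot>\<^bsub>B\<^esub> \<eta> (FO G a) = FA G f"
      using G_Cmp_unit[OF b counit_arr(1)[OF a(1)] f] counit_arr(2)[OF a(1)] Gf cod.Id_right by simp
    moreover have "FA G (counit a' \<cdot>\<^bsub>A\<^esub> FA left_adj (FA G f)) \<cdot>\<^bsub>B\<^esub> \<eta> (FO G a)
        = FA G (counit a') \<cdot>\<^bsub>B\<^esub> (\<eta> (FO G a') \<cdot>\<^bsub>B\<^esub> FA G f)"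
      using G_Cmp_unit[OF b left_adj_arr(1)[OF Gf] counit_arr(1)[OF a(2)]] left_adj_arr(2)[OF Gf] by simp
    moreover have "\<dots> = FA G f"
      using cod.Cmp_assoc[OF Gf unit_hom[OF FO_Obj[OF a(2)]] FA_hom[OF counit_arr(1)[OF a(2)]]]
        counit_arr(2)[OF a(2)] Gf cod.Id_left by simp
    ultimately show "FA G (f \<cdot>\<^bsub>A\<^esub> counit a) \<cdot>\<^bsub>B\<^esub> \<eta> (FO G a)
        = FA G (counit a' \<cdot>\<^bsub>A\<^esub> FA left_adj (FA G f)) \<cdot>\<^bsub>B\<^esub> \<eta> (FO G a)"
      by simp
  qed
  then show "FA id_func f \<cdot>\<^bsub>A\<^esub> counit a = counit a' \<cdot>\<^bsub>A\<^esub> FA (left_adj \<circ>\<^sub>F G) f"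
    by (simp add: id_func_def comp_func_def)
next
  fix b assume b: "b \<in> Obj B"
  note Fb = Fo_Obj[OF b]
  note Ff = left_adj_arr[OF unit_hom[OF b]]
  note \<epsilon> = counit_arr[OF Fb]
  have "counit (Fo b) \<cdot>\<^bsub>A\<^esub> FA left_adj (\<eta> b) = Id A (Fo b)"
  proof (rule ext_unit[OF b])
    show "counit (Fo b) \<cdot>\<^bsub>A\<^esub> FA left_adj (\<eta> b) \<in> hom A (Fo b) (Fo b)"
      using Ff(1) \<epsilon>(1) by (rule dom.Cmp_hom)
    show "Id A (Fo b) \<in> hom A (Fo b) (Fo b)"
      using Fb by (rule dom.Id_hom)
    have "FA G (counit (Fo b) \<cdot>\<^bsub>A\<^esub> FA left_adj (\<eta> b)) \<cdot>\<^bsub>B\<^esub> \<eta> b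
        = FA G (counit (Fo b)) \<cdot>\<^bsub>B\<^esub> (\<eta> (FO G (Fo b)) \<cdot>\<^bsub>B\<^esub> \<eta> b)"
      using G_Cmp_unit[OF b Ff(1) \<epsilon>(1)] Ff(2) by simp
    also have "\<dots> = Id B (FO G (Fo b)) \<cdot>\<^bsub>B\<^esub> \<eta> b"
      using cod.Cmp_assoc[OF unit_hom[OF b] unit_hom[OF FO_Obj[OF Fb]] FA_hom[OF \<epsilon>(1)]] \<epsilon>(2) by simp
    finally show "FA G (counit (Fo b) \<cdot>\<^bsub>A\<^esub> FA left_adj (\<eta> b)) \<cdot>\<^bsub>B\<^esub> \<eta> b
        = FA G (Id A (Fo b)) \<cdot>\<^bsub>B\<^esub> \<eta> b"
      using Fb FA_Id by simp
  qed
  then show "counit (FO left_adj b) \<cdot>\<^bsub>A\<^esub> FA left_adj (\<eta> b) = Id A (FO left_adj b)"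
    by simp
qed

end

section \<open>Topological functors\<close>

lemma (in is_functor) admissible_iff: "admissible C D F a b h \<longleftrightarrow> (\<exists>g \<in> hom C a b. FA F g = h)"
  using FA_hom by (auto simp: admissible_def)

lemma (in is_functor) admissible_Cmp:
  assumes "admissible C D F a b f" "admissible C D F b c g"
  shows "admissible C D F a c (g \<cdot>\<^bsub>D\<^esub> f)"
proof -
  obtain f' g' where "f' \<in> hom C a b" "g' \<in> hom C b c" "FA F f' = f" "FA F g' = g"
    using assms by (auto simp: admissible_iff)
  then show ?thesis
    using FA_Cmp dom.Cmp_hom unfolding admissible_iff by blast
qed

lemma initial_lift_domainD:
  assumes "initial_lift_domain V X U x K a"
  shows "a \<in> Obj V" "FO U a = x"
    and "\<And>b f. (b, f) \<in> K \<Longrightarrow> admissible V X U a b f"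
    and "\<And>w g. w \<in> Obj V \<Longrightarrow> g \<in> hom X (FO U w) x \<Longrightarrow>
      (\<And>b f. (b, f) \<in> K \<Longrightarrow> admissible V X U w b (f \<cdot>\<^bsub>X\<^esub> g)) \<Longrightarrow> admissible V X U w a g"
  using assms unfolding initial_lift_domain_def initial_source_def by blast+

context topological
begin

lemma faithfulD:
  assumes "f \<in> hom V a b" "g \<in> hom V a b" "FA U f = FA U g"
  shows "f = g"
  using assms faithful by (auto simp: faithful_def)

text \<open>The identity of \<open>x\<close> passes the admissibility test of either lift, so each
  lift lies below the other in the fibre and amnesticity applies. This turns statements up to
  isomorphism into strict ones and yields the equivalences with \<open>B = FO F X\<close> in the
  theorem.\<close>

lemma initial_lift_domain_unique:
  assumes a: "initial_lift_domain V X U x K a" and b: "initial_lift_domain V X U x K b"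
  shows "a = b"
proof -
  have "fib_le V X U a b" if a: "initial_lift_domain V X U x K a" and b: "initial_lift_domain V X U x K b" for a b
  proof -
    have x: "a \<in> Obj V" "b \<in> Obj V" "FO U a = x" "FO U b = x" "Id X x \<in> hom X x x"
      using a b FO_Obj cod.Id_hom by (auto simp: initial_lift_domain_def)
    have "admissible V X U a c (f \<cdot>\<^bsub>X\<^esub> Id X x)" if "(c, f) \<in> K" for c f
    proof -
      have "admissible V X U a c f"
        using a that by (auto simp: initial_lift_domain_def initial_source_def)
      moreover from this have "f \<cdot>\<^bsub>X\<^esub> Id X x = f"
        using x cod.Id_right by (auto simp: admissible_def)
      ultimately show ?thesis
        by simp
    qed
    then show ?thesis
      using b x unfolding fib_le_def initial_lift_domain_def initial_source_def by auto
  qed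
  then show ?thesis
    using assms amnestic by (auto simp: initial_lift_domain_def)
qed

end

text \<open>Admissibility in the power is admissibility in each sort, so a lift that is initial in
  every sort is initial. The sortwise criterion is a conclusion of its own because lifting the
  operations of an algebra needs initiality in a single sort.\<close>

lemma topological_pow_func:
  assumes "topological V X U"
  shows "topological (pow_cat S V) (pow_cat S X) (pow_func S U)"
    and initial_lift_domain_pow_funcI: "\<And>x K a. structured_source (pow_cat S V) (pow_cat S X) (pow_func S U) x K \<Longrightarrow>
      a \<in> extensional S \<Longrightarrow>
      (\<And>s. s \<in> S \<Longrightarrow> initial_lift_domain V X U (x s) ((\<lambda>(b, f). (b s, f s)) ` K) (a s)) \<Longrightarrow>
      initial_lift_domain (pow_cat S V) (pow_cat S X) (pow_func S U) x K a"
    and structured_source_pow_funcD: "\<And>x K s. structured_source (pow_cat S V) (pow_cat S X) (pow_func S U) x K \<Longrightarrow>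
      s \<in> S \<Longrightarrow> structured_source V X U (x s) ((\<lambda>(b, f). (b s, f s)) ` K)"
proof -
  interpret topological V X U by fact
  interpret P: is_functor "pow_cat S V" "pow_cat S X" "pow_func S U"
    by (rule is_functor_pow_func) unfold_locales
  have adm: "admissible (pow_cat S V) (pow_cat S X) (pow_func S U) a b f \<longleftrightarrow>
      a \<in> extensional S \<and> b \<in> extensional S \<and> f \<in> extensional S \<and> (\<forall>s\<in>S. admissible V X U (a s) (b s) (f s))"
    (is "?l \<longleftrightarrow> ?r") for a b f
  proof
    assume ?l
    then show ?r
      by (auto simp: admissible_def hom_pow_cat_iff pow_func_def)
  next
    assume r: ?r
    then have "\<forall>s\<in>S. \<exists>g. g \<in> hom V (a s) (b s) \<and> FA U g = f s"
      by (auto simp: admissible_def)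
    then obtain g where g: "\<forall>s\<in>S. g s \<in> hom V (a s) (b s) \<and> FA U (g s) = f s"
      by metis
    then have "restrict g S \<in> hom (pow_cat S V) a b" "FA (pow_func S U) (restrict g S) = f"
      using r by (auto simp: hom_pow_cat_iff pow_func_def intro!: extensionalityI[of _ S])
    then show ?l
      using P.FA_hom by (auto simp: admissible_def)
  qed
  show source: "structured_source V X U (x s) ((\<lambda>(b, f). (b s, f s)) ` K)"
    if "structured_source (pow_cat S V) (pow_cat S X) (pow_func S U) x K" "s \<in> S" for x K s
    using that by (fastforce simp: structured_source_def hom_pow_cat_iff Obj_pow_cat pow_func_def PiE_iff)
  show lift: "initial_lift_domain (pow_cat S V) (pow_cat S X) (pow_func S U) x K a"
    if K: "structured_source (pow_cat S V) (pow_cat S X) (pow_func S U) x K"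
      and a: "a \<in> extensional S"
      and init: "\<And>s. s \<in> S \<Longrightarrow> initial_lift_domain V X U (x s) ((\<lambda>(b, f). (b s, f s)) ` K) (a s)" for x K a
  proof -
    have x: "x \<in> extensional S"
      using K by (auto simp: structured_source_def Obj_pow_cat PiE_iff)
    have Kext: "b \<in> extensional S \<and> f \<in> extensional S" if "(b, f) \<in> K" for b f
      using K that by (auto simp: structured_source_def Obj_pow_cat PiE_iff hom_pow_cat_iff)
    have "a \<in> Obj (pow_cat S V)" "FO (pow_func S U) a = x"
      using a x init by (auto simp: initial_lift_domain_def Obj_pow_cat PiE_iff pow_func_def
          intro!: extensionalityI[of _ S])
    moreover have "admissible (pow_cat S V) (pow_cat S X) (pow_func S U) a b f" if "(b, f) \<in> K" for b f
      unfolding adm using init that Kext a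
      by (fastforce simp: initial_lift_domain_def initial_source_def)
    moreover have "admissible (pow_cat S V) (pow_cat S X) (pow_func S U) w a g"
      if w: "w \<in> Obj (pow_cat S V)"
        and g: "g \<in> hom (pow_cat S X) (FO (pow_func S U) w) (FO (pow_func S U) a)"
        and gK: "\<And>b f. (b, f) \<in> K \<Longrightarrow>
          admissible (pow_cat S V) (pow_cat S X) (pow_func S U) w b (f \<cdot>\<^bsub>pow_cat S X\<^esub> g)" for w g
      unfolding adm
    proof (intro conjI ballI)
      fix s assume s: "s \<in> S"
      have "admissible V X U (w s) (b s) (f s \<cdot>\<^bsub>X\<^esub> g s)" if "(b, f) \<in> K" for b f
        using gK[OF that] s by (auto simp: adm Cmp_pow_cat)
      moreover have "g s \<in> hom X (FO U (w s)) (FO U (a s))" "w s \<in> Obj V"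
        using g w s by (auto simp: hom_pow_cat_iff pow_func_def Obj_pow_cat)
      ultimately show "admissible V X U (w s) (a s) (g s)"
        using init[OF s] by (auto simp: initial_lift_domain_def initial_source_def)
    qed (use w g a in \<open>auto simp: hom_pow_cat_iff Obj_pow_cat PiE_iff\<close>)
    moreover have "admissible (pow_cat S V) (pow_cat S X) (pow_func S U) w b (f \<cdot>\<^bsub>pow_cat S X\<^esub> g)"
      if "admissible (pow_cat S V) (pow_cat S X) (pow_func S U) w a g" "(b, f) \<in> K" for w g b f
      using that calculation(3)[OF that(2)] admissible_Cmp by (auto simp: adm Cmp_pow_cat)
    ultimately show ?thesis
      unfolding initial_lift_domain_def initial_source_def by blast
  qed
  show "topological (pow_cat S V) (pow_cat S X) (pow_func S U)"
  proof
    show "faithful (pow_cat S V) (pow_func S U)"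
      unfolding faithful_def
    proof (intro allI ballI impI)
      fix a b f g
      assume fg: "f \<in> hom (pow_cat S V) a b" "g \<in> hom (pow_cat S V) a b"
        and "FA (pow_func S U) f = FA (pow_func S U) g"
      then have "FA U (f s) = FA U (g s)" if "s \<in> S" for s
        using that by (simp add: pow_func_def restrict_eq_iff)
      then show "f = g"
        using fg faithfulD unfolding hom_pow_cat_iff by (metis extensionalityI)
    qed
  next
    fix a b
    assume ab: "a \<in> Obj (pow_cat S V)" "b \<in> Obj (pow_cat S V)"
      "fib_le (pow_cat S V) (pow_cat S X) (pow_func S U) a b"
      "fib_le (pow_cat S V) (pow_cat S X) (pow_func S U) b a"
    have "fib_le V X U (a s) (b s)" if "fib_le (pow_cat S V) (pow_cat S X) (pow_func S U) a b" "s \<in> S" for a b s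
    proof -
      have "FO U (a s) = FO U (b s)"
        using that by (simp add: fib_le_def pow_func_def restrict_eq_iff)
      then show ?thesis
        using that by (auto simp: fib_le_def adm Id_pow_cat) (simp add: pow_func_def)
    qed
    then show "a = b"
      using ab amnestic by (intro extensionalityI[of _ S]) (auto simp: Obj_pow_cat PiE_iff)
  next
    fix x K assume K: "structured_source (pow_cat S V) (pow_cat S X) (pow_func S U) x K"
    then have "\<forall>s\<in>S. \<exists>a. initial_lift_domain V X U (x s) ((\<lambda>(b, f). (b s, f s)) ` K) a"
      using source initial_lift by blast
    then obtain a where
      "\<forall>s\<in>S. initial_lift_domain V X U (x s) ((\<lambda>(b, f). (b s, f s)) ` K) (a s)"
      by metis
    then have "initial_lift_domain (pow_cat S V) (pow_cat S X) (pow_func S U) x K (restrict a S)"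
      using K by (intro lift) auto
    then show "\<exists>a. initial_lift_domain (pow_cat S V) (pow_cat S X) (pow_func S U) x K a"
      by blast
  qed
qed

text \<open>Wyler's taut lift theorem. The unit of the lower adjunction lifts because its composites with
  the components of the initial source are the given morphisms \<open>FA R f\<close>.\<close>

lemma taut_lift:
  assumes T: "topological A A' T" and R: "topological B B' R"
    and G: "is_functor A B G"
    and univ: "universal_arrows A' B' G' Fo' \<eta>' sh'"
    and square: "func_eq A (G' \<circ>\<^sub>F T) (R \<circ>\<^sub>F G)"
    and preserves: "\<And>x K a. structured_source A A' T x K \<Longrightarrow> initial_lift_domain A A' T x K a \<Longrightarrow>
      initial_lift_domain B B' R (FO G' x) ((\<lambda>(c, f). (FO G c, FA G' f)) ` K) (FO G a)"
  defines "K \<equiv> \<lambda>x. {(a, sh' (FO R x) (FO T a) (FA R f)) | a f. a \<in> Obj A \<and> f \<in> hom B x (FO G a)}"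
  shows "\<exists>F \<eta> \<epsilon>.
    adjunction_lifting A B F G \<eta> \<epsilon> A' B' (universal_arrows.left_adj B' Fo' \<eta>' sh') G' \<eta>'
      (universal_arrows.counit B' G' sh') T R \<and>
    func_eq B (T \<circ>\<^sub>F F) (universal_arrows.left_adj B' Fo' \<eta>' sh' \<circ>\<^sub>F R) \<and>
    (\<forall>x \<in> Obj B.
      (\<forall>a. initial_lift_domain A A' T (Fo' (FO R x)) (K x) a \<longleftrightarrow> a = FO F x) \<and>
      (\<forall>z. initial_lift_domain B B' R (FO G' (Fo' (FO R x))) ((\<lambda>(c, f). (FO G c, FA G' f)) ` K x) z
         \<longleftrightarrow> z = FO G (FO F x)))"
proof -
  interpret T: topological A A' T by fact
  interpret R: topological B B' R by fact
  interpret G: is_functor A B G by fact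
  interpret c: universal_arrows A' B' G' Fo' \<eta>' sh' by fact
  have sqO: "FO G' (FO T a) = FO R (FO G a)" if "a \<in> Obj A" for a
    using that square by (simp add: func_eq_def comp_func_def)
  have sqA: "FA G' (FA T f) = FA R (FA G f)" if "f \<in> hom A a b" for a b f
    using that square by (simp add: func_eq_def comp_func_def hom_def)
  have shR: "sh' (FO R x) (FO T a) (FA R f) \<in> hom A' (Fo' (FO R x)) (FO T a)"
    "FA G' (sh' (FO R x) (FO T a) (FA R f)) \<cdot>\<^bsub>B'\<^esub> \<eta>' (FO R x) = FA R f"
    if "x \<in> Obj B" "a \<in> Obj A" "f \<in> hom B x (FO G a)" for x a f
  proof -
    have "FA R f \<in> hom B' (FO R x) (FO G' (FO T a))"
      using R.FA_hom[OF that(3)] sqO[OF that(2)] by simp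
    then show "sh' (FO R x) (FO T a) (FA R f) \<in> hom A' (Fo' (FO R x)) (FO T a)"
      "FA G' (sh' (FO R x) (FO T a) (FA R f)) \<cdot>\<^bsub>B'\<^esub> \<eta>' (FO R x) = FA R f"
      using that c.sh_hom c.sh_unit R.FO_Obj T.FO_Obj by auto
  qed
  have source: "structured_source A A' T (Fo' (FO R x)) (K x)" if "x \<in> Obj B" for x
    using that shR c.Fo_Obj R.FO_Obj by (auto simp: structured_source_def K_def)
  \<comment> \<open>Whichever lift is chosen, its image under \<open>T\<close> is literally
    \<open>Fo' (FO R x)\<close>; the strict equality of the two composite functors starts
    here.\<close>
  define Fo where "Fo x = (SOME a. initial_lift_domain A A' T (Fo' (FO R x)) (K x) a)" for x
  have Fo: "initial_lift_domain A A' T (Fo' (FO R x)) (K x) (Fo x)" if "x \<in> Obj B" for x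
    unfolding Fo_def using T.initial_lift[OF source[OF that]] by (rule someI_ex)
  then have Fo_Obj: "Fo x \<in> Obj A" and TFo: "FO T (Fo x) = Fo' (FO R x)" if "x \<in> Obj B" for x
    using that by (auto simp: initial_lift_domain_def)
  have GFo: "initial_lift_domain B B' R (FO G' (Fo' (FO R x))) ((\<lambda>(c, f). (FO G c, FA G' f)) ` K x) (FO G (Fo x))"
    if "x \<in> Obj B" for x
    using preserves[OF source[OF that] Fo[OF that]] .
  have "\<exists>h \<in> hom B x (FO G (Fo x)). FA R h = \<eta>' (FO R x)" if x: "x \<in> Obj B" for x
  proof -
    have "\<eta>' (FO R x) \<in> hom B' (FO R x) (FO R (FO G (Fo x)))"
      using x c.unit_hom R.FO_Obj sqO Fo_Obj TFo by metis
    moreover have "admissible B B' R x (FO G a) (FA G' (sh' (FO R x) (FO T a) (FA R f)) \<cdot>\<^bsub>B'\<^esub> \<eta>' (FO R x))"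
      if "a \<in> Obj A" "f \<in> hom B x (FO G a)" for a f
      unfolding shR(2)[OF x that] R.admissible_iff using that by auto
    ultimately have "admissible B B' R x (FO G (Fo x)) (\<eta>' (FO R x))"
      using GFo[OF x] x unfolding initial_lift_domain_def initial_source_def K_def by auto
    then show ?thesis
      by (simp add: R.admissible_iff)
  qed
  then obtain \<eta> where \<eta>: "\<And>x. x \<in> Obj B \<Longrightarrow> \<eta> x \<in> hom B x (FO G (Fo x))"
    "\<And>x. x \<in> Obj B \<Longrightarrow> FA R (\<eta> x) = \<eta>' (FO R x)"
    by metis
  \<comment> \<open>The extension of \<open>f\<close> is itself a component of the source that
    defines \<open>Fo x\<close>, hence admissible out of the lift.\<close>
  have "\<exists>h \<in> hom A (Fo x) a. FA T h = sh' (FO R x) (FO T a) (FA R f)"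
    if "x \<in> Obj B" "a \<in> Obj A" "f \<in> hom B x (FO G a)" for x a f
    using Fo[OF that(1)] that T.admissible_iff
    unfolding initial_lift_domain_def initial_source_def K_def by blast
  then obtain sh where sh: "\<And>x a f. \<lbrakk>x \<in> Obj B; a \<in> Obj A; f \<in> hom B x (FO G a)\<rbrakk> \<Longrightarrow> sh x a f \<in> hom A (Fo x) a"
    "\<And>x a f. \<lbrakk>x \<in> Obj B; a \<in> Obj A; f \<in> hom B x (FO G a)\<rbrakk> \<Longrightarrow>
      FA T (sh x a f) = sh' (FO R x) (FO T a) (FA R f)"
    by metis
  \<comment> \<open>Both universal laws are inherited from the classical level: the unit law is
    checked under the faithful \<open>R\<close>, uniqueness under the faithful \<open>T\<close>.
    This identity translates composites with the unit.\<close>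
  have R_unit: "FA R (FA G h \<cdot>\<^bsub>B\<^esub> \<eta> x) = FA G' (FA T h) \<cdot>\<^bsub>B'\<^esub> \<eta>' (FO R x)"
    if "x \<in> Obj B" "h \<in> hom A (Fo x) a" for x a h
    using R.FA_Cmp[OF \<eta>(1)[OF that(1)] G.FA_hom[OF that(2)]] sqA[OF that(2)] \<eta>(2)[OF that(1)] by simp
  interpret e: universal_arrows A B G Fo \<eta> sh
  proof
    fix b a f assume b: "b \<in> Obj B" and a: "a \<in> Obj A" and f: "f \<in> hom B b (FO G a)"
    have "FA R (FA G (sh b a f) \<cdot>\<^bsub>B\<^esub> \<eta> b) = FA R f"
      using R_unit[OF b sh(1)[OF b a f]] sh(2)[OF b a f] shR(2)[OF b a f] by simp
    moreover have "FA G (sh b a f) \<cdot>\<^bsub>B\<^esub> \<eta> b \<in> hom B b (FO G a)"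
      using \<eta>(1)[OF b] G.FA_hom[OF sh(1)[OF b a f]] R.dom.Cmp_hom by blast
    ultimately show "FA G (sh b a f) \<cdot>\<^bsub>B\<^esub> \<eta> b = f"
      using f R.faithfulD by blast
  next
    fix b a h assume b: "b \<in> Obj B" and a: "a \<in> Obj A" and h: "h \<in> hom A (Fo b) a"
    have Gh: "FA G h \<cdot>\<^bsub>B\<^esub> \<eta> b \<in> hom B b (FO G a)"
      using \<eta>(1)[OF b] G.FA_hom[OF h] R.dom.Cmp_hom by blast
    have "FA T (sh b a (FA G h \<cdot>\<^bsub>B\<^esub> \<eta> b)) = sh' (FO R b) (FO T a) (FA G' (FA T h) \<cdot>\<^bsub>B'\<^esub> \<eta>' (FO R b))"
      using sh(2)[OF b a Gh] R_unit[OF b h] by simp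
    also have "\<dots> = FA T h"
      using c.sh_unique R.FO_Obj[OF b] T.FO_Obj[OF a] T.FA_hom[OF h] TFo[OF b] by simp
    finally show "sh b a (FA G h \<cdot>\<^bsub>B\<^esub> \<eta> b) = h"
      using sh(1)[OF b a Gh] h T.faithfulD by blast
  qed (use Fo_Obj \<eta> sh in auto)
  have lifting: "adjunction_lifting A B e.left_adj G \<eta> e.counit A' B' c.left_adj G' \<eta>' c.counit T R"
    unfolding adjunction_lifting_def
  proof (intro conjI ballI)
    show "func_eq B (c.left_adj \<circ>\<^sub>F R) (T \<circ>\<^sub>F e.left_adj)"
      unfolding func_eq_def
    proof (intro conjI ballI)
      fix f assume f: "f \<in> Arr B"
      define x y where "x = Dom B f" and "y = Cod B f"
      have f: "f \<in> hom B x y" and xy: "x \<in> Obj B" "y \<in> Obj B"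
        using f R.dom.Dom_Obj R.dom.Cod_Obj by (auto simp: hom_def x_def y_def)
      have "\<eta> y \<cdot>\<^bsub>B\<^esub> f \<in> hom B x (FO G (Fo y))"
        using f \<eta>(1)[OF xy(2)] R.dom.Cmp_hom by blast
      then have "FA T (FA e.left_adj f) = sh' (FO R x) (FO T (Fo y)) (FA R (\<eta> y \<cdot>\<^bsub>B\<^esub> f))"
        using sh(2) xy Fo_Obj homD[OF f] by (simp add: e.left_adj_def)
      also have "\<dots> = FA c.left_adj (FA R f)"
        using R.FA_Cmp[OF f \<eta>(1)[OF xy(2)]] homD[OF R.FA_hom[OF f]] TFo xy \<eta>(2)
        by (simp add: c.left_adj_def)
      finally show "FA (c.left_adj \<circ>\<^sub>F R) f = FA (T \<circ>\<^sub>F e.left_adj) f"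
        by (simp add: comp_func_def)
    qed (simp add: comp_func_def TFo)
  next
    fix a assume a: "a \<in> Obj A"
    then have "FA T (e.counit a) = sh' (FO R (FO G a)) (FO T a) (FA R (Id B (FO G a)))"
      using sh(2) G.FO_Obj R.dom.Id_hom by (simp add: e.counit_def)
    then show "FA T (e.counit a) = c.counit (FO T a)"
      using a sqO R.FA_Id G.FO_Obj by (simp add: c.counit_def)
  qed (use e.adjunction_left_adj c.adjunction_left_adj T R square \<eta> in \<open>auto simp: topological_def\<close>)
  moreover from lifting have "func_eq B (T \<circ>\<^sub>F e.left_adj) (c.left_adj \<circ>\<^sub>F R)"
    by (simp add: adjunction_lifting_def func_eq_def)
  moreover have "initial_lift_domain A A' T (Fo' (FO R x)) (K x) a \<longleftrightarrow> a = FO e.left_adj x"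
    if "x \<in> Obj B" for x a
    using Fo[OF that] T.initial_lift_domain_unique by auto
  moreover have "initial_lift_domain B B' R (FO G' (Fo' (FO R x))) ((\<lambda>(c, f). (FO G c, FA G' f)) ` K x) z
      \<longleftrightarrow> z = FO G (FO e.left_adj x)" if "x \<in> Obj B" for x z
    using GFo[OF that] R.initial_lift_domain_unique by auto
  ultimately show ?thesis
    by blast
qed

section \<open>Small sets, pairs and tuples\<close>

context set_universe
begin

text \<open>An infinite small set contains a copy of the naturals, and any nonempty countable set is
  an image of that copy, so separation and replacement apply. In particular the finite sets inside
  Kuratowski pairs are small.\<close>

lemma small_countable:
  assumes "countable X"
  shows "small (X :: 'a set)"
proof (cases "X = {}")
  case True
  then show ?thesis
    using small_infinite small_subset by blast
next
  case False
  obtain Z :: "'a set" where Z: "small Z" "infinite Z"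
    using small_infinite by blast
  obtain g :: "nat \<Rightarrow> 'a" where g: "inj g" "range g \<subseteq> Z"
    using infinite_countable_subset[OF Z(2)] by blast
  have "X = (from_nat_into X \<circ> inv g) ` range g"
    using g(1) range_from_nat_into[OF False assms] by (simp add: image_comp[symmetric] image_image)
  then show ?thesis
    using small_image small_subset Z(1) g(2) by metis
qed

text \<open>The axioms offer unions indexed by a small set only. The index set here is an infinite
  small set in which one element \<open>a\<close> selects \<open>X\<close> and all others select
  \<open>Y\<close>.\<close>

lemma small_Un:
  assumes "small (X :: 'a set)" "small Y"
  shows "small (X \<union> Y)"
proof -
  obtain Z :: "'a set" where Z: "small Z" "infinite Z"
    using small_infinite by blast
  then obtain a b where ab: "a \<in> Z" "b \<in> Z" "a \<noteq> b"
    by (metis finite.simps infinite_arbitrarily_large insertI1 insertE subsetI finite_subset ex_in_conv)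
  have "small (\<Union>z\<in>Z. if z = a then X else Y)"
    using assms Z by (intro small_UN) auto
  then show ?thesis
    using ab by (elim small_subset) auto
qed

end

text \<open>Indices must be elements of the universe, so the naturals are first embedded into an
  infinite small set.\<close>

lemma small_UN_nat:
  fixes X :: "nat \<Rightarrow> 'u::set_universe set"
  assumes "\<And>n. small (X n)"
  shows "small (\<Union>n. X n)"
proof -
  obtain Z :: "'u set" where Z: "small Z" "infinite Z"
    using small_infinite by blast
  obtain g :: "nat \<Rightarrow> 'u" where g: "inj g" "range g \<subseteq> Z"
    using infinite_countable_subset[OF Z(2)] by blast
  have "(\<Union>n. X n) = (\<Union>z\<in>range g. X (inv g z))"
    using g(1) by simp
  then show ?thesis
    using small_UN[of "range g" "\<lambda>z. X (inv g z)"] small_subset[OF Z(1) g(2)] assms by simp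
qed

lemma encode_set_inject:
  assumes "small X" "small Y"
  shows "encode_set X = encode_set Y \<longleftrightarrow> X = Y"
  using assms encode_set_inj by blast

lemma small_finite: "finite X \<Longrightarrow> small X"
  using small_countable countable_finite by blast

lemma pair_inject [simp]: "pair a b = pair c d \<longleftrightarrow> a = c \<and> b = d"
  by (auto simp: pair_def encode_set_inject small_finite doubleton_eq_iff)

lemma pfst_pair [simp]: "pfst (pair a b) = a"
  by (auto simp: pfst_def)

lemma psnd_pair [simp]: "psnd (pair a b) = b"
  by (auto simp: psnd_def)

lemma pair_neq_point [simp]: "pair a b \<noteq> point" "point \<noteq> pair a b"
  by (auto simp: pair_def point_def encode_set_inject small_finite)

text \<open>These two elements are the tags in \<open>enc_leaf\<close> and \<open>enc_op\<close>;
  their difference keeps leaves apart from applications.\<close>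

lemma encode_point_neq_point [simp]: "encode_set {point} \<noteq> point" "point \<noteq> encode_set {point}"
  unfolding point_def by (auto simp: encode_set_inject small_finite)

lemma tup_simps [simp]: "tup [] = point" "tup (x # xs) = pair x (tup xs)"
  by (auto simp: tup_def)

text \<open>Tuples of different lengths differ because the terminator \<open>point\<close> is not a
  pair; hence tuples encode lists without recording a length.\<close>

lemma inj_tup: "inj tup"
proof
  fix xs ys :: "'a list"
  show "tup xs = tup ys \<Longrightarrow> xs = ys"
  proof (induction xs arbitrary: ys)
    case Nil then show ?case by (cases ys) auto
  next
    case (Cons x xs) then show ?case by (cases ys) auto
  qed
qed

lemma tup_inject [simp]: "tup xs = tup ys \<longleftrightarrow> xs = ys"
  by (rule inj_eq[OF inj_tup])

lemma untup_tup [simp]: "untup (tup xs) = xs"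
  by (simp add: untup_def inj_tup)

lemma numeral_of_inject [simp]: "numeral_of m = numeral_of n \<longleftrightarrow> m = n"
  by (metis length_replicate numeral_of_def tup_inject)

lemma inj_enc_op_symbol: "inj enc_op_symbol"
  by (auto simp: inj_on_def enc_op_symbol_def)

lemma inj_enc_var: "inj enc_var"
  by (auto simp: inj_on_def enc_var_def)

lemma in_listset_iff: "xs \<in> listset As \<longleftrightarrow> list_all2 (\<in>) xs As"
  by (induction As arbitrary: xs) (auto simp: set_Cons_def list_all2_Cons2)

lemma in_cart_iff [simp]: "z \<in> cart A B \<longleftrightarrow> (\<exists>a\<in>A. \<exists>b\<in>B. z = pair a b)"
  by (auto simp: cart_def)

lemma in_tuples_iff: "z \<in> tuples As \<longleftrightarrow> (\<exists>xs. list_all2 (\<in>) xs As \<and> z = tup xs)"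
  by (auto simp: tuples_def in_listset_iff)

lemma tup_in_tuples_iff [simp]: "tup xs \<in> tuples As \<longleftrightarrow> list_all2 (\<in>) xs As"
  by (auto simp: in_tuples_iff)

lemma in_args_iff: "xs \<in> args D ss \<longleftrightarrow> list_all2 (\<lambda>x s. x \<in> D s) xs ss"
  by (simp add: args_def in_listset_iff list_all2_map2)

lemma small_cart:
  assumes "small A" "small B"
  shows "small (cart A B)"
proof -
  have "cart A B = (\<Union>a\<in>A. pair a ` B)"
    by (auto simp: cart_def)
  then show ?thesis
    using assms small_UN[of A "\<lambda>a. pair a ` B"] small_image by metis
qed

lemma small_tuples:
  assumes "\<forall>A \<in> set As. small A"
  shows "small (tuples As)"
  using assms
proof (induction As)
  case Nil
  then show ?case by (simp add: tuples_def small_finite)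
next
  case (Cons A As)
  have "tuples (A # As) = cart A (tuples As)"
    by (fastforce simp: in_tuples_iff list_all2_Cons2 set_eq_iff)
  then show ?case
    using Cons small_cart by auto
qed

text \<open>Lists of each fixed length form a finite product, and countably many lengths cover all
  lists.\<close>

lemma small_tup_lists:
  assumes "small A"
  shows "small (tup ` lists A)"
proof -
  have "tup ` lists A \<subseteq> (\<Union>n. tuples (replicate n A))"
  proof
    fix z assume "z \<in> tup ` lists A"
    then obtain xs where "z = tup xs" "xs \<in> lists A" by blast
    then have "z \<in> tuples (replicate (length xs) A)"
      by (auto simp: list_all2_conv_all_nth)
    then show "z \<in> (\<Union>n. tuples (replicate n A))" by blast
  qed
  moreover have "small (\<Union>n. tuples (replicate n A))"
    using assms by (intro small_UN_nat small_tuples) auto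
  ultimately show ?thesis
    using small_subset by blast
qed

section \<open>Arrows of sets\<close>

lemma Obj_set_cat [simp]: "Obj set_cat = {A. small A}"
  by (simp add: set_cat_def)

lemma hom_set_catE:
  assumes "f \<in> hom set_cat A B"
  obtains g where "small A" "small B" "g \<in> A \<rightarrow>\<^sub>E B" "f = (A, g, B)"
  using assms by (auto simp: hom_def set_cat_def)

lemma hom_set_catI:
  assumes "small A" "small B" "\<And>x. x \<in> A \<Longrightarrow> g x \<in> B"
  shows "set_arr A g B \<in> hom set_cat A B"
  using assms by (auto simp: hom_def set_cat_def set_arr_def)

lemma app_set_arr [simp]: "x \<in> A \<Longrightarrow> app (set_arr A g B) x = g x"
  by (simp add: app_def set_arr_def)

lemma app_in: "f \<in> hom set_cat A B \<Longrightarrow> x \<in> A \<Longrightarrow> app f x \<in> B"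
  by (auto elim!: hom_set_catE simp: app_def)

lemma set_arr_eqI:
  assumes "f \<in> hom set_cat A B" "g \<in> hom set_cat A B" "\<And>x. x \<in> A \<Longrightarrow> app f x = app g x"
  shows "f = g"
proof -
  obtain f' where "f' \<in> A \<rightarrow>\<^sub>E B" "f = (A, f', B)"
    using assms(1) by (rule hom_set_catE)
  moreover obtain g' where "g' \<in> A \<rightarrow>\<^sub>E B" "g = (A, g', B)"
    using assms(2) by (rule hom_set_catE)
  ultimately show ?thesis
    using assms(3) PiE_ext[of f' A "\<lambda>_. B" g'] by (simp add: app_def)
qed

lemma app_Id_set_cat [simp]: "x \<in> A \<Longrightarrow> app (Id set_cat A) x = x"
  by (simp add: set_cat_def)

lemma app_Cmp_set_cat [simp]:
  assumes "f \<in> hom set_cat A B" "g \<in> hom set_cat B C" "x \<in> A"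
  shows "app (g \<cdot>\<^bsub>set_cat\<^esub> f) x = app g (app f x)"
  using assms by (auto elim!: hom_set_catE simp: app_def) (auto simp: set_cat_def compose_def)

lemma category_set_cat: "category set_cat"
proof
  fix f g h :: "'a set_arrow" and A B C D
  assume f: "f \<in> hom set_cat A B"
  have Id: "Id set_cat A' \<in> hom set_cat A' A'" if "small A'" for A' :: "'a set"
    using that by (auto simp: hom_def set_cat_def set_arr_def)
  have Cmp: "g \<cdot>\<^bsub>set_cat\<^esub> f \<in> hom set_cat A B"
    if "f \<in> hom set_cat A C" "g \<in> hom set_cat C B" for f g :: "'a set_arrow" and A B C
    using that by (auto simp: hom_def set_cat_def PiE_iff compose_def)
  have AB: "small A" "small B"
    using f by (auto elim: hom_set_catE)
  show "Id set_cat B \<cdot>\<^bsub>set_cat\<^esub> f = f" "f \<cdot>\<^bsub>set_cat\<^esub> Id set_cat A = f"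
    using Cmp[OF f Id[OF AB(2)]] Cmp[OF Id[OF AB(1)] f] f
      app_Cmp_set_cat[OF f Id[OF AB(2)]] app_Cmp_set_cat[OF Id[OF AB(1)] f] app_in[OF f]
    by (auto intro!: set_arr_eqI[of _ A B])
  assume g: "g \<in> hom set_cat B C"
  show "g \<cdot>\<^bsub>set_cat\<^esub> f \<in> hom set_cat A C"
    using f g by (rule Cmp)
  assume h: "h \<in> hom set_cat C D"
  show "h \<cdot>\<^bsub>set_cat\<^esub> g \<cdot>\<^bsub>set_cat\<^esub> f = h \<cdot>\<^bsub>set_cat\<^esub> (g \<cdot>\<^bsub>set_cat\<^esub> f)"
  proof (rule set_arr_eqI)
    fix x assume x: "x \<in> A"
    show "app (h \<cdot>\<^bsub>set_cat\<^esub> g \<cdot>\<^bsub>set_cat\<^esub> f) x = app (h \<cdot>\<^bsub>set_cat\<^esub> (g \<cdot>\<^bsub>set_cat\<^esub> f)) x"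
      using app_Cmp_set_cat[OF f Cmp[OF g h] x] app_Cmp_set_cat[OF Cmp[OF f g] h x]
        app_Cmp_set_cat[OF f g x] app_Cmp_set_cat[OF g h app_in[OF f x]] by simp
  qed (use f g h Cmp in blast)+
qed (auto simp: hom_def set_cat_def set_arr_def PiE_iff)

section \<open>Homomorphisms of classical algebras\<close>

lemma args_length: "ds \<in> args D ss \<Longrightarrow> length ds = length ss"
  by (auto simp: in_args_iff dest: list_all2_lengthD)

lemma args_nth: "ds \<in> args D ss \<Longrightarrow> i < length ss \<Longrightarrow> ds ! i \<in> D (ss ! i)"
  by (auto simp: in_args_iff list_all2_conv_all_nth)

lemma args_cong: "(\<And>s. s \<in> set ss \<Longrightarrow> D s = D' s) \<Longrightarrow> args D ss = args D' ss"
  by (auto simp: args_def cong: map_cong)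

lemma map2_in_args:
  assumes "ds \<in> args D ss" "\<And>s d. s \<in> set ss \<Longrightarrow> d \<in> D s \<Longrightarrow> h s d \<in> D' s"
  shows "map2 h ss ds \<in> args D' ss"
  using assms by (auto simp: in_args_iff list_all2_conv_all_nth)

lemma map2_args_cong:
  assumes "ds \<in> args D ss" "\<And>s d. s \<in> set ss \<Longrightarrow> d \<in> D s \<Longrightarrow> h s d = h' s d"
  shows "map2 h ss ds = map2 h' ss ds"
proof (rule nth_equalityI)
  fix i assume "i < length (map2 h ss ds)"
  then show "map2 h ss ds ! i = map2 h' ss ds ! i"
    using assms by (auto simp: in_args_iff list_all2_conv_all_nth)
qed simp

lemma map2_snd: "length ss = length ds \<Longrightarrow> map2 (\<lambda>s d. d) ss ds = ds"
  by (auto intro!: nth_equalityI)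

lemma map2_map2: "map2 g ss (map2 h ss ds) = map2 (\<lambda>s d. g s (h s d)) ss ds"
  by (auto intro!: nth_equalityI)

definition sorted_arrow ::
  "'u::set_universe set \<Rightarrow> ('u \<Rightarrow> 'u set) \<Rightarrow> ('u \<Rightarrow> 'u \<Rightarrow> 'u) \<Rightarrow> ('u \<Rightarrow> 'u set) \<Rightarrow> 'u \<Rightarrow> 'u set_arrow" where
  "sorted_arrow S X h Y = (\<lambda>s\<in>S. set_arr (X s) (h s) (Y s))"

lemma sorted_arrow_hom:
  assumes "X \<in> Obj (pow_cat S set_cat)" "Y \<in> Obj (pow_cat S set_cat)"
    and "\<And>s x. s \<in> S \<Longrightarrow> x \<in> X s \<Longrightarrow> h s x \<in> Y s"
  shows "sorted_arrow S X h Y \<in> hom (pow_cat S set_cat) X Y"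
  using assms by (auto simp: hom_pow_cat_iff Obj_pow_cat PiE_iff sorted_arrow_def intro!: hom_set_catI)

lemma app_sorted_arrow: "s \<in> S \<Longrightarrow> x \<in> X s \<Longrightarrow> app (sorted_arrow S X h Y s) x = h s x"
  by (simp add: sorted_arrow_def)

lemma sorted_app_in: "f \<in> hom (pow_cat S set_cat) X Y \<Longrightarrow> s \<in> S \<Longrightarrow> x \<in> X s \<Longrightarrow> app (f s) x \<in> Y s"
  by (auto simp: hom_pow_cat_iff intro: app_in)

lemma sorted_app_Cmp:
  assumes "f \<in> hom (pow_cat S set_cat) X Y" "g \<in> hom (pow_cat S set_cat) Y Z" "s \<in> S" "x \<in> X s"
  shows "app ((g \<cdot>\<^bsub>pow_cat S set_cat\<^esub> f) s) x = app (g s) (app (f s) x)"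
  using assms app_Cmp_set_cat[of "f s" "X s" "Y s" "g s" "Z s" x]
  by (simp add: hom_pow_cat_iff Cmp_pow_cat)

lemma sorted_app_Id: "s \<in> S \<Longrightarrow> x \<in> X s \<Longrightarrow> app (Id (pow_cat S set_cat) X s) x = x"
  by (simp add: Id_pow_cat)

lemma sorted_arrow_eqI:
  assumes "f \<in> hom (pow_cat S set_cat) X Y" "g \<in> hom (pow_cat S set_cat) X Y"
    and "\<And>s x. s \<in> S \<Longrightarrow> x \<in> X s \<Longrightarrow> app (f s) x = app (g s) x"
  shows "f = g"
  using assms by (intro extensionalityI[of _ S] set_arr_eqI) (auto simp: hom_pow_cat_iff)

lemma fst_quotient_alg: "fst (quotient_alg S \<Sigma> D R) = quotient_carrier S (fst D) R"
  by (simp add: quotient_alg_def)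

locale classical_signature =
  fixes S :: "'u::set_universe set" and \<Sigma> :: "('o, 'u) csig"
  assumes ins_S: "\<tau> \<in> cops \<Sigma> \<Longrightarrow> set (cins \<Sigma> \<tau>) \<subseteq> S"
    and out_S: "\<tau> \<in> cops \<Sigma> \<Longrightarrow> cout \<Sigma> \<tau> \<in> S"
begin

text \<open>A homomorphism as a bare sort-indexed function, detached from the arrows of
  \<open>set_cat\<close>. In this form it can be built by recursion on terms, composed pointwise,
  and compared with underlying functions of \<open>V\<close>-morphisms.\<close>

definition sorted_hom :: "('o, 'u) calg \<Rightarrow> ('o, 'u) calg \<Rightarrow> ('u \<Rightarrow> 'u \<Rightarrow> 'u) \<Rightarrow> bool" where
  "sorted_hom A B h \<longleftrightarrow> (\<forall>s \<in> S. \<forall>d \<in> fst A s. h s d \<in> fst B s) \<and>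
     (\<forall>\<tau> \<in> cops \<Sigma>. \<forall>ds \<in> args (fst A) (cins \<Sigma> \<tau>).
        h (cout \<Sigma> \<tau>) (snd A \<tau> ds) = snd B \<tau> (map2 h (cins \<Sigma> \<tau>) ds))"

lemma sorted_hom_in: "sorted_hom A B h \<Longrightarrow> s \<in> S \<Longrightarrow> d \<in> fst A s \<Longrightarrow> h s d \<in> fst B s"
  by (simp add: sorted_hom_def)

lemma sorted_hom_op:
  "sorted_hom A B h \<Longrightarrow> \<tau> \<in> cops \<Sigma> \<Longrightarrow> ds \<in> args (fst A) (cins \<Sigma> \<tau>) \<Longrightarrow>
     h (cout \<Sigma> \<tau>) (snd A \<tau> ds) = snd B \<tau> (map2 h (cins \<Sigma> \<tau>) ds)"
  by (simp add: sorted_hom_def)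

lemma algebra_carrier: "A \<in> classical_algebras S \<Sigma> \<Longrightarrow> fst A \<in> Obj (pow_cat S set_cat)"
  by (simp add: classical_algebras_def)

lemma algebra_small: "A \<in> classical_algebras S \<Sigma> \<Longrightarrow> s \<in> S \<Longrightarrow> small (fst A s)"
  by (auto simp: classical_algebras_def Obj_pow_cat)

lemma algebra_op_in:
  "A \<in> classical_algebras S \<Sigma> \<Longrightarrow> \<tau> \<in> cops \<Sigma> \<Longrightarrow> ds \<in> args (fst A) (cins \<Sigma> \<tau>) \<Longrightarrow>
     snd A \<tau> ds \<in> fst A (cout \<Sigma> \<tau>)"
  by (fastforce simp: classical_algebras_def PiE_iff)

lemma algebra_eqI:
  assumes "A \<in> classical_algebras S \<Sigma>" "B \<in> classical_algebras S \<Sigma>" "fst A = fst B"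
    and "\<And>\<tau> ds. \<tau> \<in> cops \<Sigma> \<Longrightarrow> ds \<in> args (fst A) (cins \<Sigma> \<tau>) \<Longrightarrow> snd A \<tau> ds = snd B \<tau> ds"
  shows "A = B"
proof -
  have "snd A \<tau> = snd B \<tau>" if "\<tau> \<in> cops \<Sigma>" for \<tau>
    using assms that unfolding classical_algebras_def PiE_iff
    by (intro extensionalityI[of _ "args (fst A) (cins \<Sigma> \<tau>)"]) auto
  then have "snd A = snd B"
    using assms unfolding classical_algebras_def PiE_iff
    by (intro extensionalityI[of _ "cops \<Sigma>"]) auto
  then show ?thesis
    using assms(3) by (rule prod_eqI[rotated])
qed

text \<open>\<open>A\<close> has to be an algebra: the value of an operation must lie in the carrier
  before \<open>h\<close> may be exchanged for \<open>h'\<close> there.\<close>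

lemma sorted_hom_cong:
  assumes "sorted_hom A B h" "A \<in> classical_algebras S \<Sigma>"
    and eq: "\<And>s d. s \<in> S \<Longrightarrow> d \<in> fst A s \<Longrightarrow> h' s d = h s d"
  shows "sorted_hom A B h'"
  unfolding sorted_hom_def
proof (intro conjI ballI)
  fix \<tau> ds assume \<tau>: "\<tau> \<in> cops \<Sigma>" "ds \<in> args (fst A) (cins \<Sigma> \<tau>)"
  have "map2 h' (cins \<Sigma> \<tau>) ds = map2 h (cins \<Sigma> \<tau>) ds"
    using \<tau> ins_S[OF \<tau>(1)] eq by (intro map2_args_cong) auto
  then show "h' (cout \<Sigma> \<tau>) (snd A \<tau> ds) = snd B \<tau> (map2 h' (cins \<Sigma> \<tau>) ds)"
    using sorted_hom_op[OF assms(1) \<tau>] eq out_S[OF \<tau>(1)] algebra_op_in[OF assms(2) \<tau>]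
    by (simp only:)
qed (use assms(1) eq sorted_hom_in in auto)

lemma sorted_hom_id:
  shows "sorted_hom A A (\<lambda>s d. d)"
  by (auto simp: sorted_hom_def map2_snd args_length)

lemma sorted_hom_comp:
  assumes "sorted_hom A B h" "sorted_hom B C k"
  shows "sorted_hom A C (\<lambda>s d. k s (h s d))"
  unfolding sorted_hom_def
proof (intro conjI ballI)
  fix \<tau> ds assume \<tau>: "\<tau> \<in> cops \<Sigma>" "ds \<in> args (fst A) (cins \<Sigma> \<tau>)"
  have "map2 h (cins \<Sigma> \<tau>) ds \<in> args (fst B) (cins \<Sigma> \<tau>)"
    using ins_S[OF \<tau>(1)] sorted_hom_in[OF assms(1)] by (intro map2_in_args[OF \<tau>(2)]) auto
  then show "k (cout \<Sigma> \<tau>) (h (cout \<Sigma> \<tau>) (snd A \<tau> ds)) = snd C \<tau> (map2 (\<lambda>s d. k s (h s d)) (cins \<Sigma> \<tau>) ds)"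
    using sorted_hom_op[OF assms(1) \<tau>] sorted_hom_op[OF assms(2) \<tau>(1)] by (simp add: map2_map2)
qed (use assms sorted_hom_in in auto)

lemma hom_classical_alg_cat_iff:
  "f \<in> hom (classical_alg_cat S \<Sigma>) A B \<longleftrightarrow> A \<in> classical_algebras S \<Sigma> \<and> B \<in> classical_algebras S \<Sigma> \<and>
     (\<exists>g \<in> hom (pow_cat S set_cat) (fst A) (fst B). sorted_hom A B (\<lambda>s. app (g s)) \<and> f = (A, g, B))"
  unfolding classical_alg_cat_def hom_struct_cat_iff sorted_hom_def
  by (auto dest: sorted_app_in)

lemma sorted_arrow_hom_alg:
  assumes "A \<in> classical_algebras S \<Sigma>" "B \<in> classical_algebras S \<Sigma>" "sorted_hom A B h"
  shows "(A, sorted_arrow S (fst A) h (fst B), B) \<in> hom (classical_alg_cat S \<Sigma>) A B"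
  unfolding hom_classical_alg_cat_iff
proof (intro conjI bexI refl)
  show "sorted_hom A B (\<lambda>s. app (sorted_arrow S (fst A) h (fst B) s))"
    using assms by (intro sorted_hom_cong[OF assms(3,1)]) (simp add: app_sorted_arrow)
  show "sorted_arrow S (fst A) h (fst B) \<in> hom (pow_cat S set_cat) (fst A) (fst B)"
    using assms algebra_carrier sorted_hom_in by (intro sorted_arrow_hom) auto
qed (use assms in auto)

lemma Obj_classical_alg_cat [simp]: "Obj (classical_alg_cat S \<Sigma>) = classical_algebras S \<Sigma>"
  by (simp add: classical_alg_cat_def)

lemma category_pow_set_cat: "category (pow_cat S set_cat)"
  by (rule category_pow_cat[OF category_set_cat])

lemma classical_alg_cat_functor:
  shows "category (classical_alg_cat S \<Sigma>)"
    and "is_functor (classical_alg_cat S \<Sigma>) (pow_cat S set_cat) classical_forget"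
proof -
  interpret P: category "pow_cat S set_cat"
    by (rule category_pow_set_cat)
  let ?P = "\<lambda>A f B. \<forall>\<tau> \<in> cops \<Sigma>. \<forall>ds \<in> args (fst A) (cins \<Sigma> \<tau>).
        app (f (cout \<Sigma> \<tau>)) (snd A \<tau> ds) = snd B \<tau> (map2 (\<lambda>s d. app (f s) d) (cins \<Sigma> \<tau>) ds)"
  have P: "?P A f B \<longleftrightarrow> sorted_hom A B (\<lambda>s. app (f s))"
    if "f \<in> hom (pow_cat S set_cat) (fst A) (fst B)" for A B f
    using that sorted_app_in by (auto simp: sorted_hom_def)
  have Id: "?P A (Id (pow_cat S set_cat) (fst A)) A" if "A \<in> classical_algebras S \<Sigma>" for A
    unfolding P[OF P.Id_hom[OF algebra_carrier[OF that]]]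
    by (rule sorted_hom_cong[OF sorted_hom_id that]) (simp add: sorted_app_Id)
  have Cmp: "?P A (g \<cdot>\<^bsub>pow_cat S set_cat\<^esub> f) C"
    if A: "A \<in> classical_algebras S \<Sigma>" and f: "f \<in> hom (pow_cat S set_cat) (fst A) (fst B)"
      and g: "g \<in> hom (pow_cat S set_cat) (fst B) (fst C)" and fg: "?P A f B" "?P B g C" for A B C f g
  proof -
    have "sorted_hom A C (\<lambda>s d. app (g s) (app (f s) d))"
      using fg unfolding P[OF f] P[OF g] by (rule sorted_hom_comp)
    then have "sorted_hom A C (\<lambda>s. app ((g \<cdot>\<^bsub>pow_cat S set_cat\<^esub> f) s))"
      by (rule sorted_hom_cong[OF _ A]) (rule sorted_app_Cmp[OF f g])
    then show ?thesis
      unfolding P[OF P.Cmp_hom[OF f g]] .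
  qed
  show cat: "category (classical_alg_cat S \<Sigma>)"
    unfolding classical_alg_cat_def
    by (rule category_struct_cat[OF P.category_axioms]) (use Id Cmp algebra_carrier in blast)+
  show "is_functor (classical_alg_cat S \<Sigma>) (pow_cat S set_cat) classical_forget"
    unfolding classical_forget_def classical_alg_cat_def
    by (rule is_functor_struct_forget[OF P.category_axioms cat[unfolded classical_alg_cat_def] algebra_carrier])
qed

text \<open>Membership and commutation are proved together, since the step for an operation symbol
  can apply the homomorphism law only once the argument values are known to lie in the
  carriers.\<close>

lemma sorted_hom_eval_trm:
  assumes h: "sorted_hom A B h" and A: "A \<in> classical_algebras S \<Sigma>"
    and \<rho>: "\<And>s x. s \<in> S \<Longrightarrow> x \<in> Y s \<Longrightarrow> \<rho> x \<in> fst A s \<and> \<rho>' x = h s (\<rho> x)"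
    and t: "wsorted \<Sigma> Y t s" "s \<in> S"
  shows "eval_trm A \<rho> t \<in> fst A s \<and> h s (eval_trm A \<rho> t) = eval_trm B \<rho>' t"
  using t
proof induction
  case (2 \<tau> ts)
  have ts: "length ts = length (cins \<Sigma> \<tau>)"
    using 2(2) by (rule list_all2_lengthD)
  have nth: "eval_trm A \<rho> (ts ! i) \<in> fst A (cins \<Sigma> \<tau> ! i) \<and>
       h (cins \<Sigma> \<tau> ! i) (eval_trm A \<rho> (ts ! i)) = eval_trm B \<rho>' (ts ! i)"
    if "i < length ts" for i
    using 2 that subsetD[OF ins_S[OF 2(1)] nth_mem] by (auto simp: list_all2_conv_all_nth)
  have "map (eval_trm A \<rho>) ts \<in> args (fst A) (cins \<Sigma> \<tau>)"
    using ts nth by (auto simp: in_args_iff list_all2_conv_all_nth)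
  moreover have "map2 h (cins \<Sigma> \<tau>) (map (eval_trm A \<rho>) ts) = map (eval_trm B \<rho>') ts"
    using ts nth by (auto intro!: nth_equalityI)
  ultimately show ?case
    using 2(1) sorted_hom_op[OF h] algebra_op_in[OF A] by simp
qed (use \<rho> in simp)

text \<open>The record \<open>ceqn\<close> does not enforce sorts. Under this condition both sides
  have values in the carrier of sort \<open>csrt e\<close>, which the quotient construction relies
  on.\<close>

definition ceqn_sorted :: "('o, 'u) ceqn \<Rightarrow> bool" where
  "ceqn_sorted e \<longleftrightarrow> distinct (cctx e) \<and> snd ` set (cctx e) \<subseteq> S \<and> csrt e \<in> S \<and>
     wsorted \<Sigma> (ctx_vars (cctx e)) (clhs e) (csrt e) \<and> wsorted \<Sigma> (ctx_vars (cctx e)) (crhs e) (csrt e)"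

text \<open>Distinctness of the context makes lookup through \<open>map_of\<close> return exactly
  the argument at the position of the variable, before and after applying \<open>h\<close>.\<close>

lemma sorted_hom_term_fun:
  assumes h: "sorted_hom A B h" and A: "A \<in> classical_algebras S \<Sigma>"
    and vs: "distinct vs" "snd ` set vs \<subseteq> S"
    and t: "wsorted \<Sigma> (ctx_vars vs) t s" "s \<in> S" and ds: "ds \<in> args (fst A) (map snd vs)"
  shows "term_fun A vs t ds \<in> fst A s"
    and "h s (term_fun A vs t ds) = term_fun B vs t (map2 h (map snd vs) ds)"
proof -
  have len: "length ds = length vs"
    using args_length[OF ds] by simp
  have "the (map_of (zip vs ds) v) \<in> fst A s \<and>
      the (map_of (zip vs (map2 h (map snd vs) ds)) v) = h s (the (map_of (zip vs ds) v))"
    if "s \<in> S" "v \<in> ctx_vars vs s" for s v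
  proof -
    from that obtain i where i: "i < length vs" "vs ! i = v" "snd v = s"
      by (auto simp: ctx_vars_def in_set_conv_nth)
    have "ds ! i \<in> fst A s"
      using args_nth[OF ds, of i] i by simp
    then show ?thesis
      using map_of_zip_nth[OF len[symmetric] vs(1), of i]
        map_of_zip_nth[of vs "map2 h (map snd vs) ds" i] vs(1) len i by simp
  qed
  then show "term_fun A vs t ds \<in> fst A s"
    and "h s (term_fun A vs t ds) = term_fun B vs t (map2 h (map snd vs) ds)"
    using sorted_hom_eval_trm[OF h A _ t, of "\<lambda>v. the (map_of (zip vs ds) v)"
        "\<lambda>v. the (map_of (zip vs (map2 h (map snd vs) ds)) v)"]
    unfolding term_fun_def by blast+
qed

section \<open>Quotients\<close>

context
  fixes D R
  assumes D: "D \<in> classical_algebras S \<Sigma>" and R: "congruence S \<Sigma> D R"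
begin

text \<open>\<open>encode_set\<close> is injective on small sets only; equivalence classes qualify
  as subsets of a small carrier.\<close>

lemma class_of_eq_iff:
  assumes "s \<in> S" "d \<in> fst D s" "d' \<in> fst D s"
  shows "class_of R s d = class_of R s d' \<longleftrightarrow> (d, d') \<in> R s"
proof -
  have eq: "equiv (fst D s) (R s)"
    using R assms by (simp add: congruence_def)
  have "small (R s `` {d})" for d
    using small_subset[OF algebra_small[OF D assms(1)]] equiv_type[OF eq] by blast
  then show ?thesis
    using eq_equiv_class_iff[OF eq assms(2,3)] by (simp add: class_of_def encode_set_inject)
qed

lemma in_quotient_carrier_iff:
  "s \<in> S \<Longrightarrow> c \<in> quotient_carrier S (fst D) R s \<longleftrightarrow> (\<exists>d \<in> fst D s. c = class_of R s d)"
  by (auto simp: quotient_carrier_def quotient_def class_of_def)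

text \<open>Representatives are chosen one argument at a time. Stating this for any list of sorts
  serves operation symbols and contexts of equations alike.\<close>

lemma args_quotient_carrier:
  assumes "cs \<in> args (quotient_carrier S (fst D) R) ss" "set ss \<subseteq> S"
  obtains ds where "ds \<in> args (fst D) ss" "cs = map2 (class_of R) ss ds"
proof -
  have "\<exists>ds. ds \<in> args (fst D) ss \<and> cs = map2 (class_of R) ss ds"
    using assms unfolding in_args_iff
  proof (induction rule: list_all2_induct)
    case (Cons c cs s ss)
    then obtain d ds where "d \<in> fst D s" "c = class_of R s d"
      "list_all2 (\<lambda>x s. x \<in> fst D s) ds ss" "cs = map2 (class_of R) ss ds"
      by (auto simp: in_quotient_carrier_iff)
    then show ?case
      by (intro exI[of _ "d # ds"]) auto
  qed auto
  then show ?thesis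
    using that by blast
qed

text \<open>Two lists of representatives of the same classes are related componentwise, so
  compatibility of the congruence makes the definite description in \<open>quotient_alg\<close>
  independent of the choice.\<close>

lemma quotient_op:
  assumes \<tau>: "\<tau> \<in> cops \<Sigma>" and ds: "ds \<in> args (fst D) (cins \<Sigma> \<tau>)"
  shows "snd (quotient_alg S \<Sigma> D R) \<tau> (map2 (class_of R) (cins \<Sigma> \<tau>) ds)
    = class_of R (cout \<Sigma> \<tau>) (snd D \<tau> ds)"
proof -
  let ?cs = "map2 (class_of R) (cins \<Sigma> \<tau>) ds"
  have same: "class_of R (cout \<Sigma> \<tau>) (snd D \<tau> ds') = class_of R (cout \<Sigma> \<tau>) (snd D \<tau> ds)"
    if ds': "ds' \<in> args (fst D) (cins \<Sigma> \<tau>)" "?cs = map2 (class_of R) (cins \<Sigma> \<tau>) ds'" for ds'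
  proof -
    have "(ds' ! i, ds ! i) \<in> R (cins \<Sigma> \<tau> ! i)" if i: "i < length (cins \<Sigma> \<tau>)" for i
    proof -
      have "class_of R (cins \<Sigma> \<tau> ! i) (ds ! i) = class_of R (cins \<Sigma> \<tau> ! i) (ds' ! i)"
        using arg_cong[OF ds'(2), of "\<lambda>xs. xs ! i"] i args_length[OF ds] args_length[OF ds'(1)] by simp
      moreover have "cins \<Sigma> \<tau> ! i \<in> S"
        using ins_S[OF \<tau>] i by auto
      ultimately show ?thesis
        using class_of_eq_iff args_nth[OF ds i] args_nth[OF ds'(1) i] by metis
    qed
    then have "(snd D \<tau> ds', snd D \<tau> ds) \<in> R (cout \<Sigma> \<tau>)"
      using R \<tau> ds ds' by (auto simp: congruence_def)
    then show ?thesis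
      using class_of_eq_iff out_S[OF \<tau>] algebra_op_in[OF D \<tau>] ds ds'(1) by simp
  qed
  have "?cs \<in> args (quotient_carrier S (fst D) R) (cins \<Sigma> \<tau>)"
  proof (rule map2_in_args[OF ds])
    fix s d assume "s \<in> set (cins \<Sigma> \<tau>)" "d \<in> fst D s"
    then show "class_of R s d \<in> quotient_carrier S (fst D) R s"
      using ins_S[OF \<tau>] in_quotient_carrier_iff by blast
  qed
  then have "snd (quotient_alg S \<Sigma> D R) \<tau> ?cs = (THE c. \<exists>ds' \<in> args (fst D) (cins \<Sigma> \<tau>).
      ?cs = map2 (class_of R) (cins \<Sigma> \<tau>) ds' \<and> c = class_of R (cout \<Sigma> \<tau>) (snd D \<tau> ds'))"
    using \<tau> by (simp add: quotient_alg_def)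
  also have "\<dots> = class_of R (cout \<Sigma> \<tau>) (snd D \<tau> ds)"
    using ds same by (intro the_equality) blast+
  finally show ?thesis .
qed

lemma quotient_algebra: "quotient_alg S \<Sigma> D R \<in> classical_algebras S \<Sigma>"
proof -
  have "snd (quotient_alg S \<Sigma> D R) \<tau> cs \<in> quotient_carrier S (fst D) R (cout \<Sigma> \<tau>)"
    if \<tau>: "\<tau> \<in> cops \<Sigma>" and cs: "cs \<in> args (quotient_carrier S (fst D) R) (cins \<Sigma> \<tau>)" for \<tau> cs
  proof -
    obtain ds where ds: "ds \<in> args (fst D) (cins \<Sigma> \<tau>)" "cs = map2 (class_of R) (cins \<Sigma> \<tau>) ds"
      using args_quotient_carrier[OF cs ins_S[OF \<tau>]] .
    then show ?thesis
      using quotient_op[OF \<tau> ds(1)] algebra_op_in[OF D \<tau> ds(1)] out_S[OF \<tau>]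
      by (auto simp: in_quotient_carrier_iff)
  qed
  moreover have "quotient_carrier S (fst D) R \<in> Obj (pow_cat S set_cat)"
    using small_image[OF algebra_small[OF D]]
    by (auto simp: Obj_pow_cat quotient_carrier_def quotient_def UNION_singleton_eq_range image_image)
  ultimately show ?thesis
    unfolding classical_algebras_def fst_quotient_alg
    by (auto simp: PiE_iff fst_quotient_alg) (auto simp: quotient_alg_def)
qed

lemma sorted_hom_class_of: "sorted_hom D (quotient_alg S \<Sigma> D R) (class_of R)"
  unfolding sorted_hom_def by (auto simp: quotient_op fst_quotient_alg in_quotient_carrier_iff)

text \<open>Arguments in the quotient lift to representatives, and the class map is a homomorphism.
  Hence the two sides evaluate to the classes of elements that \<open>R\<close> relates.\<close>

lemma quotient_csatisfies:
  assumes "contains_eqns D E R" "e \<in> E" "ceqn_sorted e"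
  shows "csatisfies (quotient_alg S \<Sigma> D R) e"
  unfolding csatisfies_def
proof
  fix cs assume cs: "cs \<in> args (fst (quotient_alg S \<Sigma> D R)) (map snd (cctx e))"
  have ok: "distinct (cctx e)" "snd ` set (cctx e) \<subseteq> S" "csrt e \<in> S"
    "wsorted \<Sigma> (ctx_vars (cctx e)) (clhs e) (csrt e)" "wsorted \<Sigma> (ctx_vars (cctx e)) (crhs e) (csrt e)"
    using assms(3) by (auto simp: ceqn_sorted_def)
  obtain ds where ds: "ds \<in> args (fst D) (map snd (cctx e))" "cs = map2 (class_of R) (map snd (cctx e)) ds"
    using args_quotient_carrier[OF cs[unfolded fst_quotient_alg]] ok by auto
  note l = sorted_hom_term_fun[OF sorted_hom_class_of D ok(1,2) ok(4,3) ds(1)]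
  note r = sorted_hom_term_fun[OF sorted_hom_class_of D ok(1,2) ok(5,3) ds(1)]
  have "(term_fun D (cctx e) (clhs e) ds, term_fun D (cctx e) (crhs e) ds) \<in> R (csrt e)"
    using assms ds by (auto simp: contains_eqns_def)
  then show "term_fun (quotient_alg S \<Sigma> D R) (cctx e) (clhs e) cs
      = term_fun (quotient_alg S \<Sigma> D R) (cctx e) (crhs e) cs"
    using l r class_of_eq_iff[OF ok(3)] ds(2) by metis
qed

end

text \<open>The kernel of a homomorphism into a model is one of the relations intersected in the
  generated congruence. This gives the factorization of homomorphisms through the quotient.\<close>

lemma congruence_kernel:
  assumes D: "D \<in> classical_algebras S \<Sigma>" and h: "sorted_hom D A h"
  defines "R \<equiv> \<lambda>s. {(d, d'). d \<in> fst D s \<and> d' \<in> fst D s \<and> h s d = h s d'}"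
  shows "congruence S \<Sigma> D R"
    and "(\<And>e. e \<in> E \<Longrightarrow> ceqn_sorted e \<and> csatisfies A e) \<Longrightarrow> contains_eqns D E R"
proof -
  show "congruence S \<Sigma> D R"
    unfolding congruence_def
  proof (intro conjI ballI impI)
    fix s show "equiv (fst D s) (R s)"
      by (auto simp: R_def equiv_def refl_on_def sym_def trans_def)
  next
    fix \<tau> ds ds'
    assume \<tau>: "\<tau> \<in> cops \<Sigma>" and ds: "ds \<in> args (fst D) (cins \<Sigma> \<tau>)" "ds' \<in> args (fst D) (cins \<Sigma> \<tau>)"
      and rel: "\<forall>i < length (cins \<Sigma> \<tau>). (ds ! i, ds' ! i) \<in> R (cins \<Sigma> \<tau> ! i)"
    have "map2 h (cins \<Sigma> \<tau>) ds = map2 h (cins \<Sigma> \<tau>) ds'"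
      using rel ds[THEN args_length] by (intro nth_equalityI) (auto simp: R_def)
    then show "(snd D \<tau> ds, snd D \<tau> ds') \<in> R (cout \<Sigma> \<tau>)"
      using \<tau> ds sorted_hom_op[OF h \<tau>] algebra_op_in[OF D \<tau>] by (simp add: R_def)
  qed
  assume E: "\<And>e. e \<in> E \<Longrightarrow> ceqn_sorted e \<and> csatisfies A e"
  show "contains_eqns D E R"
    unfolding contains_eqns_def
  proof (intro ballI)
    fix e ds assume e: "e \<in> E" and ds: "ds \<in> args (fst D) (map snd (cctx e))"
    have ok: "distinct (cctx e)" "snd ` set (cctx e) \<subseteq> S" "csrt e \<in> S"
      "wsorted \<Sigma> (ctx_vars (cctx e)) (clhs e) (csrt e)" "wsorted \<Sigma> (ctx_vars (cctx e)) (crhs e) (csrt e)"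
      using E[OF e] by (auto simp: ceqn_sorted_def)
    have "map2 h (map snd (cctx e)) ds \<in> args (fst A) (map snd (cctx e))"
      using ok sorted_hom_in[OF h] by (intro map2_in_args[OF ds]) auto
    then have "term_fun A (cctx e) (clhs e) (map2 h (map snd (cctx e)) ds)
        = term_fun A (cctx e) (crhs e) (map2 h (map snd (cctx e)) ds)"
      using E[OF e] by (auto simp: csatisfies_def)
    then show "(term_fun D (cctx e) (clhs e) ds, term_fun D (cctx e) (crhs e) ds) \<in> R (csrt e)"
      using sorted_hom_term_fun[OF h D ok(1,2) ok(4,3) ds] sorted_hom_term_fun[OF h D ok(1,2) ok(5,3) ds]
      by (simp add: R_def)
  qed
qed

lemma generated_congruence:
  assumes D: "D \<in> classical_algebras S \<Sigma>" and E: "\<And>e. e \<in> E \<Longrightarrow> ceqn_sorted e"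
  shows "congruence S \<Sigma> D (generated_congruence S \<Sigma> D E)"
    and "contains_eqns D E (generated_congruence S \<Sigma> D E)"
    and "congruence S \<Sigma> D R \<Longrightarrow> contains_eqns D E R \<Longrightarrow> generated_congruence S \<Sigma> D E s \<subseteq> R s"
proof -
  let ?G = "generated_congruence S \<Sigma> D E"
  have G: "(d, d') \<in> ?G s \<longleftrightarrow> (\<forall>R. congruence S \<Sigma> D R \<and> contains_eqns D E R \<longrightarrow> (d, d') \<in> R s)" for d d' s
    by (auto simp: generated_congruence_def)
  \<comment> \<open>The full relation on the carriers is a congruence that contains the equations,
    as both sides are well-sorted. So the intersection runs over a nonempty family and stays inside
    the carriers instead of being everything.\<close>
  let ?T = "\<lambda>s. fst D s \<times> fst D s"
  have T: "congruence S \<Sigma> D ?T"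
    using algebra_op_in[OF D] by (auto simp: congruence_def equiv_def refl_on_def sym_def trans_def)
  have T_eqns: "contains_eqns D E ?T"
    unfolding contains_eqns_def
    using E sorted_hom_term_fun(1)[OF sorted_hom_id D] by (auto simp: ceqn_sorted_def)
  show "contains_eqns D E ?G"
    by (auto simp: contains_eqns_def G)
  show "?G s \<subseteq> R s" if "congruence S \<Sigma> D R" "contains_eqns D E R"
    using that G by auto
  show "congruence S \<Sigma> D ?G"
    unfolding congruence_def
  proof (intro conjI ballI impI)
    fix s assume s: "s \<in> S"
    have eq: "equiv (fst D s) (R s)" if "congruence S \<Sigma> D R" for R
      using that s by (simp add: congruence_def)
    have sub: "?G s \<subseteq> fst D s \<times> fst D s"
      using T T_eqns by (auto simp: G)
    have refl: "refl_on (fst D s) (?G s)"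
      using eq by (auto simp: refl_on_def G equiv_def)
    have sym: "sym (?G s)"
      using eq by (auto simp: sym_def G equiv_def)
    have trans: "trans (?G s)"
    proof (rule transI)
      fix x y z assume "(x, y) \<in> ?G s" "(y, z) \<in> ?G s"
      then show "(x, z) \<in> ?G s"
        using eq unfolding G equiv_def by (meson transD)
    qed
    show "equiv (fst D s) (?G s)"
      using sub refl sym trans by (intro equivI) auto
  next
    fix \<tau> ds ds'
    assume "\<tau> \<in> cops \<Sigma>" "ds \<in> args (fst D) (cins \<Sigma> \<tau>)" "ds' \<in> args (fst D) (cins \<Sigma> \<tau>)"
      "\<forall>i < length (cins \<Sigma> \<tau>). (ds ! i, ds' ! i) \<in> ?G (cins \<Sigma> \<tau> ! i)"
    then show "(snd D \<tau> ds, snd D \<tau> ds') \<in> ?G (cout \<Sigma> \<tau>)"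
      unfolding G by (auto simp: congruence_def)
  qed
qed

end

section \<open>Term algebras\<close>

text \<open>Induction on the term: the tags decide between leaf and application, and injectivity of
  pairs and tuples exposes the parts. Terms can therefore be decoded from elements of the
  universe.\<close>

lemma inj_enc_trm:
  assumes "inj oe" "inj xe"
  shows "inj (enc_trm oe xe)"
proof
  fix t t' show "enc_trm oe xe t = enc_trm oe xe t' \<Longrightarrow> t = t'"
  proof (induction t arbitrary: t')
    case (Var x)
    then show ?case
      using assms(2) by (cases t') (auto simp: enc_leaf_def enc_op_def inj_eq)
  next
    case (Op \<tau> ts)
    show ?case
    proof (cases t')
      case (Var x)
      then show ?thesis
        using Op.prems by (simp add: enc_leaf_def enc_op_def)
    next
      case (Op \<tau>' ts')
      then have eq: "\<tau> = \<tau>'" "map (enc_trm oe xe) ts = map (enc_trm oe xe) ts'"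
        using Op.prems assms(1) by (auto simp: enc_op_def inj_eq)
      then have "length ts = length ts'"
        using map_eq_imp_length_eq by blast
      then have "ts = ts'"
        using eq(2) Op.IH by (auto simp: list_eq_iff_nth_eq)
      then show ?thesis
        using eq Op by simp
    qed
  qed
qed

text \<open>A leaf may occur in several sorts, so evaluation in an \<open>S\<close>-sorted family of valuations
  takes the sort as an argument.\<close>

primrec sorted_eval :: "('o, 'u) csig \<Rightarrow> ('o, 'u) calg \<Rightarrow> ('u \<Rightarrow> 'x \<Rightarrow> 'u) \<Rightarrow> ('o, 'x) trm \<Rightarrow> 'u \<Rightarrow> 'u" where
  "sorted_eval \<Sigma> A f (Var x) = (\<lambda>s. f s x)"
| "sorted_eval \<Sigma> A f (Op \<tau> ts) =
     (\<lambda>s. snd A \<tau> (map2 (\<lambda>s e. e s) (cins \<Sigma> \<tau>) (map (sorted_eval \<Sigma> A f) ts)))"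

locale term_signature = classical_signature S \<Sigma>
  for S :: "'u::set_universe set" and \<Sigma> :: "('o, 'u) csig" +
  fixes oe :: "'o \<Rightarrow> 'u"
  assumes small_S: "small S" and inj_oe: "inj oe" and small_ops: "small (oe ` cops \<Sigma>)"
begin

text \<open>Codes of terms are gathered in stages \<open>L n\<close>: the leaves, then at each step
  all applications of operation symbols to lists from the previous stage. Each stage is small and
  there are countably many.\<close>

lemma small_enc_trms:
  assumes "\<And>s. s \<in> S \<Longrightarrow> small (xe ` Y s)"
  shows "small (enc_trm oe xe ` {t. \<exists>s \<in> S. wsorted \<Sigma> Y t s})"
proof -
  define L where "L = rec_nat (enc_leaf ` (\<Union>s\<in>S. xe ` Y s))
    (\<lambda>_ X. X \<union> (\<Union>c \<in> oe ` cops \<Sigma>. enc_op c ` lists X))"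
  have L0: "L 0 = enc_leaf ` (\<Union>s\<in>S. xe ` Y s)"
    and LSuc: "L (Suc n) = L n \<union> (\<Union>c \<in> oe ` cops \<Sigma>. enc_op c ` lists (L n))" for n
    by (simp_all add: L_def)
  have mono: "m \<le> n \<Longrightarrow> L m \<subseteq> L n" for m n
    by (rule lift_Suc_mono_le[of L]) (auto simp: LSuc)
  have "small (L n)" for n
  proof (induction n)
    case 0
    then show ?case
      unfolding L0 using small_S assms by (intro small_image small_UN) auto
  next
    case (Suc n)
    have "enc_op c ` lists (L n) = (\<lambda>z. pair (encode_set {point}) (pair c z)) ` (tup ` lists (L n))" for c
      by (auto simp: enc_op_def)
    then have "small (enc_op c ` lists (L n))" for c
      using small_image[OF small_tup_lists[OF Suc]] by metis
    then show ?case
      unfolding LSuc using Suc small_ops by (intro small_Un small_UN) auto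
  qed
  moreover have "\<exists>n. enc_trm oe xe t \<in> L n" if "wsorted \<Sigma> Y t s" "s \<in> S" for t s
    using that
  proof induction
    case (1 x s)
    then have "enc_trm oe xe (Var x) \<in> L 0"
      by (auto simp: L0)
    then show ?case ..
  next
    case (2 \<tau> ts)
      have "list_all2 (\<lambda>t s. \<exists>n. enc_trm oe xe t \<in> L n) ts (cins \<Sigma> \<tau>)"
      using 2(2)
    proof (rule list.rel_mono_strong)
      fix t s assume "s \<in> set (cins \<Sigma> \<tau>)"
      then show "wsorted \<Sigma> Y t s \<and> (s \<in> S \<longrightarrow> (\<exists>n. enc_trm oe xe t \<in> L n)) \<Longrightarrow> \<exists>n. enc_trm oe xe t \<in> L n"
        using ins_S[OF 2(1)] by auto
    qed
    \<comment> \<open>An application has finitely many arguments and the stages increase, so the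
      maximum of their stages contains them all.\<close>
    then have "\<exists>n. \<forall>t \<in> set ts. enc_trm oe xe t \<in> L n"
    proof (induction rule: list_all2_induct)
      case (Cons t ts s ss)
      then obtain m n where "enc_trm oe xe t \<in> L m" "\<forall>t \<in> set ts. enc_trm oe xe t \<in> L n"
        by auto
      then have "\<forall>t \<in> set (t # ts). enc_trm oe xe t \<in> L (max m n)"
        using mono[of m "max m n"] mono[of n "max m n"] by auto
      then show ?case ..
    qed auto
    then obtain n where "\<forall>t \<in> set ts. enc_trm oe xe t \<in> L n" ..
    then have "enc_trm oe xe (Op \<tau> ts) \<in> L (Suc n)"
      using 2(1) by (auto simp: LSuc intro!: bexI[of _ \<tau>] imageI)
    then show ?case ..
  qed
  then have "enc_trm oe xe ` {t. \<exists>s \<in> S. wsorted \<Sigma> Y t s} \<subseteq> (\<Union>n. L n)"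
    by auto
  ultimately show ?thesis
    using small_UN_nat[of L] small_subset by blast
qed

lemma in_term_carrier_iff:
  "s \<in> S \<Longrightarrow> d \<in> term_carrier S \<Sigma> oe xe Y s \<longleftrightarrow> (\<exists>t. wsorted \<Sigma> Y t s \<and> d = enc_trm oe xe t)"
  by (auto simp: term_carrier_def)

lemma fst_term_alg [simp]: "fst (term_alg S \<Sigma> oe xe Y) = term_carrier S \<Sigma> oe xe Y"
  by (simp add: term_alg_def)

lemma enc_trms_in_args:
  assumes "list_all2 (wsorted \<Sigma> Y) ts ss" "set ss \<subseteq> S"
  shows "map (enc_trm oe xe) ts \<in> args (term_carrier S \<Sigma> oe xe Y) ss"
  using assms(1) unfolding in_args_iff list.rel_map
proof (rule list.rel_mono_strong)
  fix t s assume "s \<in> set ss" "wsorted \<Sigma> Y t s"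
  then show "enc_trm oe xe t \<in> term_carrier S \<Sigma> oe xe Y s"
    using assms(2) in_term_carrier_iff by blast
qed

lemma args_term_carrierE:
  assumes "ds \<in> args (term_carrier S \<Sigma> oe xe Y) ss" "set ss \<subseteq> S"
  obtains ts where "list_all2 (wsorted \<Sigma> Y) ts ss" "ds = map (enc_trm oe xe) ts"
proof -
  have "\<exists>ts. list_all2 (wsorted \<Sigma> Y) ts ss \<and> ds = map (enc_trm oe xe) ts"
    using assms unfolding in_args_iff
  proof (induction rule: list_all2_induct)
    case (Cons d ds s ss)
    then obtain t ts where "wsorted \<Sigma> Y t s" "d = enc_trm oe xe t"
      "list_all2 (wsorted \<Sigma> Y) ts ss" "ds = map (enc_trm oe xe) ts"
      by (auto simp: in_term_carrier_iff)
    then show ?case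
      by (intro exI[of _ "t # ts"]) auto
  qed auto
  then show ?thesis
    using that by blast
qed

lemma term_alg_op:
  assumes "\<tau> \<in> cops \<Sigma>" "list_all2 (wsorted \<Sigma> Y) ts (cins \<Sigma> \<tau>)"
  shows "snd (term_alg S \<Sigma> oe xe Y) \<tau> (map (enc_trm oe xe) ts) = enc_trm oe xe (Op \<tau> ts)"
  using assms enc_trms_in_args[OF assms(2) ins_S[OF assms(1)]] by (simp add: term_alg_def)

text \<open>Under the valuation of each leaf by its own code, evaluation merely rebuilds the term.
  Thus a term is its own value at the generic arguments.\<close>

lemma eval_trm_term_alg:
  assumes "wsorted \<Sigma> Y t s"
  shows "eval_trm (term_alg S \<Sigma> oe xe Y) (\<lambda>x. enc_leaf (xe x)) t = enc_trm oe xe t"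
  using assms
proof induction
  case (2 \<tau> ts)
  then have ts: "list_all2 (wsorted \<Sigma> Y) ts (cins \<Sigma> \<tau>)"
    by (auto elim: list_all2_mono)
  have map_eq: "map (eval_trm (term_alg S \<Sigma> oe xe Y) (\<lambda>x. enc_leaf (xe x))) ts = map (enc_trm oe xe) ts"
    using 2(2) by (fastforce simp: list_all2_conv_all_nth in_set_conv_nth)
  show ?case
    unfolding eval_trm.simps map_eq by (rule term_alg_op[OF 2(1) ts])
qed simp

lemma term_algebra:
  assumes "\<And>s. s \<in> S \<Longrightarrow> small (xe ` Y s)"
  shows "term_alg S \<Sigma> oe xe Y \<in> classical_algebras S \<Sigma>"
proof -
  let ?D = "term_alg S \<Sigma> oe xe Y"
  have "snd ?D \<tau> ds \<in> term_carrier S \<Sigma> oe xe Y (cout \<Sigma> \<tau>)"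
    if \<tau>: "\<tau> \<in> cops \<Sigma>" and ds: "ds \<in> args (term_carrier S \<Sigma> oe xe Y) (cins \<Sigma> \<tau>)" for \<tau> ds
  proof -
    obtain ts where ts: "list_all2 (wsorted \<Sigma> Y) ts (cins \<Sigma> \<tau>)" "ds = map (enc_trm oe xe) ts"
      using args_term_carrierE[OF ds ins_S[OF \<tau>]] .
    then have "wsorted \<Sigma> Y (Op \<tau> ts) (cout \<Sigma> \<tau>)"
      using \<tau> by (intro wsorted.intros)
    then show ?thesis
      using term_alg_op[OF \<tau> ts(1)] ts(2) in_term_carrier_iff[OF out_S[OF \<tau>]] by blast
  qed
  moreover have "small (enc_trm oe xe ` {t. wsorted \<Sigma> Y t s})" if "s \<in> S" for s
    by (rule small_subset[OF small_enc_trms[of xe Y, OF assms]]) (use that in auto)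
  then have "term_carrier S \<Sigma> oe xe Y \<in> Obj (pow_cat S set_cat)"
    by (auto simp: Obj_pow_cat term_carrier_def)
  ultimately show ?thesis
    unfolding classical_algebras_def by (auto simp: PiE_iff) (auto simp: term_alg_def)
qed

text \<open>Existence half of freeness of the term algebra, before any equations are imposed; any
  sorted valuation of the leaves extends.\<close>

lemma sorted_hom_term_alg:
  assumes inj_xe: "inj xe" and A: "A \<in> classical_algebras S \<Sigma>"
    and f: "\<And>s x. s \<in> S \<Longrightarrow> x \<in> Y s \<Longrightarrow> f s x \<in> fst A s"
  obtains h where "sorted_hom (term_alg S \<Sigma> oe xe Y) A h" "\<And>s x. h s (enc_leaf (xe x)) = f s x"
proof -
  \<comment> \<open>Decode, then evaluate. The leaf equation needs no sort condition because
    \<open>sorted_eval\<close> hands the sort on to \<open>f\<close>.\<close>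
  define h where "h s d = sorted_eval \<Sigma> A f (inv (enc_trm oe xe) d) s" for s d
  have h: "h s (enc_trm oe xe t) = sorted_eval \<Sigma> A f t s" for s t
    by (simp add: h_def inj_enc_trm[OF inj_oe inj_xe])
  have h_map: "map2 h ss (map (enc_trm oe xe) ts) = map2 (\<lambda>s e. e s) ss (map (sorted_eval \<Sigma> A f) ts)" for ss ts
    by (auto intro!: nth_equalityI simp: h)
  have "sorted_eval \<Sigma> A f t s \<in> fst A s" if "wsorted \<Sigma> Y t s" "s \<in> S" for t s
    using that
  proof induction
    case (2 \<tau> ts)
    have "map2 (\<lambda>s e. e s) (cins \<Sigma> \<tau>) (map (sorted_eval \<Sigma> A f) ts) \<in> args (fst A) (cins \<Sigma> \<tau>)"
      using 2(2) subsetD[OF ins_S[OF 2(1)] nth_mem]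
      by (auto simp: in_args_iff list_all2_conv_all_nth)
    then show ?case
      using algebra_op_in[OF A 2(1)] by simp
  qed (use f in simp)
  then have "h s d \<in> fst A s" if "s \<in> S" "d \<in> term_carrier S \<Sigma> oe xe Y s" for s d
    using that by (auto simp: in_term_carrier_iff h)
  moreover have "h (cout \<Sigma> \<tau>) (snd (term_alg S \<Sigma> oe xe Y) \<tau> ds) = snd A \<tau> (map2 h (cins \<Sigma> \<tau>) ds)"
    if \<tau>: "\<tau> \<in> cops \<Sigma>" and ds: "ds \<in> args (term_carrier S \<Sigma> oe xe Y) (cins \<Sigma> \<tau>)" for \<tau> ds
  proof -
    obtain ts where ts: "list_all2 (wsorted \<Sigma> Y) ts (cins \<Sigma> \<tau>)" "ds = map (enc_trm oe xe) ts"
      using args_term_carrierE[OF ds ins_S[OF \<tau>]] .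
    show ?thesis
      unfolding ts(2) term_alg_op[OF \<tau> ts(1)] h h_map by simp
  qed
  ultimately have "sorted_hom (term_alg S \<Sigma> oe xe Y) A h"
    by (simp add: sorted_hom_def)
  moreover have "h s (enc_leaf (xe x)) = f s x" for s x
    using h[of s "Var x"] by simp
  ultimately show ?thesis
    using that by blast
qed

text \<open>Uniqueness half of freeness: every element of the carrier is the code of a term, and
  induction on that term carries agreement up from the leaves.\<close>

lemma sorted_hom_term_alg_unique:
  assumes "sorted_hom (term_alg S \<Sigma> oe xe Y) A h" "sorted_hom (term_alg S \<Sigma> oe xe Y) A h'"
    and "\<And>s x. s \<in> S \<Longrightarrow> x \<in> Y s \<Longrightarrow> h s (enc_leaf (xe x)) = h' s (enc_leaf (xe x))"
    and "s \<in> S" "d \<in> term_carrier S \<Sigma> oe xe Y s"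
  shows "h s d = h' s d"
proof -
  have "h s (enc_trm oe xe t) = h' s (enc_trm oe xe t)" if "wsorted \<Sigma> Y t s" "s \<in> S" for t s
    using that
  proof induction
    case (2 \<tau> ts)
    then have ts: "list_all2 (wsorted \<Sigma> Y) ts (cins \<Sigma> \<tau>)"
      by (auto elim: list_all2_mono)
    have "map2 h (cins \<Sigma> \<tau>) (map (enc_trm oe xe) ts) = map2 h' (cins \<Sigma> \<tau>) (map (enc_trm oe xe) ts)"
    proof (rule nth_equalityI)
      fix i assume "i < length (map2 h (cins \<Sigma> \<tau>) (map (enc_trm oe xe) ts))"
      then show "map2 h (cins \<Sigma> \<tau>) (map (enc_trm oe xe) ts) ! i = map2 h' (cins \<Sigma> \<tau>) (map (enc_trm oe xe) ts) ! i"
        using 2(2) subsetD[OF ins_S[OF 2(1)] nth_mem] by (auto simp: list_all2_conv_all_nth)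
    qed simp
    moreover have "map (enc_trm oe xe) ts \<in> args (fst (term_alg S \<Sigma> oe xe Y)) (cins \<Sigma> \<tau>)"
      using enc_trms_in_args[OF ts ins_S[OF 2(1)]] by simp
    ultimately show ?case
      using sorted_hom_op[OF assms(1) 2(1)] sorted_hom_op[OF assms(2) 2(1)] term_alg_op[OF 2(1) ts] by metis
  qed (use assms(3) in simp)
  then show ?thesis
    using assms(4,5) by (auto simp: in_term_carrier_iff)
qed

end

section \<open>Free algebras of classical theories\<close>

locale classical_theory = term_signature S \<Sigma> oe
  for S :: "'u::set_universe set" and \<Sigma> :: "('o, 'u) csig" and oe :: "'o \<Rightarrow> 'u" +
  fixes E :: "('o, 'u) ceqn set"
  assumes eqns_sorted: "e \<in> E \<Longrightarrow> ceqn_sorted e"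
begin

lemma Obj_classical_theory_cat:
  "Obj (classical_theory_cat S \<Sigma> E) = {A \<in> classical_algebras S \<Sigma>. \<forall>e \<in> E. csatisfies A e}"
  by (simp add: classical_theory_cat_def)

lemma hom_classical_theory_cat_iff:
  "f \<in> hom (classical_theory_cat S \<Sigma> E) A B \<longleftrightarrow>
     f \<in> hom (classical_alg_cat S \<Sigma>) A B \<and> (\<forall>e \<in> E. csatisfies A e) \<and> (\<forall>e \<in> E. csatisfies B e)"
  unfolding classical_theory_cat_def hom_full_subcat_iff ..

lemma is_functor_classical_forget: "is_functor (classical_theory_cat S \<Sigma> E) (pow_cat S set_cat) classical_forget"
  using is_functor_full_subcat[OF classical_alg_cat_functor(2), of _ "\<lambda>_. True"]
  unfolding classical_theory_cat_def full_subcat_top by blast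

section \<open>The free model on a fixed sorted set\<close>

context
  fixes Y :: "'u \<Rightarrow> 'u set"
  assumes Y: "Y \<in> Obj (pow_cat S set_cat)"
begin

lemma small_generators: "s \<in> S \<Longrightarrow> small ((\<lambda>y. y) ` Y s)"
  using Y by (auto simp: Obj_pow_cat)

lemma free_sig_algebra: "free_sig_alg S \<Sigma> oe Y \<in> classical_algebras S \<Sigma>"
  unfolding free_sig_alg_def using small_generators by (rule term_algebra)

lemma congruence_free_congruence: "congruence S \<Sigma> (free_sig_alg S \<Sigma> oe Y) (free_congruence S \<Sigma> E oe Y)"
  and contains_eqns_free_congruence: "contains_eqns (free_sig_alg S \<Sigma> oe Y) E (free_congruence S \<Sigma> E oe Y)"
  unfolding free_congruence_def using generated_congruence(1,2)[OF free_sig_algebra eqns_sorted] by blast+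

lemma free_alg_Obj: "free_alg S \<Sigma> E oe Y \<in> Obj (classical_theory_cat S \<Sigma> E)"
  unfolding Obj_classical_theory_cat free_alg_def
  using quotient_algebra[OF free_sig_algebra congruence_free_congruence]
    quotient_csatisfies[OF free_sig_algebra congruence_free_congruence contains_eqns_free_congruence] eqns_sorted
  by blast

lemma in_free_alg_iff:
  "s \<in> S \<Longrightarrow> c \<in> fst (free_alg S \<Sigma> E oe Y) s \<longleftrightarrow>
     (\<exists>d \<in> term_carrier S \<Sigma> oe (\<lambda>y. y) Y s. c = class_of (free_congruence S \<Sigma> E oe Y) s d)"
  using in_quotient_carrier_iff[OF free_sig_algebra congruence_free_congruence, of s c]
  by (simp add: free_alg_def free_sig_alg_def fst_quotient_alg)

lemma sorted_hom_free_class: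
  "sorted_hom (term_alg S \<Sigma> oe (\<lambda>y. y) Y) (free_alg S \<Sigma> E oe Y) (class_of (free_congruence S \<Sigma> E oe Y))"
  using sorted_hom_class_of[OF free_sig_algebra congruence_free_congruence]
  unfolding free_alg_def free_sig_alg_def .

lemma leaf_in_term_carrier: "s \<in> S \<Longrightarrow> y \<in> Y s \<Longrightarrow> enc_leaf y \<in> term_carrier S \<Sigma> oe (\<lambda>y. y) Y s"
  using in_term_carrier_iff[of s "enc_leaf y" "\<lambda>y. y" Y] wsorted.intros(1)[of y Y s \<Sigma>]
  by (metis enc_trm.simps(1))

lemma free_unit_hom:
  "free_unit S \<Sigma> E oe Y \<in> hom (pow_cat S set_cat) Y (fst (free_alg S \<Sigma> E oe Y))"
  and app_free_unit: "s \<in> S \<Longrightarrow> y \<in> Y s \<Longrightarrow>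
    app (free_unit S \<Sigma> E oe Y s) y = class_of (free_congruence S \<Sigma> E oe Y) s (enc_leaf y)"
proof -
  have eq: "free_unit S \<Sigma> E oe Y = sorted_arrow S Y
      (\<lambda>s y. class_of (free_congruence S \<Sigma> E oe Y) s (enc_leaf y)) (fst (free_alg S \<Sigma> E oe Y))"
    by (simp add: free_unit_def sorted_arrow_def)
  show "free_unit S \<Sigma> E oe Y \<in> hom (pow_cat S set_cat) Y (fst (free_alg S \<Sigma> E oe Y))"
    unfolding eq using Y free_alg_Obj algebra_carrier leaf_in_term_carrier
    by (intro sorted_arrow_hom) (auto simp: Obj_classical_theory_cat in_free_alg_iff)
  show "s \<in> S \<Longrightarrow> y \<in> Y s \<Longrightarrow>
    app (free_unit S \<Sigma> E oe Y s) y = class_of (free_congruence S \<Sigma> E oe Y) s (enc_leaf y)"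
    unfolding eq by (simp add: app_sorted_arrow)
qed

text \<open>The extension \<open>k\<close> of \<open>f\<close> to terms has a kernel that contains
  the generated congruence, since \<open>A\<close> is a model. Hence \<open>k\<close> factors
  through the quotient, and the factor is again a homomorphism.\<close>

lemma sharp_exists:
  assumes A: "A \<in> Obj (classical_theory_cat S \<Sigma> E)" and f: "f \<in> hom (pow_cat S set_cat) Y (fst A)"
  shows "\<exists>h \<in> hom (classical_theory_cat S \<Sigma> E) (free_alg S \<Sigma> E oe Y) A.
    FA classical_forget h \<cdot>\<^bsub>pow_cat S set_cat\<^esub> free_unit S \<Sigma> E oe Y = f"
proof -
  let ?D = "term_alg S \<Sigma> oe (\<lambda>y. y) Y" and ?q = "class_of (free_congruence S \<Sigma> E oe Y)"
  let ?F = "free_alg S \<Sigma> E oe Y"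
  have D: "?D \<in> classical_algebras S \<Sigma>"
    using free_sig_algebra by (simp add: free_sig_alg_def)
  have A': "A \<in> classical_algebras S \<Sigma>" "\<And>e. e \<in> E \<Longrightarrow> csatisfies A e"
    using A by (auto simp: Obj_classical_theory_cat)
  have F: "?F \<in> classical_algebras S \<Sigma>"
    using free_alg_Obj by (auto simp: Obj_classical_theory_cat)
  obtain k where k: "sorted_hom ?D A k" "\<And>s y. k s (enc_leaf y) = app (f s) y"
    using sorted_hom_term_alg[where xe = "\<lambda>y. y" and Y = Y and f = "\<lambda>s. app (f s)", OF _ A'(1)]
      sorted_app_in[OF f] by auto
  have kernel: "k s d = k s d'"
    if "s \<in> S" "d \<in> term_carrier S \<Sigma> oe (\<lambda>y. y) Y s" "d' \<in> term_carrier S \<Sigma> oe (\<lambda>y. y) Y s" "?q s d = ?q s d'"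
    for s d d'
  proof -
    have "(d, d') \<in> free_congruence S \<Sigma> E oe Y s"
      using class_of_eq_iff[OF free_sig_algebra congruence_free_congruence, of s d d'] that
      by (simp add: free_sig_alg_def)
    moreover have "free_congruence S \<Sigma> E oe Y s \<subseteq> {(d, d'). d \<in> fst ?D s \<and> d' \<in> fst ?D s \<and> k s d = k s d'}"
      unfolding free_congruence_def free_sig_alg_def
      using generated_congruence(3)[OF D eqns_sorted congruence_kernel(1)[OF D k(1)]
          congruence_kernel(2)[OF D k(1)], of E] eqns_sorted A'(2) by blast
    ultimately show ?thesis
      by blast
  qed
  \<comment> \<open>The choice of representative does not matter by \<open>kernel\<close>.\<close>
  define h where "h s c = k s (SOME d. d \<in> term_carrier S \<Sigma> oe (\<lambda>y. y) Y s \<and> c = ?q s d)" for s c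
  have h: "h s (?q s d) = k s d" if "s \<in> S" "d \<in> term_carrier S \<Sigma> oe (\<lambda>y. y) Y s" for s d
  proof -
    let ?d = "SOME d'. d' \<in> term_carrier S \<Sigma> oe (\<lambda>y. y) Y s \<and> ?q s d = ?q s d'"
    have "?d \<in> term_carrier S \<Sigma> oe (\<lambda>y. y) Y s \<and> ?q s d = ?q s ?d"
      by (rule someI[of _ d]) (use that in simp)
    then have "k s d = k s ?d"
      using kernel[OF that] by blast
    then show ?thesis
      by (simp add: h_def)
  qed
  have "sorted_hom ?F A h"
    unfolding sorted_hom_def
  proof (intro conjI ballI)
    fix s c assume s: "s \<in> S" "c \<in> fst ?F s"
    then show "h s c \<in> fst A s"
      using sorted_hom_in[OF k(1) s(1)] h by (auto simp: in_free_alg_iff)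
  next
    fix \<tau> cs assume \<tau>: "\<tau> \<in> cops \<Sigma>" and cs: "cs \<in> args (fst ?F) (cins \<Sigma> \<tau>)"
    obtain ds where ds: "ds \<in> args (fst ?D) (cins \<Sigma> \<tau>)" "cs = map2 ?q (cins \<Sigma> \<tau>) ds"
      using args_quotient_carrier[OF free_sig_algebra congruence_free_congruence, of cs] cs ins_S[OF \<tau>]
      by (auto simp: free_alg_def fst_quotient_alg free_sig_alg_def)
    have "map2 h (cins \<Sigma> \<tau>) cs = map2 k (cins \<Sigma> \<tau>) ds"
      unfolding ds(2) map2_map2 using ins_S[OF \<tau>] h by (intro map2_args_cong[OF ds(1)]) auto
    then show "h (cout \<Sigma> \<tau>) (snd ?F \<tau> cs) = snd A \<tau> (map2 h (cins \<Sigma> \<tau>) cs)"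
      using h[OF out_S[OF \<tau>], of "snd ?D \<tau> ds"] algebra_op_in[OF D \<tau> ds(1)]
      by (simp add: ds(2) sorted_hom_op[OF k(1) \<tau> ds(1)] sorted_hom_op[OF sorted_hom_free_class \<tau> ds(1)])
  qed
  then have hom: "(?F, sorted_arrow S (fst ?F) h (fst A), A) \<in> hom (classical_theory_cat S \<Sigma> E) ?F A"
    using sorted_arrow_hom_alg[OF F A'(1)] A free_alg_Obj
    by (simp add: hom_classical_theory_cat_iff Obj_classical_theory_cat)
  have arrow: "sorted_arrow S (fst ?F) h (fst A) \<in> hom (pow_cat S set_cat) (fst ?F) (fst A)"
    using hom by (auto simp: hom_classical_theory_cat_iff hom_classical_alg_cat_iff)
  have "sorted_arrow S (fst ?F) h (fst A) \<cdot>\<^bsub>pow_cat S set_cat\<^esub> free_unit S \<Sigma> E oe Y = f"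
  proof (rule sorted_arrow_eqI[OF category.Cmp_hom[OF category_pow_set_cat free_unit_hom arrow] f])
    fix s y assume s: "s \<in> S" "y \<in> Y s"
    then have "class_of (free_congruence S \<Sigma> E oe Y) s (enc_leaf y) \<in> fst ?F s"
      using leaf_in_term_carrier by (auto simp: in_free_alg_iff)
    then show "app ((sorted_arrow S (fst ?F) h (fst A) \<cdot>\<^bsub>pow_cat S set_cat\<^esub> free_unit S \<Sigma> E oe Y) s) y = app (f s) y"
      using s sorted_app_Cmp[OF free_unit_hom arrow] h leaf_in_term_carrier k(2)
      by (simp add: app_free_unit app_sorted_arrow)
  qed
  then show ?thesis
    using hom by (intro bexI[of _ "(?F, sorted_arrow S (fst ?F) h (fst A), A)"])
      (simp_all add: classical_forget_def struct_forget_def)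
qed

text \<open>Composed with the class map, both become homomorphisms on the term algebra that agree on
  leaves, hence everywhere; the class map is onto the carrier.\<close>

lemma sharp_unique:
  assumes g: "g \<in> hom (classical_theory_cat S \<Sigma> E) (free_alg S \<Sigma> E oe Y) A"
    and g': "g' \<in> hom (classical_theory_cat S \<Sigma> E) (free_alg S \<Sigma> E oe Y) A"
    and eq: "FA classical_forget g \<cdot>\<^bsub>pow_cat S set_cat\<^esub> free_unit S \<Sigma> E oe Y
      = FA classical_forget g' \<cdot>\<^bsub>pow_cat S set_cat\<^esub> free_unit S \<Sigma> E oe Y"
  shows "g = g'"
proof -
  let ?F = "free_alg S \<Sigma> E oe Y" and ?q = "class_of (free_congruence S \<Sigma> E oe Y)"
  obtain f f' where f: "f \<in> hom (pow_cat S set_cat) (fst ?F) (fst A)" "sorted_hom ?F A (\<lambda>s. app (f s))" "g = (?F, f, A)"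
    and f': "f' \<in> hom (pow_cat S set_cat) (fst ?F) (fst A)" "sorted_hom ?F A (\<lambda>s. app (f' s))" "g' = (?F, f', A)"
    using g g' by (auto simp: hom_classical_theory_cat_iff hom_classical_alg_cat_iff)
  have "app (f s) (?q s (enc_leaf y)) = app (f' s) (?q s (enc_leaf y))" if "s \<in> S" "y \<in> Y s" for s y
  proof -
    have "f \<cdot>\<^bsub>pow_cat S set_cat\<^esub> free_unit S \<Sigma> E oe Y = f' \<cdot>\<^bsub>pow_cat S set_cat\<^esub> free_unit S \<Sigma> E oe Y"
      using eq f(3) f'(3) by (simp add: classical_forget_def struct_forget_def)
    then show ?thesis
      using that sorted_app_Cmp[OF free_unit_hom f(1)] sorted_app_Cmp[OF free_unit_hom f'(1)]
      by (simp add: app_free_unit)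
  qed
  then have "app (f s) (?q s d) = app (f' s) (?q s d)" if "s \<in> S" "d \<in> term_carrier S \<Sigma> oe (\<lambda>y. y) Y s" for s d
    using sorted_hom_term_alg_unique[OF sorted_hom_comp[OF sorted_hom_free_class f(2)]
        sorted_hom_comp[OF sorted_hom_free_class f'(2)] _ that] by simp
  then have "f = f'"
    by (intro sorted_arrow_eqI[OF f(1) f'(1)]) (auto simp: in_free_alg_iff)
  then show ?thesis
    using f(3) f'(3) by simp
qed

lemma sharp:
  assumes A: "A \<in> Obj (classical_theory_cat S \<Sigma> E)" and f: "f \<in> hom (pow_cat S set_cat) Y (fst A)"
  shows "sharp S \<Sigma> E oe Y A f \<in> hom (classical_theory_cat S \<Sigma> E) (free_alg S \<Sigma> E oe Y) A"
    and "FA classical_forget (sharp S \<Sigma> E oe Y A f) \<cdot>\<^bsub>pow_cat S set_cat\<^esub> free_unit S \<Sigma> E oe Y = f"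
proof -
  have "\<exists>!h. h \<in> hom (classical_theory_cat S \<Sigma> E) (free_alg S \<Sigma> E oe Y) A \<and>
        FA classical_forget h \<cdot>\<^bsub>pow_cat S set_cat\<^esub> free_unit S \<Sigma> E oe Y = f"
    using sharp_exists[OF A f] sharp_unique by blast
  from theI'[OF this]
  show "sharp S \<Sigma> E oe Y A f \<in> hom (classical_theory_cat S \<Sigma> E) (free_alg S \<Sigma> E oe Y) A"
    and "FA classical_forget (sharp S \<Sigma> E oe Y A f) \<cdot>\<^bsub>pow_cat S set_cat\<^esub> free_unit S \<Sigma> E oe Y = f"
    by (auto simp: sharp_def)
qed

end

lemma FO_classical_forget [simp]: "FO classical_forget = fst"
  by (simp add: classical_forget_def struct_forget_def)

text \<open>The parameters are the concrete constants of the classical adjunction, so the abstract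
  left adjoint obtained here is \<open>free_func\<close> itself.\<close>

sublocale free: universal_arrows "classical_theory_cat S \<Sigma> E" "pow_cat S set_cat" classical_forget
  "free_alg S \<Sigma> E oe" "free_unit S \<Sigma> E oe" "sharp S \<Sigma> E oe"
proof (rule universal_arrows.intro[OF is_functor_classical_forget], unfold_locales)
  fix Y A h assume Y: "Y \<in> Obj (pow_cat S set_cat)" and A: "A \<in> Obj (classical_theory_cat S \<Sigma> E)"
    and h: "h \<in> hom (classical_theory_cat S \<Sigma> E) (free_alg S \<Sigma> E oe Y) A"
  have "FA classical_forget h \<cdot>\<^bsub>pow_cat S set_cat\<^esub> free_unit S \<Sigma> E oe Y \<in> hom (pow_cat S set_cat) Y (fst A)"
    using is_functor.FA_hom[OF is_functor_classical_forget h] free_unit_hom[OF Y]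
      category.Cmp_hom[OF category_pow_set_cat] by fastforce
  then show "sharp S \<Sigma> E oe Y A (FA classical_forget h \<cdot>\<^bsub>pow_cat S set_cat\<^esub> free_unit S \<Sigma> E oe Y) = h"
    using sharp[OF Y A] sharp_unique[OF Y _ h] by blast
qed (simp_all add: free_alg_Obj free_unit_hom sharp)

lemma free_func_eq: "free_func S \<Sigma> E oe = free.left_adj"
  by (simp add: free_func_def free.left_adj_def)

lemma free_counit_eq: "free_counit S \<Sigma> E oe = free.counit"
  by (simp add: free_counit_def free.counit_def fun_eq_iff)

end

section \<open>Finite products and tensor products\<close>

lemma tuplesE:
  assumes "z \<in> tuples As"
  obtains xs where "z = tup xs" "length xs = length As" "\<And>i. i < length As \<Longrightarrow> xs ! i \<in> As ! i"
  using assms by (auto simp: in_tuples_iff list_all2_conv_all_nth)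

lemma set_proj_hom:
  assumes "\<forall>A \<in> set As. small A" "i < length As"
  shows "set_proj As i \<in> hom set_cat (tuples As) (As ! i)"
  unfolding set_proj_def using assms
  by (intro hom_set_catI small_tuples) (auto elim: tuplesE)

lemma app_set_proj: "tup xs \<in> tuples As \<Longrightarrow> app (set_proj As i) (tup xs) = xs ! i"
  by (simp add: set_proj_def)

locale enriching = topological V set_cat U
  for V :: "('v, 'm) cat" and U :: "('v, 'm, 'u::set_universe set, 'u set_arrow) func" +
  fixes M :: "('v, 'm) monoidal"
  assumes strict: "strict_symmetric_monoidal_functor V M set_cat set_cartesian U"
begin

abbreviation adm :: "'v \<Rightarrow> 'v \<Rightarrow> 'u set_arrow \<Rightarrow> bool" where
  "adm \<equiv> admissible V set_cat U"

lemma small_U: "a \<in> Obj V \<Longrightarrow> small (FO U a)"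
  using FO_Obj by auto

lemma U_app_in: "f \<in> hom V a b \<Longrightarrow> x \<in> FO U a \<Longrightarrow> app (FA U f) x \<in> FO U b"
  using FA_hom app_in by blast

lemma U_app_Cmp:
  "f \<in> hom V a b \<Longrightarrow> g \<in> hom V b c \<Longrightarrow> x \<in> FO U a \<Longrightarrow> app (FA U (g \<cdot>\<^bsub>V\<^esub> f)) x = app (FA U g) (app (FA U f) x)"
  using FA_Cmp[of f a b g c] app_Cmp_set_cat[OF FA_hom FA_hom, of f a b g c x] by simp

lemma U_app_Id: "a \<in> Obj V \<Longrightarrow> x \<in> FO U a \<Longrightarrow> app (FA U (Id V a)) x = x"
  using FA_Id by simp

text \<open>Faithfulness: a morphism of \<open>V\<close> is determined by the values of its
  underlying function on elements.\<close>

lemma hom_eqI: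
  assumes "f \<in> hom V a b" "g \<in> hom V a b" "\<And>x. x \<in> FO U a \<Longrightarrow> app (FA U f) x = app (FA U g) x"
  shows "f = g"
  using set_arr_eqI[OF FA_hom[OF assms(1)] FA_hom[OF assms(2)] assms(3)] faithfulD[OF assms(1,2)] by blast

lemma lift_arr:
  assumes "adm a b f"
  shows "lift_arr V U a b f \<in> hom V a b" "FA U (lift_arr V U a b f) = f"
proof -
  have "\<exists>!m. m \<in> hom V a b \<and> FA U m = f"
    using assms faithfulD by (auto simp: admissible_iff)
  from theI'[OF this] show "lift_arr V U a b f \<in> hom V a b" "FA U (lift_arr V U a b f) = f"
    by (auto simp: lift_arr_def)
qed

lemma admI: "f \<in> hom V a b \<Longrightarrow> adm a b (FA U f)"
  by (auto simp: admissible_iff)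

text \<open>The initial lift of the set projections is a product, since a function into it is
  admissible exactly when its coordinates are. Any other product with the same underlying
  projections is comparable to it in both directions, so \<open>fprod\<close> denotes this
  lift.\<close>

lemma fprod_initial:
  assumes as: "set as \<subseteq> Obj V"
  shows "initial_lift_domain V set_cat U (tuples (map (FO U) as))
    {(as ! i, set_proj (map (FO U) as) i) | i. i < length as} (fprod V U as)"
proof -
  let ?T = "tuples (map (FO U) as)" and ?pr = "set_proj (map (FO U) as)"
  let ?K = "{(as ! i, ?pr i) | i. i < length as}"
  have as_nth: "as ! i \<in> Obj V" if "i < length as" for i
    using as that by auto
  have small: "\<forall>A \<in> set (map (FO U) as). small A"
    using as small_U by auto
  have pr: "?pr i \<in> hom set_cat ?T (FO U (as ! i))" if "i < length as" for i
    using set_proj_hom[OF small, of i] that by simp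
  have "structured_source V set_cat U ?T ?K"
    using pr as_nth small_tuples[OF small] by (auto simp: structured_source_def)
  then obtain p where p: "initial_lift_domain V set_cat U ?T ?K p"
    using initial_lift by blast
  then have p_Obj: "p \<in> Obj V" and Up: "FO U p = ?T" and pr_adm: "\<And>i. i < length as \<Longrightarrow> adm p (as ! i) (?pr i)"
    using initial_lift_domainD(1-3)[OF p] by blast+
  have adm_p: "adm w p g" if "w \<in> Obj V" "g \<in> hom set_cat (FO U w) ?T"
    "\<And>i. i < length as \<Longrightarrow> adm w (as ! i) (?pr i \<cdot>\<^bsub>set_cat\<^esub> g)" for w g
    using initial_lift_domainD(4)[OF p that(1,2)] that(3) by blast
  define \<pi>s where "\<pi>s = map (\<lambda>i. lift_arr V U p (as ! i) (?pr i)) [0..<length as]"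
  have len: "length \<pi>s = length as"
    by (simp add: \<pi>s_def)
  have \<pi>s: "\<pi>s ! i \<in> hom V p (as ! i)" "FA U (\<pi>s ! i) = ?pr i" if "i < length as" for i
    using that lift_arr[OF pr_adm[OF that]] by (auto simp: \<pi>s_def)
  have eq_tup: "g = h" if g: "g \<in> hom set_cat X ?T" and h: "h \<in> hom set_cat X ?T"
    and eq: "\<And>i. i < length as \<Longrightarrow> ?pr i \<cdot>\<^bsub>set_cat\<^esub> g = ?pr i \<cdot>\<^bsub>set_cat\<^esub> h" for X g h
  proof (rule set_arr_eqI[OF g h])
    fix x assume x: "x \<in> X"
    obtain xs where xs: "app g x = tup xs" "length xs = length as"
      using app_in[OF g x] by (auto elim: tuplesE)
    obtain ys where ys: "app h x = tup ys" "length ys = length as"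
      using app_in[OF h x] by (auto elim: tuplesE)
    have "xs ! i = ys ! i" if i: "i < length as" for i
      using app_Cmp_set_cat[OF g pr[OF i] x] app_Cmp_set_cat[OF h pr[OF i] x] eq[OF i]
        app_in[OF g x] app_in[OF h x] xs ys app_set_proj by metis
    then show "app g x = app h x"
      using xs ys by (simp add: list_eq_iff_nth_eq)
  qed
  have product: "is_product V as p \<pi>s"
    unfolding is_product_def
  proof (intro conjI ballI allI impI p_Obj)
    show "list_all2 (\<lambda>\<pi> a. \<pi> \<in> hom V p a) \<pi>s as"
      using \<pi>s len by (simp add: list_all2_conv_all_nth)
  next
    fix w gs assume w: "w \<in> Obj V" and gs: "list_all2 (\<lambda>g a. g \<in> hom V w a) gs as"
    then have gs_len: "length gs = length as" and gs_nth: "\<And>i. i < length as \<Longrightarrow> gs ! i \<in> hom V w (as ! i)"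
      by (auto simp: list_all2_conv_all_nth)
    \<comment> \<open>The mediating function is the tupling of the given components.\<close>
    define k where "k = set_arr (FO U w) (\<lambda>x. tup (map (\<lambda>g. app (FA U g) x) gs)) ?T"
    have k_tup: "tup (map (\<lambda>g. app (FA U g) x) gs) \<in> ?T" if "x \<in> FO U w" for x
      using that gs_len U_app_in[OF gs_nth] by (auto simp: list_all2_conv_all_nth)
    have k: "k \<in> hom set_cat (FO U w) ?T"
      unfolding k_def using small_U[OF w] small_tuples[OF small] k_tup by (intro hom_set_catI)
    have pr_k: "?pr i \<cdot>\<^bsub>set_cat\<^esub> k = FA U (gs ! i)" if i: "i < length as" for i
    proof (rule set_arr_eqI[OF category.Cmp_hom[OF category_set_cat k pr[OF i]] FA_hom[OF gs_nth[OF i]]])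
      fix x assume x: "x \<in> FO U w"
      show "app (?pr i \<cdot>\<^bsub>set_cat\<^esub> k) x = app (FA U (gs ! i)) x"
        using app_Cmp_set_cat[OF k pr[OF i] x] x app_set_proj[OF k_tup[OF x]] i gs_len by (simp add: k_def)
    qed
    have "adm w p k"
      using adm_p[OF w k] pr_k admI[OF gs_nth] by simp
    then obtain h where h: "h \<in> hom V w p" "FA U h = k"
      by (auto simp: admissible_iff)
    have "gs ! i = \<pi>s ! i \<cdot>\<^bsub>V\<^esub> h" if i: "i < length as" for i
      using faithfulD[OF gs_nth[OF i] dom.Cmp_hom[OF h(1) \<pi>s(1)[OF i]]] FA_Cmp[OF h(1) \<pi>s(1)[OF i]]
        pr_k[OF i] h(2) \<pi>s(2)[OF i] by simp
    then have "gs = map (\<lambda>\<pi>. \<pi> \<cdot>\<^bsub>V\<^esub> h) \<pi>s"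
      using gs_len len by (intro nth_equalityI) auto
    moreover have "h' = h" if h': "h' \<in> hom V w p" "gs = map (\<lambda>\<pi>. \<pi> \<cdot>\<^bsub>V\<^esub> h') \<pi>s" for h'
    proof -
      have "?pr i \<cdot>\<^bsub>set_cat\<^esub> FA U h' = ?pr i \<cdot>\<^bsub>set_cat\<^esub> k" if i: "i < length as" for i
      proof -
        have "gs ! i = \<pi>s ! i \<cdot>\<^bsub>V\<^esub> h'"
          using arg_cong[OF h'(2), of "\<lambda>xs. xs ! i"] i len by simp
        then show ?thesis
          using FA_Cmp[OF h'(1) \<pi>s(1)[OF i]] pr_k[OF i] \<pi>s(2)[OF i] by simp
      qed
      then have "FA U h' = k"
        using eq_tup[OF _ k] FA_hom[OF h'(1)] Up by simp
      then show ?thesis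
        using faithfulD[OF h'(1) h(1)] h(2) by simp
    qed
    ultimately show "\<exists>!h. h \<in> hom V w p \<and> gs = map (\<lambda>\<pi>. \<pi> \<cdot>\<^bsub>V\<^esub> h) \<pi>s"
      using h(1) by blast
  qed
  have "fprod V U as = p"
    unfolding fprod_def
  proof (rule the_equality)
    show "FO U p = ?T \<and> (\<exists>\<pi>s. is_product V as p \<pi>s \<and> (\<forall>i < length as. FA U (\<pi>s ! i) = ?pr i))"
      using Up product \<pi>s by blast
  next
    fix q assume "FO U q = ?T \<and> (\<exists>\<pi>s. is_product V as q \<pi>s \<and> (\<forall>i < length as. FA U (\<pi>s ! i) = ?pr i))"
    then obtain \<rho>s where Uq: "FO U q = ?T" and q: "is_product V as q \<rho>s"
      and U\<rho>: "\<And>i. i < length as \<Longrightarrow> FA U (\<rho>s ! i) = ?pr i"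
      by blast
    from q have q_Obj: "q \<in> Obj V" and len': "length \<rho>s = length as"
      and \<rho>s: "\<And>i. i < length as \<Longrightarrow> \<rho>s ! i \<in> hom V q (as ! i)"
      by (auto simp: is_product_def list_all2_conv_all_nth)
    have Id: "Id set_cat ?T \<in> hom set_cat ?T ?T"
      using category.Id_hom[OF category_set_cat] small_tuples[OF small] by simp
    have "adm q p (Id set_cat ?T)"
      using adm_p[OF q_Obj] Id Uq category.Id_right[OF category_set_cat pr] admI[OF \<rho>s] U\<rho> by simp
    then have qp: "fib_le V set_cat U q p"
      using Uq Up by (simp add: fib_le_def)
    \<comment> \<open>The product property of \<open>q\<close> gives a mediating morphism whose
      coordinates are the projections, so it lies over the identity. Together with
      \<open>qp\<close>, amnesticity forces equality.\<close>
    obtain h where h: "h \<in> hom V p q" "\<pi>s = map (\<lambda>\<pi>. \<pi> \<cdot>\<^bsub>V\<^esub> h) \<rho>s"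
      using q p_Obj \<pi>s len unfolding is_product_def list_all2_conv_all_nth by metis
    have "?pr i \<cdot>\<^bsub>set_cat\<^esub> FA U h = ?pr i \<cdot>\<^bsub>set_cat\<^esub> Id set_cat ?T" if i: "i < length as" for i
    proof -
      have "\<pi>s ! i = \<rho>s ! i \<cdot>\<^bsub>V\<^esub> h"
        using arg_cong[OF h(2), of "\<lambda>xs. xs ! i"] i len' by simp
      then show ?thesis
        using FA_Cmp[OF h(1) \<rho>s[OF i]] \<pi>s(2)[OF i] U\<rho>[OF i] category.Id_right[OF category_set_cat pr[OF i]]
        by simp
    qed
    then have "FA U h = Id set_cat ?T"
      using eq_tup[OF _ Id] FA_hom[OF h(1)] Up Uq by simp
    then have pq: "fib_le V set_cat U p q"
      using Uq Up admI[OF h(1)] by (simp add: fib_le_def)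
    show "q = p"
      using amnestic[OF q_Obj p_Obj qp pq] .
  qed
  then show ?thesis
    using p by simp
qed

lemma fprod:
  assumes "set as \<subseteq> Obj V"
  shows "fprod V U as \<in> Obj V" "FO U (fprod V U as) = tuples (map (FO U) as)"
    and "\<And>i. i < length as \<Longrightarrow> fproj V U as i \<in> hom V (fprod V U as) (as ! i)"
    and "\<And>i. i < length as \<Longrightarrow> FA U (fproj V U as i) = set_proj (map (FO U) as) i"
    and "\<And>w g. w \<in> Obj V \<Longrightarrow> g \<in> hom set_cat (FO U w) (tuples (map (FO U) as)) \<Longrightarrow>
      (\<And>i. i < length as \<Longrightarrow> adm w (as ! i) (set_proj (map (FO U) as) i \<cdot>\<^bsub>set_cat\<^esub> g)) \<Longrightarrow> adm w (fprod V U as) g"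
proof -
  note p = initial_lift_domainD[OF fprod_initial[OF assms]]
  show "fprod V U as \<in> Obj V" "FO U (fprod V U as) = tuples (map (FO U) as)"
    by (rule p)+
  show "fproj V U as i \<in> hom V (fprod V U as) (as ! i)"
    "FA U (fproj V U as i) = set_proj (map (FO U) as) i" if "i < length as" for i
    unfolding fproj_def using lift_arr p(3) that by blast+
  show "adm w (fprod V U as) g" if "w \<in> Obj V" "g \<in> hom set_cat (FO U w) (tuples (map (FO U) as))"
    "\<And>i. i < length as \<Longrightarrow> adm w (as ! i) (set_proj (map (FO U) as) i \<cdot>\<^bsub>set_cat\<^esub> g)" for w g
    using p(4)[OF that(1,2)] that(3) by blast
qed

text \<open>The coordinatewise function is admissible because each of its coordinates underlies
  \<open>fs ! i\<close> after a projection. A competing morphism has the same coordinates, which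
  pins down the definite description.\<close>

lemma fprod_arr:
  assumes as: "set as \<subseteq> Obj V" and bs: "set bs \<subseteq> Obj V"
    and len: "length fs = length as" "length bs = length as"
    and fs: "\<And>i. i < length as \<Longrightarrow> fs ! i \<in> hom V (as ! i) (bs ! i)"
  shows "fprod_arr V U fs \<in> hom V (fprod V U as) (fprod V U bs)"
    and "\<And>xs. tup xs \<in> tuples (map (FO U) as) \<Longrightarrow>
      app (FA U (fprod_arr V U fs)) (tup xs) = tup (map2 (\<lambda>f x. app (FA U f) x) fs xs)"
proof -
  let ?A = "tuples (map (FO U) as)" and ?B = "tuples (map (FO U) bs)"
  have Dom: "map (Dom V) fs = as" and Cod: "map (Cod V) fs = bs"
    using len homD(2,3)[OF fs] by (auto intro!: nth_equalityI)
  define k where "k = set_arr ?A (\<lambda>z. tup (map2 (\<lambda>f x. app (FA U f) x) fs (untup z))) ?B"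
  have k_tup: "tup (map2 (\<lambda>f x. app (FA U f) x) fs xs) \<in> ?B" if "tup xs \<in> ?A" for xs
    using that len U_app_in[OF fs] by (auto simp: list_all2_conv_all_nth)
  have app_k: "app k (tup xs) = tup (map2 (\<lambda>f x. app (FA U f) x) fs xs)" if "tup xs \<in> ?A" for xs
    using that by (simp add: k_def del: tup_in_tuples_iff)
  have k: "k \<in> hom set_cat ?A ?B"
    unfolding k_def
  proof (rule hom_set_catI)
    show "small ?A" "small ?B"
      using as bs by (auto intro!: small_tuples small_U)
    fix z assume "z \<in> ?A"
    then show "tup (map2 (\<lambda>f x. app (FA U f) x) fs (untup z)) \<in> ?B"
      using k_tup by (metis in_tuples_iff untup_tup)
  qed
  have pr: "fproj V U as i \<in> hom V (fprod V U as) (as ! i)" "FA U (fproj V U as i) = set_proj (map (FO U) as) i"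
    "fproj V U bs i \<in> hom V (fprod V U bs) (bs ! i)" "FA U (fproj V U bs i) = set_proj (map (FO U) bs) i"
    if "i < length as" for i
    using fprod(3,4)[OF as, of i] fprod(3,4)[OF bs, of i] that len by auto
  have proj_hom: "set_proj (map (FO U) bs) i \<in> hom set_cat ?B (FO U (bs ! i))" if "i < length as" for i
    using FA_hom[OF pr(3)[OF that]] pr(4)[OF that] fprod(2)[OF bs] by simp
  have f_pr: "fs ! i \<cdot>\<^bsub>V\<^esub> fproj V U as i \<in> hom V (fprod V U as) (bs ! i)" if "i < length as" for i
    using dom.Cmp_hom[OF pr(1)[OF that] fs[OF that]] .
  have pr_k: "set_proj (map (FO U) bs) i \<cdot>\<^bsub>set_cat\<^esub> k = FA U (fs ! i \<cdot>\<^bsub>V\<^esub> fproj V U as i)" if i: "i < length as" for i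
  proof (rule set_arr_eqI)
    show "set_proj (map (FO U) bs) i \<cdot>\<^bsub>set_cat\<^esub> k \<in> hom set_cat ?A (FO U (bs ! i))"
      using category.Cmp_hom[OF category_set_cat k proj_hom[OF i]] .
    show "FA U (fs ! i \<cdot>\<^bsub>V\<^esub> fproj V U as i) \<in> hom set_cat ?A (FO U (bs ! i))"
      using FA_hom[OF f_pr[OF i]] fprod(2)[OF as] by simp
    fix z assume z: "z \<in> ?A"
    then obtain xs where xs: "z = tup xs" "length xs = length as"
      by (auto elim: tuplesE)
    have "app (set_proj (map (FO U) bs) i \<cdot>\<^bsub>set_cat\<^esub> k) z = app (FA U (fs ! i)) (xs ! i)"
      using app_Cmp_set_cat[OF k proj_hom[OF i] z] z xs app_k k_tup i len by (simp add: app_set_proj)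
    moreover have "app (FA U (fs ! i \<cdot>\<^bsub>V\<^esub> fproj V U as i)) z = app (FA U (fs ! i)) (xs ! i)"
      using U_app_Cmp[OF pr(1)[OF i] fs[OF i], of z] z pr(2)[OF i] fprod(2)[OF as] xs(1)
      by (simp add: app_set_proj)
    ultimately show "app (set_proj (map (FO U) bs) i \<cdot>\<^bsub>set_cat\<^esub> k) z = app (FA U (fs ! i \<cdot>\<^bsub>V\<^esub> fproj V U as i)) z"
      by simp
  qed
  have "adm (fprod V U as) (fprod V U bs) k"
    using fprod(5)[OF bs fprod(1)[OF as]] k pr_k admI[OF f_pr] len by (simp add: fprod(2)[OF as])
  then obtain h where h: "h \<in> hom V (fprod V U as) (fprod V U bs)" "FA U h = k"
    by (auto simp: admissible_iff)
  have "fprod_arr V U fs = h"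
    unfolding fprod_arr_def Let_def Dom Cod
  proof (rule the_equality)
    have "fproj V U bs i \<cdot>\<^bsub>V\<^esub> h = fs ! i \<cdot>\<^bsub>V\<^esub> fproj V U as i" if i: "i < length as" for i
      using faithfulD[OF dom.Cmp_hom[OF h(1) pr(3)[OF i]] f_pr[OF i]] FA_Cmp[OF h(1) pr(3)[OF i]] h(2)
        pr(4)[OF i] pr_k[OF i] by simp
    then show "h \<in> hom V (fprod V U as) (fprod V U bs) \<and>
        (\<forall>i < length fs. fproj V U bs i \<cdot>\<^bsub>V\<^esub> h = fs ! i \<cdot>\<^bsub>V\<^esub> fproj V U as i)"
      using h(1) len by simp
  next
    fix h' assume "h' \<in> hom V (fprod V U as) (fprod V U bs) \<and>
        (\<forall>i < length fs. fproj V U bs i \<cdot>\<^bsub>V\<^esub> h' = fs ! i \<cdot>\<^bsub>V\<^esub> fproj V U as i)"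
    then have h': "h' \<in> hom V (fprod V U as) (fprod V U bs)"
      and eq: "\<And>i. i < length as \<Longrightarrow> fproj V U bs i \<cdot>\<^bsub>V\<^esub> h' = fs ! i \<cdot>\<^bsub>V\<^esub> fproj V U as i"
      using len by auto
    show "h' = h"
    proof (rule hom_eqI[OF h' h(1)])
      fix z assume z: "z \<in> FO U (fprod V U as)"
      have "app (FA U h') z \<in> ?B" "app (FA U h) z \<in> ?B"
        using U_app_in[OF h' z] U_app_in[OF h(1) z] fprod(2)[OF bs] by auto
      then obtain xs ys where xs: "app (FA U h') z = tup xs" "length xs = length bs" "tup xs \<in> ?B"
        and ys: "app (FA U h) z = tup ys" "length ys = length bs" "tup ys \<in> ?B"
        by (metis tuplesE length_map)
      have "xs ! i = ys ! i" if i: "i < length bs" for i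
      proof -
        have i': "i < length as"
          using i len by simp
        have "FA U (fproj V U bs i \<cdot>\<^bsub>V\<^esub> h') = FA U (fproj V U bs i \<cdot>\<^bsub>V\<^esub> h)"
          using eq[OF i'] pr_k[OF i'] FA_Cmp[OF h(1) pr(3)[OF i']] h(2) pr(4)[OF i'] by simp
        then show ?thesis
          using U_app_Cmp[OF h' pr(3)[OF i'] z] U_app_Cmp[OF h(1) pr(3)[OF i'] z] xs ys pr(4)[OF i'] app_set_proj
          by metis
      qed
      then show "app (FA U h') z = app (FA U h) z"
        using xs ys by (simp add: list_eq_iff_nth_eq)
    qed
  qed
  then show "fprod_arr V U fs \<in> hom V (fprod V U as) (fprod V U bs)"
    and "\<And>xs. tup xs \<in> ?A \<Longrightarrow>
      app (FA U (fprod_arr V U fs)) (tup xs) = tup (map2 (\<lambda>f x. app (FA U f) x) fs xs)"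
    using h app_k by auto
qed

text \<open>Strictness of \<open>U\<close> makes the underlying set literally the set of pairs of a
  parameter and a tuple; everything elementwise below depends on that.\<close>

lemma arg_obj:
  assumes P: "P \<in> Obj V" and A: "\<And>s. s \<in> set ss \<Longrightarrow> A s \<in> Obj V"
  shows "arg_obj V U M P ss A \<in> Obj V"
    and "FO U (arg_obj V U M P ss A) = cart (FO U P) (tuples (map (\<lambda>s. FO U (A s)) ss))"
proof -
  interpret strict: strict_symmetric_monoidal_functor V M set_cat set_cartesian U
    by (rule strict)
  have as: "set (map A ss) \<subseteq> Obj V"
    using A by auto
  show "arg_obj V U M P ss A \<in> Obj V"
    unfolding arg_obj_def using P fprod(1)[OF as] by (rule strict.dom.tens_Obj)
  show "FO U (arg_obj V U M P ss A) = cart (FO U P) (tuples (map (\<lambda>s. FO U (A s)) ss))"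
    unfolding arg_obj_def using P fprod(1,2)[OF as] strict.strict_tensO
    by (simp add: set_cartesian_def comp_def)
qed

lemma in_arg_obj_iff:
  assumes "P \<in> Obj V" "\<And>s. s \<in> set ss \<Longrightarrow> A s \<in> Obj V"
  shows "z \<in> FO U (arg_obj V U M P ss A) \<longleftrightarrow>
    (\<exists>p \<in> FO U P. \<exists>ds \<in> args (\<lambda>s. FO U (A s)) ss. z = pair p (tup ds))"
  by (subst arg_obj(2)[OF assms]) (auto simp: in_tuples_iff args_def in_listset_iff)

lemma arg_arr:
  assumes P: "P \<in> Obj V" and f: "\<And>s. s \<in> set ss \<Longrightarrow> f s \<in> hom V (A s) (B s)"
  shows "arg_arr V U M P ss f \<in> hom V (arg_obj V U M P ss A) (arg_obj V U M P ss B)"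
    and "\<And>p ds. p \<in> FO U P \<Longrightarrow> ds \<in> args (\<lambda>s. FO U (A s)) ss \<Longrightarrow>
      app (FA U (arg_arr V U M P ss f)) (pair p (tup ds)) = pair p (tup (map2 (\<lambda>s d. app (FA U (f s)) d) ss ds))"
proof -
  interpret strict: strict_symmetric_monoidal_functor V M set_cat set_cartesian U
    by (rule strict)
  have as: "set (map A ss) \<subseteq> Obj V" and bs: "set (map B ss) \<subseteq> Obj V"
    using dom.hom_Obj[OF f] by auto
  have AB: "\<And>s. s \<in> set ss \<Longrightarrow> A s \<in> Obj V" "\<And>s. s \<in> set ss \<Longrightarrow> B s \<in> Obj V"
    using as bs by auto
  have fs: "map f ss ! i \<in> hom V (map A ss ! i) (map B ss ! i)" if "i < length (map A ss)" for i
    using that f by simp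
  note g = fprod_arr[OF as bs _ _ fs]
  have g_hom: "fprod_arr V U (map f ss) \<in> hom V (fprod V U (map A ss)) (fprod V U (map B ss))"
    by (rule g(1)) simp_all
  have Id: "Id V P \<in> hom V P P"
    using P by (rule dom.Id_hom)
  show hom: "arg_arr V U M P ss f \<in> hom V (arg_obj V U M P ss A) (arg_obj V U M P ss B)"
    unfolding arg_arr_def arg_obj_def using Id g_hom by (rule strict.dom.tens_hom)
  fix p ds assume p: "p \<in> FO U P" and ds: "ds \<in> args (\<lambda>s. FO U (A s)) ss"
  then have tup: "tup ds \<in> tuples (map (FO U) (map A ss))"
    by (simp add: args_def in_listset_iff comp_def)
  \<comment> \<open>The tensor of arrows in \<open>set_cartesian\<close> is defined by matching on
    triples, so both factors are first written as explicit triples.\<close>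
  obtain k where k: "FA U (fprod_arr V U (map f ss)) =
      (FO U (fprod V U (map A ss)), k, FO U (fprod V U (map B ss)))"
    using FA_hom[OF g_hom] by (auto elim!: hom_set_catE)
  obtain i where i: "FA U (Id V P) = (FO U P, i, FO U P)"
    using FA_hom[OF Id] by (auto elim!: hom_set_catE)
  have "FA U (arg_arr V U M P ss f) = set_arr (cart (FO U P) (tuples (map (FO U) (map A ss))))
      (\<lambda>z. pair (i (pfst z)) (k (psnd z))) (cart (FO U P) (tuples (map (FO U) (map B ss))))"
    unfolding arg_arr_def using strict.strict_tensA[OF homD(1)[OF Id] homD(1)[OF g_hom]] k i
      fprod(2)[OF as] fprod(2)[OF bs] by (simp add: set_cartesian_def)
  moreover have "pair p (tup ds) \<in> cart (FO U P) (tuples (map (FO U) (map A ss)))"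
    using p tup by auto
  ultimately have "app (FA U (arg_arr V U M P ss f)) (pair p (tup ds)) = pair (i p) (k (tup ds))"
    by simp
  moreover have "i p = p"
    using U_app_Id[OF P p] i by (simp add: app_def)
  moreover have "k (tup ds) = tup (map2 (\<lambda>s d. app (FA U (f s)) d) ss ds)"
    using g(2)[OF _ _ _ tup] k by (simp add: app_def map2_map_map[symmetric] zip_map1 case_prod_unfold comp_def)
  ultimately show "app (FA U (arg_arr V U M P ss f)) (pair p (tup ds)) = pair p (tup (map2 (\<lambda>s d. app (FA U (f s)) d) ss ds))"
    by simp
qed

end

section \<open>Enriched algebras and their underlying classical algebras\<close>

lemma und_sig_simps [simp]:
  "(\<sigma>, p) \<in> cops (und_sig U \<Sigma>) \<longleftrightarrow> \<sigma> \<in> ops \<Sigma> \<and> p \<in> FO U (par \<Sigma> \<sigma>)"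
  "cins (und_sig U \<Sigma>) (\<sigma>, p) = ins \<Sigma> \<sigma>"
  "cout (und_sig U \<Sigma>) (\<sigma>, p) = out \<Sigma> \<sigma>"
  by (auto simp: und_sig_def)

lemma ball_cops_und_sig:
  "(\<forall>\<tau> \<in> cops (und_sig U \<Sigma>). Q \<tau>) \<longleftrightarrow> (\<forall>\<sigma> \<in> ops \<Sigma>. \<forall>p \<in> FO U (par \<Sigma> \<sigma>). Q (\<sigma>, p))"
  by (auto simp: und_sig_def)

lemma small_ctx_vars: "small (enc_var ` ctx_vars vs s)"
  by (rule small_finite) (simp add: ctx_vars_def)

lemma map_snd_var_ctx: "map snd (var_ctx ss) = ss"
  by (simp add: var_ctx_def)

lemma distinct_var_ctx: "distinct (var_ctx ss)"
  by (simp add: var_ctx_def distinct_enumerate)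

lemma FO_pow_func: "s \<in> S \<Longrightarrow> FO (pow_func S U) a s = FO U (a s)"
  by (simp add: pow_func_def)

lemma FA_pow_func: "s \<in> S \<Longrightarrow> FA (pow_func S U) f s = FA U (f s)"
  by (simp add: pow_func_def)

locale enriched_signature = enriching V U M
  for V :: "('v, 'm) cat" and U :: "('v, 'm, 'u::set_universe set, 'u set_arrow) func"
    and M :: "('v, 'm) monoidal" +
  fixes S :: "'u set" and \<Sigma> :: "('u, 'v) esig"
  assumes small_sorts: "small S" and sig: "signature V S \<Sigma>"
begin

lemma sigD:
  assumes "\<sigma> \<in> ops \<Sigma>"
  shows "set (ins \<Sigma> \<sigma>) \<subseteq> S" "out \<Sigma> \<sigma> \<in> S" "par \<Sigma> \<sigma> \<in> Obj V"
  using sig assms by (auto simp: signature_def)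

text \<open>The operation symbols of the underlying signature form a small union of copies of the
  parameter sets, which are small as underlying sets of objects of \<open>V\<close>.\<close>

sublocale und: term_signature S "und_sig U \<Sigma>" enc_op_symbol
proof
  have "enc_op_symbol ` cops (und_sig U \<Sigma>) = (\<Union>\<sigma>\<in>ops \<Sigma>. pair \<sigma> ` FO U (par \<Sigma> \<sigma>))"
    by (auto simp: und_sig_def enc_op_symbol_def image_iff)
  moreover have "small (\<Union>\<sigma>\<in>ops \<Sigma>. pair \<sigma> ` FO U (par \<Sigma> \<sigma>))"
    using sig small_U by (intro small_UN small_image) (auto simp: signature_def)
  ultimately show "small (enc_op_symbol ` cops (und_sig U \<Sigma>))"
    by simp
next
  fix \<tau> assume "\<tau> \<in> cops (und_sig U \<Sigma>)"
  then show "set (cins (und_sig U \<Sigma>) \<tau>) \<subseteq> S" "cout (und_sig U \<Sigma>) \<tau> \<in> S"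
    using sigD[of "fst \<tau>"] by (cases \<tau>; simp)+
qed (rule small_sorts inj_enc_op_symbol)+

lemma pow_topological: "topological (pow_cat S V) (pow_cat S set_cat) (pow_func S U)"
  by (rule topological_pow_func) unfold_locales

sublocale pow: topological "pow_cat S V" "pow_cat S set_cat" "pow_func S U"
  by (rule pow_topological)

lemma args_FO_pow_func: "set ss \<subseteq> S \<Longrightarrow> args (FO (pow_func S U) a) ss = args (\<lambda>s. FO U (a s)) ss"
  by (rule args_cong) (auto simp: FO_pow_func)

lemma pow_Obj: "a \<in> Obj (pow_cat S V) \<Longrightarrow> s \<in> S \<Longrightarrow> a s \<in> Obj V"
  by (auto simp: Obj_pow_cat)

lemma pow_hom: "f \<in> hom (pow_cat S V) a b \<Longrightarrow> s \<in> S \<Longrightarrow> f s \<in> hom V (a s) (b s)"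
  by (auto simp: hom_pow_cat_iff)

lemma carrier_Obj: "A \<in> algebras V U M S \<Sigma> \<Longrightarrow> fst A \<in> Obj (pow_cat S V)"
  by (simp add: algebras_def)

lemma op_hom:
  "A \<in> algebras V U M S \<Sigma> \<Longrightarrow> \<sigma> \<in> ops \<Sigma> \<Longrightarrow>
     snd A \<sigma> \<in> hom V (arg_obj V U M (par \<Sigma> \<sigma>) (ins \<Sigma> \<sigma>) (fst A)) (fst A (out \<Sigma> \<sigma>))"
  by (auto simp: algebras_def)

lemma ins_Obj:
  "a \<in> Obj (pow_cat S V) \<Longrightarrow> \<sigma> \<in> ops \<Sigma> \<Longrightarrow> s \<in> set (ins \<Sigma> \<sigma>) \<Longrightarrow> a s \<in> Obj V"
  using sigD(1) pow_Obj by blast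

lemma args_obj_iff:
  assumes "a \<in> Obj (pow_cat S V)" "\<sigma> \<in> ops \<Sigma>"
  shows "z \<in> FO U (arg_obj V U M (par \<Sigma> \<sigma>) (ins \<Sigma> \<sigma>) a) \<longleftrightarrow>
    (\<exists>p \<in> FO U (par \<Sigma> \<sigma>). \<exists>ds \<in> args (FO (pow_func S U) a) (ins \<Sigma> \<sigma>). z = pair p (tup ds))"
  using in_arg_obj_iff[OF sigD(3)[OF assms(2)] ins_Obj[OF assms]]
    args_FO_pow_func[OF sigD(1)[OF assms(2)]] by simp

lemma fst_und_alg [simp]: "fst (und_alg U S \<Sigma> A) = FO (pow_func S U) (fst A)"
  by (simp add: und_alg_def)

lemma und_alg_op:
  "\<sigma> \<in> ops \<Sigma> \<Longrightarrow> p \<in> FO U (par \<Sigma> \<sigma>) \<Longrightarrow> ds \<in> args (FO (pow_func S U) (fst A)) (ins \<Sigma> \<sigma>) \<Longrightarrow>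
     snd (und_alg U S \<Sigma> A) (\<sigma>, p) ds = app (FA U (snd A \<sigma>)) (pair p (tup ds))"
  by (simp add: und_alg_def)

lemma und_algebra:
  assumes A: "A \<in> algebras V U M S \<Sigma>"
  shows "und_alg U S \<Sigma> A \<in> classical_algebras S (und_sig U \<Sigma>)"
proof -
  have "snd (und_alg U S \<Sigma> A) (\<sigma>, p) ds \<in> FO (pow_func S U) (fst A) (out \<Sigma> \<sigma>)"
    if "\<sigma> \<in> ops \<Sigma>" "p \<in> FO U (par \<Sigma> \<sigma>)" "ds \<in> args (FO (pow_func S U) (fst A)) (ins \<Sigma> \<sigma>)" for \<sigma> p ds
    using that und_alg_op[OF that] U_app_in[OF op_hom[OF A that(1)], of "pair p (tup ds)"]
      args_obj_iff[OF carrier_Obj[OF A] that(1)] FO_pow_func[OF sigD(2)[OF that(1)]] by auto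
  then show ?thesis
    using pow.FO_Obj[OF carrier_Obj[OF A]]
    unfolding classical_algebras_def PiE_iff by (auto, auto simp: und_alg_def)
qed

text \<open>Every element of an argument object is some \<open>pair p (tup ds)\<close>, and the
  value of an operation there is recorded by the underlying algebra. This supplies amnesticity for
  algebras.\<close>

lemma alg_eqI:
  assumes A: "A \<in> algebras V U M S \<Sigma>" and B: "B \<in> algebras V U M S \<Sigma>"
    and eq: "fst A = fst B" "und_alg U S \<Sigma> A = und_alg U S \<Sigma> B"
  shows "A = B"
proof -
  have "snd A \<sigma> = snd B \<sigma>" if \<sigma>: "\<sigma> \<in> ops \<Sigma>" for \<sigma>
  proof (rule hom_eqI[OF op_hom[OF A \<sigma>]])
    show "snd B \<sigma> \<in> hom V (arg_obj V U M (par \<Sigma> \<sigma>) (ins \<Sigma> \<sigma>) (fst A)) (fst A (out \<Sigma> \<sigma>))"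
      using op_hom[OF B \<sigma>] eq(1) by simp
    fix z assume "z \<in> FO U (arg_obj V U M (par \<Sigma> \<sigma>) (ins \<Sigma> \<sigma>) (fst A))"
    then obtain p ds where "p \<in> FO U (par \<Sigma> \<sigma>)" "ds \<in> args (FO (pow_func S U) (fst A)) (ins \<Sigma> \<sigma>)" "z = pair p (tup ds)"
      using args_obj_iff[OF carrier_Obj[OF A] \<sigma>] by blast
    then show "app (FA U (snd A \<sigma>)) z = app (FA U (snd B \<sigma>)) z"
      using und_alg_op[OF \<sigma>, of p ds A] und_alg_op[OF \<sigma>, of p ds B] eq by simp
  qed
  moreover have "snd A \<in> extensional (ops \<Sigma>)" "snd B \<in> extensional (ops \<Sigma>)"
    using A B by (auto simp: algebras_def PiE_iff)
  ultimately have "snd A = snd B"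
    by (intro extensionalityI[of _ "ops \<Sigma>"]) auto
  then show ?thesis
    using eq(1) by (simp add: prod_eq_iff)
qed

text \<open>Evaluating the homomorphism square of \<open>\<sigma>\<close> at all
  \<open>pair p (tup ds)\<close> gives precisely the classical squares of the symbols
  \<open>(\<sigma>, p)\<close>. Questions about enriched homomorphisms thereby become classical
  ones.\<close>

lemma sorted_hom_und_iff:
  assumes A: "A \<in> algebras V U M S \<Sigma>" and B: "B \<in> algebras V U M S \<Sigma>"
    and f: "f \<in> hom (pow_cat S V) (fst A) (fst B)"
  shows "und.sorted_hom (und_alg U S \<Sigma> A) (und_alg U S \<Sigma> B) (\<lambda>s. app (FA U (f s))) \<longleftrightarrow>
    (\<forall>\<sigma> \<in> ops \<Sigma>. f (out \<Sigma> \<sigma>) \<cdot>\<^bsub>V\<^esub> snd A \<sigma> = snd B \<sigma> \<cdot>\<^bsub>V\<^esub> arg_arr V U M (par \<Sigma> \<sigma>) (ins \<Sigma> \<sigma>) f)"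
proof -
  let ?h = "\<lambda>s. app (FA U (f s))"
  have h_in: "?h s d \<in> FO U (fst B s)" if "s \<in> S" "d \<in> FO U (fst A s)" for s d
    using U_app_in[OF pow_hom[OF f that(1)] that(2)] .
  have "f (out \<Sigma> \<sigma>) \<cdot>\<^bsub>V\<^esub> snd A \<sigma> = snd B \<sigma> \<cdot>\<^bsub>V\<^esub> arg_arr V U M (par \<Sigma> \<sigma>) (ins \<Sigma> \<sigma>) f \<longleftrightarrow>
      (\<forall>p \<in> FO U (par \<Sigma> \<sigma>). \<forall>ds \<in> args (FO (pow_func S U) (fst A)) (ins \<Sigma> \<sigma>).
        ?h (out \<Sigma> \<sigma>) (snd (und_alg U S \<Sigma> A) (\<sigma>, p) ds) = snd (und_alg U S \<Sigma> B) (\<sigma>, p) (map2 ?h (ins \<Sigma> \<sigma>) ds))"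
    (is "?l = ?r \<longleftrightarrow> _") if \<sigma>: "\<sigma> \<in> ops \<Sigma>" for \<sigma>
  proof -
    have f_ins: "\<And>s. s \<in> set (ins \<Sigma> \<sigma>) \<Longrightarrow> f s \<in> hom V (fst A s) (fst B s)"
      using pow_hom[OF f] sigD(1)[OF \<sigma>] by auto
    note arg = arg_arr[OF sigD(3)[OF \<sigma>] f_ins]
    note fo = pow_hom[OF f sigD(2)[OF \<sigma>]]
    have l: "?l \<in> hom V (arg_obj V U M (par \<Sigma> \<sigma>) (ins \<Sigma> \<sigma>) (fst A)) (fst B (out \<Sigma> \<sigma>))"
      using dom.Cmp_hom[OF op_hom[OF A \<sigma>] fo] .
    have r: "?r \<in> hom V (arg_obj V U M (par \<Sigma> \<sigma>) (ins \<Sigma> \<sigma>) (fst A)) (fst B (out \<Sigma> \<sigma>))"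
      using dom.Cmp_hom[OF arg(1) op_hom[OF B \<sigma>]] by blast
    have app_lr: "app (FA U ?l) (pair p (tup ds)) = ?h (out \<Sigma> \<sigma>) (snd (und_alg U S \<Sigma> A) (\<sigma>, p) ds)"
      "app (FA U ?r) (pair p (tup ds)) = snd (und_alg U S \<Sigma> B) (\<sigma>, p) (map2 ?h (ins \<Sigma> \<sigma>) ds)"
      if p: "p \<in> FO U (par \<Sigma> \<sigma>)" and ds: "ds \<in> args (FO (pow_func S U) (fst A)) (ins \<Sigma> \<sigma>)" for p ds
    proof -
      have z: "pair p (tup ds) \<in> FO U (arg_obj V U M (par \<Sigma> \<sigma>) (ins \<Sigma> \<sigma>) (fst A))"
        using args_obj_iff[OF carrier_Obj[OF A] \<sigma>] p ds by blast
      have ds': "ds \<in> args (\<lambda>s. FO U (fst A s)) (ins \<Sigma> \<sigma>)"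
        using ds args_FO_pow_func[OF sigD(1)[OF \<sigma>]] by simp
      have "map2 ?h (ins \<Sigma> \<sigma>) ds \<in> args (FO (pow_func S U) (fst B)) (ins \<Sigma> \<sigma>)"
        using h_in sigD(1)[OF \<sigma>] by (intro map2_in_args[OF ds]) (auto simp: FO_pow_func subset_iff)
      then show "app (FA U ?r) (pair p (tup ds)) = snd (und_alg U S \<Sigma> B) (\<sigma>, p) (map2 ?h (ins \<Sigma> \<sigma>) ds)"
        using U_app_Cmp[OF arg(1) op_hom[OF B \<sigma>] z] arg(2)[OF _ p ds'] und_alg_op[OF \<sigma> p] by simp
      show "app (FA U ?l) (pair p (tup ds)) = ?h (out \<Sigma> \<sigma>) (snd (und_alg U S \<Sigma> A) (\<sigma>, p) ds)"
        using U_app_Cmp[OF op_hom[OF A \<sigma>] fo z] und_alg_op[OF \<sigma> p ds] by simp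
    qed
    show ?thesis
    proof
      assume "\<forall>p \<in> FO U (par \<Sigma> \<sigma>). \<forall>ds \<in> args (FO (pow_func S U) (fst A)) (ins \<Sigma> \<sigma>).
        ?h (out \<Sigma> \<sigma>) (snd (und_alg U S \<Sigma> A) (\<sigma>, p) ds) = snd (und_alg U S \<Sigma> B) (\<sigma>, p) (map2 ?h (ins \<Sigma> \<sigma>) ds)"
      then show "?l = ?r"
        using app_lr args_obj_iff[OF carrier_Obj[OF A] \<sigma>] by (intro hom_eqI[OF l r]) auto
    qed (use app_lr in simp)
  qed
  moreover have "\<forall>s \<in> S. \<forall>d \<in> fst (und_alg U S \<Sigma> A) s. ?h s d \<in> fst (und_alg U S \<Sigma> B) s"
    using h_in by (simp add: FO_pow_func)
  ultimately show ?thesis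
    unfolding und.sorted_hom_def by (simp add: ball_cops_und_sig)
qed

lemma hom_alg_cat_iff:
  "k \<in> hom (alg_cat V U M S \<Sigma>) A B \<longleftrightarrow> A \<in> algebras V U M S \<Sigma> \<and> B \<in> algebras V U M S \<Sigma> \<and>
     (\<exists>f \<in> hom (pow_cat S V) (fst A) (fst B).
        und.sorted_hom (und_alg U S \<Sigma> A) (und_alg U S \<Sigma> B) (\<lambda>s. app (FA U (f s))) \<and> k = (A, f, B))"
  unfolding alg_cat_def hom_struct_cat_iff using sorted_hom_und_iff by blast

lemma Obj_alg_cat [simp]: "Obj (alg_cat V U M S \<Sigma>) = algebras V U M S \<Sigma>"
  by (simp add: alg_cat_def)

lemma alg_cat_functor:
  shows "category (alg_cat V U M S \<Sigma>)"
    and "is_functor (alg_cat V U M S \<Sigma>) (pow_cat S V) theory_forget"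
proof -
  let ?P = "\<lambda>A f B. \<forall>\<sigma> \<in> ops \<Sigma>. f (out \<Sigma> \<sigma>) \<cdot>\<^bsub>V\<^esub> snd A \<sigma> = snd B \<sigma> \<cdot>\<^bsub>V\<^esub> arg_arr V U M (par \<Sigma> \<sigma>) (ins \<Sigma> \<sigma>) f"
  \<comment> \<open>Closure under identities and composition is imported from the classical level
    rather than derived from functoriality of tensor and product.\<close>
  have Id: "?P A (Id (pow_cat S V) (fst A)) A" if A: "A \<in> algebras V U M S \<Sigma>" for A
  proof -
    have "und.sorted_hom (und_alg U S \<Sigma> A) (und_alg U S \<Sigma> A) (\<lambda>s. app (FA U (Id (pow_cat S V) (fst A) s)))"
      using pow_Obj[OF carrier_Obj[OF A]]
      by (intro und.sorted_hom_cong[OF und.sorted_hom_id und_algebra[OF A]])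
        (simp add: Id_pow_cat FO_pow_func U_app_Id del: FA_Id)
    then show ?thesis
      unfolding sorted_hom_und_iff[OF A A pow.dom.Id_hom[OF carrier_Obj[OF A]]] .
  qed
  have Cmp: "?P A (g \<cdot>\<^bsub>pow_cat S V\<^esub> f) C"
    if A: "A \<in> algebras V U M S \<Sigma>" and B: "B \<in> algebras V U M S \<Sigma>" and C: "C \<in> algebras V U M S \<Sigma>"
      and f: "f \<in> hom (pow_cat S V) (fst A) (fst B)" and g: "g \<in> hom (pow_cat S V) (fst B) (fst C)"
      and fg: "?P A f B" "?P B g C" for A B C f g
  proof -
    have "und.sorted_hom (und_alg U S \<Sigma> A) (und_alg U S \<Sigma> C) (\<lambda>s d. app (FA U (g s)) (app (FA U (f s)) d))"
      using und.sorted_hom_comp fg[folded sorted_hom_und_iff[OF A B f] sorted_hom_und_iff[OF B C g]] by blast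
    then have "und.sorted_hom (und_alg U S \<Sigma> A) (und_alg U S \<Sigma> C) (\<lambda>s. app (FA U ((g \<cdot>\<^bsub>pow_cat S V\<^esub> f) s)))"
      by (rule und.sorted_hom_cong[OF _ und_algebra[OF A]])
        (simp add: Cmp_pow_cat FO_pow_func U_app_Cmp[OF pow_hom[OF f] pow_hom[OF g]])
    then show ?thesis
      unfolding sorted_hom_und_iff[OF A C pow.dom.Cmp_hom[OF f g]] .
  qed
  show cat: "category (alg_cat V U M S \<Sigma>)"
    unfolding alg_cat_def
    by (rule category_struct_cat[OF pow.dom.category_axioms]) (use Id Cmp carrier_Obj in blast)+
  show "is_functor (alg_cat V U M S \<Sigma>) (pow_cat S V) theory_forget"
    unfolding theory_forget_def alg_cat_def
    by (rule is_functor_struct_forget[OF pow.dom.category_axioms cat[unfolded alg_cat_def] carrier_Obj])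
qed

lemma is_functor_und_func:
  "is_functor (alg_cat V U M S \<Sigma>) (classical_alg_cat S (und_sig U \<Sigma>)) (und_func U S \<Sigma>)"
proof (rule is_functor.intro[OF alg_cat_functor(1) und.classical_alg_cat_functor(1)], unfold_locales)
  fix k A B assume "k \<in> hom (alg_cat V U M S \<Sigma>) A B"
  then obtain f where A: "A \<in> algebras V U M S \<Sigma>" and B: "B \<in> algebras V U M S \<Sigma>"
    and f: "f \<in> hom (pow_cat S V) (fst A) (fst B)"
    and h: "und.sorted_hom (und_alg U S \<Sigma> A) (und_alg U S \<Sigma> B) (\<lambda>s. app (FA U (f s)))" and k: "k = (A, f, B)"
    by (auto simp: hom_alg_cat_iff)
  have "und.sorted_hom (und_alg U S \<Sigma> A) (und_alg U S \<Sigma> B) (\<lambda>s. app (FA (pow_func S U) f s))"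
    using und.sorted_hom_cong[OF h und_algebra[OF A]] by (simp add: FA_pow_func)
  then show "FA (und_func U S \<Sigma>) k
      \<in> hom (classical_alg_cat S (und_sig U \<Sigma>)) (FO (und_func U S \<Sigma>) A) (FO (und_func U S \<Sigma>) B)"
    using und_algebra[OF A] und_algebra[OF B] pow.FA_hom[OF f] k
    by (auto simp: und.hom_classical_alg_cat_iff und_func_def)
next
  fix A assume "A \<in> Obj (alg_cat V U M S \<Sigma>)"
  then have "fst A \<in> Obj (pow_cat S V)"
    by (simp add: carrier_Obj)
  then show "FA (und_func U S \<Sigma>) (Id (alg_cat V U M S \<Sigma>) A)
      = Id (classical_alg_cat S (und_sig U \<Sigma>)) (FO (und_func U S \<Sigma>) A)"
    using pow.FA_Id by (simp add: und_func_def alg_cat_def classical_alg_cat_def struct_cat_def)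
next
  fix k l A B C assume "k \<in> hom (alg_cat V U M S \<Sigma>) A B" "l \<in> hom (alg_cat V U M S \<Sigma>) B C"
  then obtain f g where "f \<in> hom (pow_cat S V) (fst A) (fst B)" "k = (A, f, B)"
    "g \<in> hom (pow_cat S V) (fst B) (fst C)" "l = (B, g, C)"
    by (auto simp: hom_alg_cat_iff)
  then show "FA (und_func U S \<Sigma>) (l \<cdot>\<^bsub>alg_cat V U M S \<Sigma>\<^esub> k)
      = FA (und_func U S \<Sigma>) l \<cdot>\<^bsub>classical_alg_cat S (und_sig U \<Sigma>)\<^esub> FA (und_func U S \<Sigma>) k"
    using pow.FA_Cmp by (simp add: und_func_def alg_cat_def classical_alg_cat_def struct_cat_def)
qed (simp_all add: und_func_def und_algebra)

section \<open>Structured lifts of classical algebras\<close>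

text \<open>The operations of \<open>indisc_alg\<close>, but over an arbitrary carrier
  \<open>a\<close>: the common construction behind indiscrete algebras and initial lifts.\<close>

definition lift_alg :: "('u \<Rightarrow> 'v) \<Rightarrow> ('u \<times> 'u, 'u) calg \<Rightarrow> ('u, 'v, 'm) alg" where
  "lift_alg a D = (a,
     \<lambda>\<sigma> \<in> ops \<Sigma>. lift_arr V U (arg_obj V U M (par \<Sigma> \<sigma>) (ins \<Sigma> \<sigma>) a) (a (out \<Sigma> \<sigma>))
       (set_arr (cart (FO U (par \<Sigma> \<sigma>)) (tuples (map (fst D) (ins \<Sigma> \<sigma>))))
          (\<lambda>z. snd D (\<sigma>, pfst z) (untup (psnd z))) (fst D (out \<Sigma> \<sigma>))))"

text \<open>Admissibility is asked of every function \<open>g\<close> with the right values on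
  pairs, so that applications can reason with elements and never see the encoded function in
  \<open>lift_alg\<close>.\<close>

lemma
  assumes a: "a \<in> Obj (pow_cat S V)" and D: "D \<in> classical_algebras S (und_sig U \<Sigma>)"
    and aD: "FO (pow_func S U) a = fst D"
    and adm: "\<And>\<sigma> g. \<sigma> \<in> ops \<Sigma> \<Longrightarrow>
      g \<in> hom set_cat (FO U (arg_obj V U M (par \<Sigma> \<sigma>) (ins \<Sigma> \<sigma>) a)) (FO U (a (out \<Sigma> \<sigma>))) \<Longrightarrow>
      (\<And>p ds. p \<in> FO U (par \<Sigma> \<sigma>) \<Longrightarrow> ds \<in> args (fst D) (ins \<Sigma> \<sigma>) \<Longrightarrow> app g (pair p (tup ds)) = snd D (\<sigma>, p) ds) \<Longrightarrow>
      adm (arg_obj V U M (par \<Sigma> \<sigma>) (ins \<Sigma> \<sigma>) a) (a (out \<Sigma> \<sigma>)) g"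
  shows lift_alg: "lift_alg a D \<in> algebras V U M S \<Sigma>" and und_lift_alg: "und_alg U S \<Sigma> (lift_alg a D) = D"
proof -
  define g where "g \<sigma> = set_arr (cart (FO U (par \<Sigma> \<sigma>)) (tuples (map (fst D) (ins \<Sigma> \<sigma>))))
          (\<lambda>z. snd D (\<sigma>, pfst z) (untup (psnd z))) (fst D (out \<Sigma> \<sigma>))" for \<sigma>
  have U_arg: "FO U (arg_obj V U M (par \<Sigma> \<sigma>) (ins \<Sigma> \<sigma>) a) = cart (FO U (par \<Sigma> \<sigma>)) (tuples (map (fst D) (ins \<Sigma> \<sigma>)))"
    if \<sigma>: "\<sigma> \<in> ops \<Sigma>" for \<sigma>
  proof -
    have "map (\<lambda>s. FO U (a s)) (ins \<Sigma> \<sigma>) = map (fst D) (ins \<Sigma> \<sigma>)"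
      using sigD(1)[OF \<sigma>] by (auto simp: aD[symmetric] FO_pow_func subset_iff)
    then show ?thesis
      using arg_obj(2)[OF sigD(3)[OF \<sigma>], of "ins \<Sigma> \<sigma>" a, OF ins_Obj[OF a \<sigma>]] by (simp only:)
  qed
  have U_out: "FO U (a (out \<Sigma> \<sigma>)) = fst D (out \<Sigma> \<sigma>)" if "\<sigma> \<in> ops \<Sigma>" for \<sigma>
    using sigD(2)[OF that] by (simp add: aD[symmetric] FO_pow_func)
  have app_g: "app (g \<sigma>) (pair p (tup ds)) = snd D (\<sigma>, p) ds"
    if "p \<in> FO U (par \<Sigma> \<sigma>)" "ds \<in> args (fst D) (ins \<Sigma> \<sigma>)" for \<sigma> p ds
    using that by (auto simp: g_def args_def in_listset_iff)
  have g_adm: "adm (arg_obj V U M (par \<Sigma> \<sigma>) (ins \<Sigma> \<sigma>) a) (a (out \<Sigma> \<sigma>)) (g \<sigma>)" if \<sigma>: "\<sigma> \<in> ops \<Sigma>" for \<sigma>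
  proof (rule adm[OF \<sigma>])
    show "g \<sigma> \<in> hom set_cat (FO U (arg_obj V U M (par \<Sigma> \<sigma>) (ins \<Sigma> \<sigma>) a)) (FO U (a (out \<Sigma> \<sigma>)))"
      unfolding U_arg[OF \<sigma>] U_out[OF \<sigma>]
    proof (unfold g_def, rule hom_set_catI)
      have "arg_obj V U M (par \<Sigma> \<sigma>) (ins \<Sigma> \<sigma>) a \<in> Obj V"
        using arg_obj(1)[OF sigD(3)[OF \<sigma>] ins_Obj[OF a \<sigma>]] .
      then show "small (cart (FO U (par \<Sigma> \<sigma>)) (tuples (map (fst D) (ins \<Sigma> \<sigma>))))"
        using small_U U_arg[OF \<sigma>] by metis
      show "small (fst D (out \<Sigma> \<sigma>))"
        using und.algebra_small[OF D sigD(2)[OF \<sigma>]] .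
      fix z assume "z \<in> cart (FO U (par \<Sigma> \<sigma>)) (tuples (map (fst D) (ins \<Sigma> \<sigma>)))"
      then obtain p ds where "p \<in> FO U (par \<Sigma> \<sigma>)" "ds \<in> args (fst D) (ins \<Sigma> \<sigma>)" "z = pair p (tup ds)"
        by (auto simp: args_def in_tuples_iff in_listset_iff)
      then show "snd D (\<sigma>, pfst z) (untup (psnd z)) \<in> fst D (out \<Sigma> \<sigma>)"
        using und.algebra_op_in[OF D, of "(\<sigma>, p)" ds] \<sigma> by simp
    qed
  qed (use app_g in blast)
  show A: "lift_alg a D \<in> algebras V U M S \<Sigma>"
    using a lift_arr(1)[OF g_adm] by (auto simp: algebras_def lift_alg_def g_def)
  show "und_alg U S \<Sigma> (lift_alg a D) = D"
  proof (rule und.algebra_eqI[OF und_algebra[OF A] D])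
    show fst_eq: "fst (und_alg U S \<Sigma> (lift_alg a D)) = fst D"
      by (simp add: lift_alg_def aD)
    fix \<tau> ds assume \<tau>: "\<tau> \<in> cops (und_sig U \<Sigma>)"
      and ds: "ds \<in> args (fst (und_alg U S \<Sigma> (lift_alg a D))) (cins (und_sig U \<Sigma>) \<tau>)"
    obtain \<sigma> p where \<sigma>p: "\<tau> = (\<sigma>, p)" "\<sigma> \<in> ops \<Sigma>" "p \<in> FO U (par \<Sigma> \<sigma>)"
      using \<tau> by (cases \<tau>) auto
    have "snd (und_alg U S \<Sigma> (lift_alg a D)) (\<sigma>, p) ds = app (FA U (snd (lift_alg a D) \<sigma>)) (pair p (tup ds))"
      using ds \<sigma>p by (intro und_alg_op) auto
    also have "\<dots> = app (g \<sigma>) (pair p (tup ds))"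
      using lift_arr(2)[OF g_adm[OF \<sigma>p(2)]] \<sigma>p(2) by (simp add: lift_alg_def g_def)
    also have "\<dots> = snd D (\<sigma>, p) ds"
      using ds \<sigma>p fst_eq by (intro app_g) auto
    finally show "snd (und_alg U S \<Sigma> (lift_alg a D)) \<tau> ds = snd D \<tau> ds"
      using \<sigma>p(1) by simp
  qed
qed

text \<open>The initial lift of the empty source imposes no condition on incoming functions, and for
  the identity this makes it the greatest element of the fibre.\<close>

lemma indisc:
  assumes "small Y"
  shows "indisc V U Y \<in> Obj V" "FO U (indisc V U Y) = Y"
    and "\<And>w g. w \<in> Obj V \<Longrightarrow> g \<in> hom set_cat (FO U w) Y \<Longrightarrow> adm w (indisc V U Y) g"
proof -
  have "structured_source V set_cat U Y {}"
    using assms by (simp add: structured_source_def)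
  then obtain a where a: "initial_lift_domain V set_cat U Y {} a"
    using initial_lift by blast
  note a = initial_lift_domainD[OF a]
  have Id: "Id set_cat Y \<in> hom set_cat Y Y"
    using assms category.Id_hom[OF category_set_cat] by simp
  have max: "fib_le V set_cat U b a" if "b \<in> Obj V" "FO U b = Y" for b
    using a(4)[of b "Id set_cat Y"] that Id a(2) by (simp add: fib_le_def)
  have "indisc V U Y = a"
    unfolding indisc_def using a(1,2) max amnestic by (intro the_equality) blast+
  then show "indisc V U Y \<in> Obj V" "FO U (indisc V U Y) = Y"
    and "\<And>w g. w \<in> Obj V \<Longrightarrow> g \<in> hom set_cat (FO U w) Y \<Longrightarrow> adm w (indisc V U Y) g"
    using a by auto
qed

text \<open>Every function into an indiscrete object is admissible, so any classical algebra lifts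
  with indiscrete carriers.\<close>

lemma
  assumes D: "D \<in> classical_algebras S (und_sig U \<Sigma>)"
  shows indisc_algebra: "indisc_alg V U M S \<Sigma> D \<in> algebras V U M S \<Sigma>"
    and und_indisc_alg: "und_alg U S \<Sigma> (indisc_alg V U M S \<Sigma> D) = D"
    and fst_indisc_alg: "s \<in> S \<Longrightarrow> fst (indisc_alg V U M S \<Sigma> D) s = indisc V U (fst D s)"
proof -
  let ?a = "\<lambda>s\<in>S. indisc V U (fst D s)"
  have eq: "indisc_alg V U M S \<Sigma> D = lift_alg ?a D"
    by (simp add: indisc_alg_def lift_alg_def Let_def)
  note small = und.algebra_small[OF D]
  have a: "?a \<in> Obj (pow_cat S V)"
    using indisc(1)[OF small] by (auto simp: Obj_pow_cat)
  have "fst D \<in> extensional S"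
    using und.algebra_carrier[OF D] by (auto simp: Obj_pow_cat PiE_iff)
  then have aD: "FO (pow_func S U) ?a = fst D"
    using indisc(2)[OF small] by (intro extensionalityI[of _ S]) (auto simp: pow_func_def)
  have "adm (arg_obj V U M (par \<Sigma> \<sigma>) (ins \<Sigma> \<sigma>) ?a) (?a (out \<Sigma> \<sigma>)) g"
    if \<sigma>: "\<sigma> \<in> ops \<Sigma>" and g: "g \<in> hom set_cat (FO U (arg_obj V U M (par \<Sigma> \<sigma>) (ins \<Sigma> \<sigma>) ?a)) (FO U (?a (out \<Sigma> \<sigma>)))"
    for \<sigma> g
  proof -
    have "arg_obj V U M (par \<Sigma> \<sigma>) (ins \<Sigma> \<sigma>) ?a \<in> Obj V"
      using arg_obj(1)[OF sigD(3)[OF \<sigma>] ins_Obj[OF a \<sigma>]] .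
    then show ?thesis
      using indisc(2,3)[OF small[OF sigD(2)[OF \<sigma>]]] g sigD(2)[OF \<sigma>] by simp
  qed
  then show "indisc_alg V U M S \<Sigma> D \<in> algebras V U M S \<Sigma>" "und_alg U S \<Sigma> (indisc_alg V U M S \<Sigma> D) = D"
    unfolding eq using lift_alg[OF a D aD] und_lift_alg[OF a D aD] by blast+
  show "s \<in> S \<Longrightarrow> fst (indisc_alg V U M S \<Sigma> D) s = indisc V U (fst D s)"
    by (simp add: eq lift_alg_def)
qed

text \<open>Admissibility into the indiscrete carriers is automatic, so a classical homomorphism
  becomes an enriched one. This is the supply of morphisms along which naturality of operations is
  used.\<close>

lemma hom_indisc_alg:
  assumes A: "A \<in> algebras V U M S \<Sigma>" and D: "D \<in> classical_algebras S (und_sig U \<Sigma>)"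
    and h: "und.sorted_hom (und_alg U S \<Sigma> A) D h"
  obtains f where "(A, f, indisc_alg V U M S \<Sigma> D) \<in> hom (alg_cat V U M S \<Sigma>) A (indisc_alg V U M S \<Sigma> D)"
    "\<And>s x. s \<in> S \<Longrightarrow> x \<in> FO U (fst A s) \<Longrightarrow> app (FA U (f s)) x = h s x"
proof -
  let ?I = "indisc_alg V U M S \<Sigma> D"
  define f where "f = (\<lambda>s\<in>S. lift_arr V U (fst A s) (fst ?I s) (set_arr (FO U (fst A s)) (h s) (fst D s)))"
  have "adm (fst A s) (fst ?I s) (set_arr (FO U (fst A s)) (h s) (fst D s))" if s: "s \<in> S" for s
  proof -
    note As = pow_Obj[OF carrier_Obj[OF A] s] and small = und.algebra_small[OF D s]
    have "set_arr (FO U (fst A s)) (h s) (fst D s) \<in> hom set_cat (FO U (fst A s)) (fst D s)"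
      using small_U[OF As] small und.sorted_hom_in[OF h s] s by (intro hom_set_catI) (auto simp: FO_pow_func)
    then show ?thesis
      unfolding fst_indisc_alg[OF D s] by (rule indisc(3)[OF small As])
  qed
  note lift = lift_arr[OF this]
  have f: "f \<in> hom (pow_cat S V) (fst A) (fst ?I)"
    using carrier_Obj[OF A] carrier_Obj[OF indisc_algebra[OF D]] lift(1)
    by (auto simp: hom_pow_cat_iff f_def Obj_pow_cat PiE_iff)
  have app_f: "app (FA U (f s)) x = h s x" if "s \<in> S" "x \<in> FO U (fst A s)" for s x
    using that lift(2) by (simp add: f_def)
  have "und.sorted_hom (und_alg U S \<Sigma> A) (und_alg U S \<Sigma> ?I) (\<lambda>s. app (FA U (f s)))"
    unfolding und_indisc_alg[OF D]
    by (rule und.sorted_hom_cong[OF h und_algebra[OF A]]) (simp add: FO_pow_func app_f)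
  then have "(A, f, ?I) \<in> hom (alg_cat V U M S \<Sigma>) A ?I"
    using A indisc_algebra[OF D] f by (simp add: hom_alg_cat_iff)
  then show ?thesis
    using that app_f by blast
qed

section \<open>Algebraic operations are given by terms\<close>

lemma ctx_algebra: "ctx_alg U S \<Sigma> ss \<in> classical_algebras S (und_sig U \<Sigma>)"
  unfolding ctx_alg_def by (rule und.term_algebra) (rule small_ctx_vars)

context
  fixes ss s P \<omega>
  assumes \<omega>: "algebraic_operation V U M S \<Sigma> ss s P \<omega>"
begin

lemma operation_type: "set ss \<subseteq> S" "s \<in> S" "P \<in> Obj V"
  using \<omega> by (auto simp: algebraic_operation_def)

lemma operation_hom: "A \<in> algebras V U M S \<Sigma> \<Longrightarrow> \<omega> A \<in> hom V (arg_obj V U M P ss (fst A)) (fst A s)"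
  using \<omega> by (auto simp: algebraic_operation_def nat_trans_def args_func_def sort_func_def)

lemma operation_arg_iff:
  assumes "A \<in> algebras V U M S \<Sigma>"
  shows "z \<in> FO U (arg_obj V U M P ss (fst A)) \<longleftrightarrow>
    (\<exists>p \<in> FO U P. \<exists>ds \<in> args (FO (pow_func S U) (fst A)) ss. z = pair p (tup ds))"
proof -
  have "fst A s \<in> Obj V" if "s \<in> set ss" for s
    using pow_Obj[OF carrier_Obj[OF assms]] operation_type(1) that by blast
  then show ?thesis
    using in_arg_obj_iff[OF operation_type(3), of ss "fst A"] args_FO_pow_func[OF operation_type(1)] by simp
qed

lemma operation_natural:
  assumes k: "(A, f, B) \<in> hom (alg_cat V U M S \<Sigma>) A B"
    and p: "p \<in> FO U P" and ds: "ds \<in> args (FO (pow_func S U) (fst A)) ss"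
  shows "app (FA U (f s)) (app (FA U (\<omega> A)) (pair p (tup ds)))
    = app (FA U (\<omega> B)) (pair p (tup (map2 (\<lambda>s d. app (FA U (f s)) d) ss ds)))"
proof -
  have A: "A \<in> algebras V U M S \<Sigma>" and B: "B \<in> algebras V U M S \<Sigma>" and f: "f \<in> hom (pow_cat S V) (fst A) (fst B)"
    using k by (auto simp: hom_alg_cat_iff)
  have f_ss: "\<And>s. s \<in> set ss \<Longrightarrow> f s \<in> hom V (fst A s) (fst B s)"
    using pow_hom[OF f] operation_type(1) by auto
  note arg = arg_arr[OF operation_type(3) f_ss]
  have z: "pair p (tup ds) \<in> FO U (arg_obj V U M P ss (fst A))"
    using operation_arg_iff[OF A] p ds by blast
  have "FA (sort_func s) (A, f, B) \<cdot>\<^bsub>V\<^esub> \<omega> A = \<omega> B \<cdot>\<^bsub>V\<^esub> FA (args_func V U M P ss) (A, f, B)"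
    using \<omega> k unfolding algebraic_operation_def nat_trans_def by blast
  then have "f s \<cdot>\<^bsub>V\<^esub> \<omega> A = \<omega> B \<cdot>\<^bsub>V\<^esub> arg_arr V U M P ss f"
    by (simp add: args_func_def sort_func_def)
  then have "app (FA U (f s \<cdot>\<^bsub>V\<^esub> \<omega> A)) (pair p (tup ds)) = app (FA U (\<omega> B \<cdot>\<^bsub>V\<^esub> arg_arr V U M P ss f)) (pair p (tup ds))"
    by simp
  then show ?thesis
    using U_app_Cmp[OF operation_hom[OF A] pow_hom[OF f operation_type(2)] z]
      U_app_Cmp[OF arg(1) operation_hom[OF B] z] arg(2)[OF _ p] ds args_FO_pow_func[OF operation_type(1)]
    by simp
qed

lemma ctx_args: "map (\<lambda>v. enc_trm enc_op_symbol enc_var (Var v)) (var_ctx ss) \<in> args (fst (ctx_alg U S \<Sigma> ss)) ss"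
proof -
  have "list_all2 (wsorted (und_sig U \<Sigma>) (ctx_vars (var_ctx ss))) (map Var (var_ctx ss)) (map snd (var_ctx ss))"
    by (auto simp: list_all2_conv_all_nth ctx_vars_def intro!: wsorted.intros)
  then have "list_all2 (wsorted (und_sig U \<Sigma>) (ctx_vars (var_ctx ss))) (map Var (var_ctx ss)) ss"
    unfolding map_snd_var_ctx .
  from und.enc_trms_in_args[OF this operation_type(1), of enc_var] show ?thesis
    by (simp add: ctx_alg_def comp_def)
qed

text \<open>The value of \<open>\<omega>\<close> at the generic arguments lies in the carrier of the
  term algebra, hence is the code of a term, and of only one by injectivity. So the description in
  \<open>op_term\<close> denotes.\<close>

lemma op_term:
  assumes p: "p \<in> FO U P"
  shows "wsorted (und_sig U \<Sigma>) (ctx_vars (var_ctx ss)) (op_term V U M S \<Sigma> ss s \<omega> p) s"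
    and "enc_trm enc_op_symbol enc_var (op_term V U M S \<Sigma> ss s \<omega> p) =
       app (FA U (\<omega> (indisc_alg V U M S \<Sigma> (ctx_alg U S \<Sigma> ss))))
         (pair p (tup (map (\<lambda>v. enc_trm enc_op_symbol enc_var (Var v)) (var_ctx ss))))"
proof -
  let ?D = "ctx_alg U S \<Sigma> ss"
  let ?I = "indisc_alg V U M S \<Sigma> ?D"
  let ?z = "pair p (tup (map (\<lambda>v. enc_trm enc_op_symbol enc_var (Var v)) (var_ctx ss)))"
  note I = indisc_algebra[OF ctx_algebra]
  have fst_I: "FO (pow_func S U) (fst ?I) = fst ?D"
    using und_indisc_alg[OF ctx_algebra] by (metis fst_und_alg)
  have "?z \<in> FO U (arg_obj V U M P ss (fst ?I))"
    unfolding operation_arg_iff[OF I] fst_I using p ctx_args by blast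
  then have "app (FA U (\<omega> ?I)) ?z \<in> FO U (fst ?I s)"
    by (rule U_app_in[OF operation_hom[OF I]])
  then have "app (FA U (\<omega> ?I)) ?z \<in> fst ?D s"
    using fst_I FO_pow_func[OF operation_type(2)] by metis
  then obtain t where t: "wsorted (und_sig U \<Sigma>) (ctx_vars (var_ctx ss)) t s"
    "enc_trm enc_op_symbol enc_var t = app (FA U (\<omega> ?I)) ?z"
    by (auto simp: ctx_alg_def und.in_term_carrier_iff[OF operation_type(2)])
  have "t' = t" if "enc_trm enc_op_symbol enc_var t' = app (FA U (\<omega> ?I)) ?z" for t'
    using t(2) that inj_enc_trm[OF inj_enc_op_symbol inj_enc_var] by (metis injD)
  then have "op_term V U M S \<Sigma> ss s \<omega> p = t"
    unfolding op_term_def using t by blast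
  then show "wsorted (und_sig U \<Sigma>) (ctx_vars (var_ctx ss)) (op_term V U M S \<Sigma> ss s \<omega> p) s"
    and "enc_trm enc_op_symbol enc_var (op_term V U M S \<Sigma> ss s \<omega> p) = app (FA U (\<omega> ?I)) ?z"
    using t by auto
qed

text \<open>Let \<open>I\<close> denote the indiscrete algebra on a classical algebra. Naturality of \<open>\<omega>\<close> along
  \<open>A \<rightarrow> I |A| \<leftarrow> I D\<close>, where \<open>D\<close> is the algebra of terms in context and the second morphism
  evaluates terms, determines \<open>\<omega>\<close> on \<open>A\<close> by its value at the generic arguments in \<open>I D\<close>.\<close>

lemma operation_eq_term_fun:
  assumes A: "A \<in> algebras V U M S \<Sigma>" and p: "p \<in> FO U P"
    and ds: "ds \<in> args (FO (pow_func S U) (fst A)) ss"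
  shows "app (FA U (\<omega> A)) (pair p (tup ds))
    = term_fun (und_alg U S \<Sigma> A) (var_ctx ss) (op_term V U M S \<Sigma> ss s \<omega> p) ds"
proof -
  let ?D = "ctx_alg U S \<Sigma> ss" and ?B = "und_alg U S \<Sigma> A" and ?vs = "var_ctx ss"
  let ?ID = "indisc_alg V U M S \<Sigma> ?D" and ?IB = "indisc_alg V U M S \<Sigma> ?B"
  let ?xs = "map (\<lambda>v. enc_trm enc_op_symbol enc_var (Var v)) ?vs"
  define \<rho> where "\<rho> v = the (map_of (zip ?vs ds) v)" for v
  note B = und_algebra[OF A]
  have len: "length ds = length ss" "length ?vs = length ss"
    using args_length[OF ds] arg_cong[OF map_snd_var_ctx[of ss], of length] by auto
  have \<rho>_nth: "\<rho> (?vs ! i) = ds ! i" if "i < length ss" for i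
    unfolding \<rho>_def using map_of_zip_nth[OF _ distinct_var_ctx[of ss], of ds i] len that by simp
  have \<rho>: "\<rho> v \<in> fst ?B s'" if "s' \<in> S" "v \<in> ctx_vars ?vs s'" for s' v
  proof -
    from that obtain i where i: "i < length ss" "?vs ! i = v" "snd v = s'"
      using len by (auto simp: ctx_vars_def in_set_conv_nth)
    moreover have "ss ! i = snd (?vs ! i)"
      using i(1) len map_snd_var_ctx by (metis nth_map)
    ultimately show ?thesis
      using \<rho>_nth[of i] args_nth[OF ds, of i] by simp
  qed
  \<comment> \<open>\<open>h\<close> evaluates terms at \<open>ds\<close>. One valuation
    \<open>\<rho>\<close> serves all sorts, since a variable carries its own sort.\<close>
  obtain h where h: "und.sorted_hom ?D ?B h" "\<And>s v. h s (enc_leaf (enc_var v)) = \<rho> v"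
    using und.sorted_hom_term_alg[where Y = "ctx_vars ?vs" and f = "\<lambda>_. \<rho>", OF inj_enc_var B] \<rho>
    unfolding ctx_alg_def by blast
  have "h s (enc_trm enc_op_symbol enc_var t) = term_fun ?B ?vs t ds"
    if "wsorted (und_sig U \<Sigma>) (ctx_vars ?vs) t s" for t
  proof -
    have leaf: "enc_leaf (enc_var v) \<in> fst ?D s' \<and> \<rho> v = h s' (enc_leaf (enc_var v))"
      if "s' \<in> S" "v \<in> ctx_vars ?vs s'" for s' v
    proof -
      have "wsorted (und_sig U \<Sigma>) (ctx_vars ?vs) (Var v) s'"
        using that by (intro wsorted.intros)
      then show ?thesis
        using h(2) und.in_term_carrier_iff[OF that(1)] unfolding ctx_alg_def
        by (metis enc_trm.simps(1) und.fst_term_alg)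
    qed
    show ?thesis
      using und.sorted_hom_eval_trm[where \<rho> = "\<lambda>v. enc_leaf (enc_var v)" and \<rho>' = \<rho>,
          OF h(1) ctx_algebra leaf that operation_type(2)] und.eval_trm_term_alg[OF that, of enc_var]
      by (simp add: ctx_alg_def term_fun_def \<rho>_def[abs_def])
  qed
  from this[OF op_term(1)[OF p]]
  have "term_fun ?B ?vs (op_term V U M S \<Sigma> ss s \<omega> p) ds = h s (app (FA U (\<omega> ?ID)) (pair p (tup ?xs)))"
    by (simp add: op_term(2)[OF p])
  also have "\<dots> = app (FA U (\<omega> ?IB)) (pair p (tup ds))"
  proof -
    have h': "und.sorted_hom (und_alg U S \<Sigma> ?ID) ?B h"
      using h(1) und_indisc_alg[OF ctx_algebra] by simp
    have fst_D: "FO (pow_func S U) (fst ?ID) = fst ?D"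
      using und_indisc_alg[OF ctx_algebra] by (metis fst_und_alg)
    have U_D: "FO U (fst ?ID s') = fst ?D s'" if "s' \<in> S" for s'
      using fst_D FO_pow_func[OF that] by metis
    obtain f where f: "(?ID, f, ?IB) \<in> hom (alg_cat V U M S \<Sigma>) ?ID ?IB"
      "\<And>s x. s \<in> S \<Longrightarrow> x \<in> FO U (fst ?ID s) \<Longrightarrow> app (FA U (f s)) x = h s x"
      using hom_indisc_alg[OF indisc_algebra[OF ctx_algebra] B h'] by blast
    have z: "pair p (tup ?xs) \<in> FO U (arg_obj V U M P ss (fst ?ID))"
      unfolding operation_arg_iff[OF indisc_algebra[OF ctx_algebra]] fst_D using p ctx_args by blast
    \<comment> \<open>\<open>f\<close> sends the generic arguments to \<open>ds\<close>, so
      naturality carries the term computed in \<open>?ID\<close> to the value of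
      \<open>\<omega>\<close> in \<open>?IB\<close>.\<close>
    have "map2 (\<lambda>s d. app (FA U (f s)) d) ss ?xs = map2 h ss ?xs"
      using f(2) operation_type(1) U_D by (intro map2_args_cong[OF ctx_args]) auto
    also have "\<dots> = ds"
      using len h(2) \<rho>_nth by (intro nth_equalityI) auto
    finally show ?thesis
      using operation_natural[OF f(1) p, of ?xs] ctx_args fst_D
        f(2)[OF operation_type(2) U_app_in[OF operation_hom[OF indisc_algebra[OF ctx_algebra]] z]] by simp
  qed
  \<comment> \<open>This \<open>f\<close> lies over the identity of the carriers, so the value in
    \<open>?IB\<close> is the value in \<open>A\<close>.\<close>
  also have "\<dots> = app (FA U (\<omega> A)) (pair p (tup ds))"
  proof -
    obtain f where f: "(A, f, ?IB) \<in> hom (alg_cat V U M S \<Sigma>) A ?IB"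
      "\<And>s x. s \<in> S \<Longrightarrow> x \<in> FO U (fst A s) \<Longrightarrow> app (FA U (f s)) x = x"
      using hom_indisc_alg[OF A B und.sorted_hom_id] by blast
    have z: "pair p (tup ds) \<in> FO U (arg_obj V U M P ss (fst A))"
      unfolding operation_arg_iff[OF A] using p ds by blast
    have "map2 (\<lambda>s d. app (FA U (f s)) d) ss ds = map2 (\<lambda>s d. d) ss ds"
      using f(2) operation_type(1) by (intro map2_args_cong[OF ds]) (auto simp: FO_pow_func subset_iff)
    also have "\<dots> = ds"
      using len by (simp add: map2_snd)
    finally show ?thesis
      using operation_natural[OF f(1) p ds] f(2)[OF operation_type(2) U_app_in[OF operation_hom[OF A] z]] by simp
  qed
  finally show ?thesis
    by simp
qed

end

end

section \<open>Enriched theories\<close>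

locale enriched_theory = enriched_signature V U M S \<Sigma>
  for V :: "('v, 'm) cat" and U :: "('v, 'm, 'u::set_universe set, 'u set_arrow) func"
    and M :: "('v, 'm) monoidal" and S :: "'u set" and \<Sigma> :: "('u, 'v) esig" +
  fixes E :: "('u, 'v, 'm) eeqn set"
  assumes equational: "equational_theory V U M S \<Sigma> E"
begin

lemma eqn_operations:
  assumes "e \<in> E"
  shows "algebraic_operation V U M S \<Sigma> (eins e) (eout e) (epar e) (elhs e)"
    and "algebraic_operation V U M S \<Sigma> (eins e) (eout e) (epar e) (erhs e)"
  using equational assms by (auto simp: equational_theory_def)

sublocale cls: classical_theory S "und_sig U \<Sigma>" enc_op_symbol "und_eqns V U M S \<Sigma> E"
proof
  fix e' assume "e' \<in> und_eqns V U M S \<Sigma> E"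
  then obtain e p where e: "e \<in> E" and p: "p \<in> FO U (epar e)"
    and e': "e' = \<lparr>cctx = var_ctx (eins e), clhs = op_term V U M S \<Sigma> (eins e) (eout e) (elhs e) p,
      crhs = op_term V U M S \<Sigma> (eins e) (eout e) (erhs e) p, csrt = eout e\<rparr>"
    by (auto simp: und_eqns_def)
  note l = eqn_operations(1)[OF e] and r = eqn_operations(2)[OF e]
  have "snd ` set (var_ctx (eins e)) = set (eins e)"
    using map_snd_var_ctx[of "eins e"] by (metis list.set_map)
  then show "und.ceqn_sorted e'"
    using op_term(1)[OF l p] op_term(1)[OF r p] distinct_var_ctx operation_type[OF l]
    by (simp add: und.ceqn_sorted_def e')
qed

text \<open>Each side of an equation takes at \<open>pair p (tup ds)\<close> the value of its term
  for \<open>p\<close>, and such pairs exhaust the argument object. So one enriched equation holds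
  exactly when its classical equations for all \<open>p\<close> do.\<close>

lemma satisfies_iff:
  assumes A: "A \<in> algebras V U M S \<Sigma>"
  shows "(\<forall>e \<in> E. elhs e A = erhs e A) \<longleftrightarrow> (\<forall>e' \<in> und_eqns V U M S \<Sigma> E. csatisfies (und_alg U S \<Sigma> A) e')"
proof -
  have "elhs e A = erhs e A \<longleftrightarrow> (\<forall>p \<in> FO U (epar e). csatisfies (und_alg U S \<Sigma> A)
      \<lparr>cctx = var_ctx (eins e), clhs = op_term V U M S \<Sigma> (eins e) (eout e) (elhs e) p,
      crhs = op_term V U M S \<Sigma> (eins e) (eout e) (erhs e) p, csrt = eout e\<rparr>)" (is "_ \<longleftrightarrow> ?r")
    if e: "e \<in> E" for e
  proof -
    note l = eqn_operations(1)[OF e] and r = eqn_operations(2)[OF e]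
    have "?r \<longleftrightarrow> (\<forall>p \<in> FO U (epar e). \<forall>ds \<in> args (FO (pow_func S U) (fst A)) (eins e).
        app (FA U (elhs e A)) (pair p (tup ds)) = app (FA U (erhs e A)) (pair p (tup ds)))"
      using operation_eq_term_fun[OF l A] operation_eq_term_fun[OF r A]
      by (simp add: csatisfies_def map_snd_var_ctx)
    also have "\<dots> \<longleftrightarrow> elhs e A = erhs e A"
    proof
      assume eq: "\<forall>p \<in> FO U (epar e). \<forall>ds \<in> args (FO (pow_func S U) (fst A)) (eins e).
        app (FA U (elhs e A)) (pair p (tup ds)) = app (FA U (erhs e A)) (pair p (tup ds))"
      show "elhs e A = erhs e A"
      proof (rule hom_eqI[OF operation_hom[OF l A] operation_hom[OF r A]])
        fix z assume "z \<in> FO U (arg_obj V U M (epar e) (eins e) (fst A))"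
        then show "app (FA U (elhs e A)) z = app (FA U (erhs e A)) z"
          using eq unfolding operation_arg_iff[OF l A] by blast
      qed
    qed simp
    finally show ?thesis
      by blast
  qed
  then show ?thesis
    unfolding und_eqns_def by blast
qed

section \<open>The functor from enriched models to classical models\<close>

abbreviation Alg where "Alg \<equiv> theory_cat V U M S \<Sigma> E"
abbreviation uAlg where "uAlg \<equiv> classical_theory_cat S (und_sig U \<Sigma>) (und_eqns V U M S \<Sigma> E)"

lemma Obj_theory_cat: "Obj Alg = {A \<in> algebras V U M S \<Sigma>. und_alg U S \<Sigma> A \<in> Obj uAlg}"
  using satisfies_iff und_algebra by (auto simp: theory_cat_def cls.Obj_classical_theory_cat)

lemma hom_theory_cat_iff:
  "k \<in> hom Alg A B \<longleftrightarrow> k \<in> hom (alg_cat V U M S \<Sigma>) A B \<and> A \<in> Obj Alg \<and> B \<in> Obj Alg"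
  by (auto simp: theory_cat_def hom_full_subcat_iff hom_alg_cat_iff)

lemma is_functor_theory_forget: "is_functor Alg (pow_cat S V) theory_forget"
  using is_functor_full_subcat[OF alg_cat_functor(2), of _ "\<lambda>_. True"]
  unfolding theory_cat_def full_subcat_top by blast

lemma is_functor_und_theory: "is_functor Alg uAlg (und_func U S \<Sigma>)"
  unfolding theory_cat_def classical_theory_cat_def
  by (rule is_functor_full_subcat[OF is_functor_und_func]) (simp add: satisfies_iff und_func_def)

interpretation und_functor: is_functor Alg uAlg "und_func U S \<Sigma>"
  by (rule is_functor_und_theory)

text \<open>The homomorphism condition is already part of being a classical morphism, so only the
  carrier has to lift. Initiality of algebras can therefore be tested on carriers.\<close>

lemma admissible_und_iff:
  assumes A: "A \<in> Obj Alg" and B: "B \<in> Obj Alg"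
  shows "admissible Alg uAlg (und_func U S \<Sigma>) A B k \<longleftrightarrow>
    k \<in> hom uAlg (und_alg U S \<Sigma> A) (und_alg U S \<Sigma> B) \<and>
    admissible (pow_cat S V) (pow_cat S set_cat) (pow_func S U) (fst A) (fst B) (FA classical_forget k)"
    (is "?l \<longleftrightarrow> ?r")
proof
  assume ?l
  then obtain f where "f \<in> hom (pow_cat S V) (fst A) (fst B)" "k = FA (und_func U S \<Sigma>) (A, f, B)"
    and "k \<in> hom uAlg (und_alg U S \<Sigma> A) (und_alg U S \<Sigma> B)"
    by (auto simp: admissible_def hom_theory_cat_iff hom_alg_cat_iff und_func_def)
  then show ?r
    by (auto simp: pow.admissible_iff classical_forget_def struct_forget_def und_func_def)
next
  assume r: ?r
  then obtain g where g: "g \<in> hom (pow_cat S set_cat) (fst (und_alg U S \<Sigma> A)) (fst (und_alg U S \<Sigma> B))"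
    "und.sorted_hom (und_alg U S \<Sigma> A) (und_alg U S \<Sigma> B) (\<lambda>s. app (g s))"
    "k = (und_alg U S \<Sigma> A, g, und_alg U S \<Sigma> B)"
    by (auto simp: cls.hom_classical_theory_cat_iff und.hom_classical_alg_cat_iff)
  then obtain f where f: "f \<in> hom (pow_cat S V) (fst A) (fst B)" "FA (pow_func S U) f = g"
    using r by (auto simp: pow.admissible_iff classical_forget_def struct_forget_def)
  have A': "A \<in> algebras V U M S \<Sigma>" and B': "B \<in> algebras V U M S \<Sigma>"
    using A B by (auto simp: Obj_theory_cat)
  have "und.sorted_hom (und_alg U S \<Sigma> A) (und_alg U S \<Sigma> B) (\<lambda>s. app (FA U (f s)))"
    by (rule und.sorted_hom_cong[OF g(2) und_algebra[OF A']]) (simp add: f(2)[symmetric] FA_pow_func)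
  then have "(A, f, B) \<in> hom Alg A B"
    using A B A' B' f(1) by (auto simp: hom_theory_cat_iff hom_alg_cat_iff)
  moreover have "FA (und_func U S \<Sigma>) (A, f, B) = k"
    using f(2) g(3) by (simp add: und_func_def)
  ultimately show ?l
    unfolding und_functor.admissible_iff by blast
qed

lemma FO_und_func: "FO (und_func U S \<Sigma>) = und_alg U S \<Sigma>"
  by (simp add: und_func_def)

lemma forget_Cmp:
  assumes "f \<in> hom uAlg A B" "g \<in> hom uAlg B C"
  shows "FA classical_forget (g \<cdot>\<^bsub>uAlg\<^esub> f) = FA classical_forget g \<cdot>\<^bsub>pow_cat S set_cat\<^esub> FA classical_forget f"
  using is_functor.FA_Cmp[OF cls.is_functor_classical_forget assms] .

lemma forget_hom: "f \<in> hom uAlg A B \<Longrightarrow> FA classical_forget f \<in> hom (pow_cat S set_cat) (fst A) (fst B)"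
  using is_functor.FA_hom[OF cls.is_functor_classical_forget] by simp

text \<open>The second conclusion says that the carrier of the lift is the lift of the carriers.
  Through uniqueness of lifts it becomes the preservation hypothesis of
  \<open>taut_lift\<close>.\<close>

lemma theory_initial_lift:
  assumes K: "structured_source Alg uAlg (und_func U S \<Sigma>) D K"
  obtains A where "initial_lift_domain Alg uAlg (und_func U S \<Sigma>) D K A"
    and "initial_lift_domain (pow_cat S V) (pow_cat S set_cat) (pow_func S U) (fst D)
      ((\<lambda>(B, k). (fst B, FA classical_forget k)) ` K) (fst A)"
proof -
  let ?K = "(\<lambda>(B, k). (fst B, FA classical_forget k)) ` K"
  have D: "D \<in> Obj uAlg" and KB: "\<And>B k. (B, k) \<in> K \<Longrightarrow> B \<in> Obj Alg"
    and Kk: "\<And>B k. (B, k) \<in> K \<Longrightarrow> k \<in> hom uAlg D (und_alg U S \<Sigma> B)"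
    using K by (auto simp: structured_source_def und_func_def)
  have D': "D \<in> classical_algebras S (und_sig U \<Sigma>)"
    using D by (simp add: cls.Obj_classical_theory_cat)
  have KB': "B \<in> algebras V U M S \<Sigma>" if "(B, k) \<in> K" for B k
    using KB[OF that] by (simp add: Obj_theory_cat)
  have source: "structured_source (pow_cat S V) (pow_cat S set_cat) (pow_func S U) (fst D) ?K"
    using und.algebra_carrier[OF D'] carrier_Obj[OF KB'] forget_hom[OF Kk]
    by (fastforce simp: structured_source_def)
  \<comment> \<open>The carrier is lifted sort by sort, because admissibility of an operation is
    tested in its output sort alone.\<close>
  then have "\<exists>b. initial_lift_domain V set_cat U (fst D s) ((\<lambda>(b, f). (b s, f s)) ` ?K) b" if "s \<in> S" for s
    using structured_source_pow_funcD[OF topological_axioms source that] initial_lift by blast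
  then obtain b where b: "\<And>s. s \<in> S \<Longrightarrow> initial_lift_domain V set_cat U (fst D s) ((\<lambda>(b, f). (b s, f s)) ` ?K) (b s)"
    by metis
  define a where "a = restrict b S"
  have a_init: "initial_lift_domain V set_cat U (fst D s) ((\<lambda>(b, f). (b s, f s)) ` ?K) (a s)" if "s \<in> S" for s
    using b[OF that] that by (simp add: a_def)
  have pow_init: "initial_lift_domain (pow_cat S V) (pow_cat S set_cat) (pow_func S U) (fst D) ?K a"
    by (rule initial_lift_domain_pow_funcI[OF topological_axioms source _ a_init])
      (simp_all only: a_def restrict_extensional)
  note a = initial_lift_domainD[OF pow_init]
  let ?A = "lift_alg a D"
  \<comment> \<open>By initiality in the output sort it suffices to compose \<open>g\<close> with
    the components. As \<open>k\<close> is a homomorphism, such a composite equals the operation of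
    \<open>B\<close> after the lifted argument map, which underlies the \<open>V\<close>-morphism
    \<open>?m\<close>.\<close>
  have adm_op: "adm (arg_obj V U M (par \<Sigma> \<sigma>) (ins \<Sigma> \<sigma>) a) (a (out \<Sigma> \<sigma>)) g"
    if \<sigma>: "\<sigma> \<in> ops \<Sigma>"
      and g: "g \<in> hom set_cat (FO U (arg_obj V U M (par \<Sigma> \<sigma>) (ins \<Sigma> \<sigma>) a)) (FO U (a (out \<Sigma> \<sigma>)))"
      and app_g: "\<And>p ds. p \<in> FO U (par \<Sigma> \<sigma>) \<Longrightarrow> ds \<in> args (fst D) (ins \<Sigma> \<sigma>) \<Longrightarrow>
        app g (pair p (tup ds)) = snd D (\<sigma>, p) ds" for \<sigma> g
  proof (rule initial_lift_domainD(4)[OF a_init[OF sigD(2)[OF \<sigma>]]])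
    let ?w = "arg_obj V U M (par \<Sigma> \<sigma>) (ins \<Sigma> \<sigma>) a"
    show "?w \<in> Obj V"
      using arg_obj(1)[OF sigD(3)[OF \<sigma>] ins_Obj[OF a(1) \<sigma>]] .
    have U_out: "FO U (a (out \<Sigma> \<sigma>)) = fst D (out \<Sigma> \<sigma>)"
      using FO_pow_func[OF sigD(2)[OF \<sigma>], of U a] a(2) by simp
    then show g': "g \<in> hom set_cat (FO U ?w) (fst D (out \<Sigma> \<sigma>))"
      using g by simp
    fix c h assume "(c, h) \<in> (\<lambda>(b, f). (b (out \<Sigma> \<sigma>), f (out \<Sigma> \<sigma>))) ` ?K"
    then obtain B k where Bk: "(B, k) \<in> K" and c: "c = fst B (out \<Sigma> \<sigma>)" and h: "h = FA classical_forget k (out \<Sigma> \<sigma>)"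
      by auto
    note B = KB'[OF Bk]
    obtain f where f: "f \<in> hom (pow_cat S V) a (fst B)" "FA (pow_func S U) f = FA classical_forget k"
      using a(3)[of "fst B" "FA classical_forget k"] Bk by (force simp: pow.admissible_iff)
    have Uf: "FA U (f s) = FA classical_forget k s" if "s \<in> S" for s
      using f(2) FA_pow_func[OF that] by metis
    have k_hom: "und.sorted_hom D (und_alg U S \<Sigma> B) (\<lambda>s. app (FA classical_forget k s))"
      using Kk[OF Bk] by (auto simp: cls.hom_classical_theory_cat_iff und.hom_classical_alg_cat_iff
          classical_forget_def struct_forget_def)
    have f_ins: "\<And>s. s \<in> set (ins \<Sigma> \<sigma>) \<Longrightarrow> f s \<in> hom V (a s) (fst B s)"
      using pow_hom[OF f(1)] sigD(1)[OF \<sigma>] by auto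
    note arg = arg_arr[OF sigD(3)[OF \<sigma>] f_ins]
    let ?m = "snd B \<sigma> \<cdot>\<^bsub>V\<^esub> arg_arr V U M (par \<Sigma> \<sigma>) (ins \<Sigma> \<sigma>) f"
    have m: "?m \<in> hom V ?w (fst B (out \<Sigma> \<sigma>))"
      using dom.Cmp_hom[OF arg(1) op_hom[OF B \<sigma>]] by blast
    have h_hom: "h \<in> hom set_cat (fst D (out \<Sigma> \<sigma>)) (FO U (fst B (out \<Sigma> \<sigma>)))"
      using FA_hom[OF pow_hom[OF f(1) sigD(2)[OF \<sigma>]]] Uf[OF sigD(2)[OF \<sigma>]] U_out h by simp
    have "h \<cdot>\<^bsub>set_cat\<^esub> g = FA U ?m"
    proof (rule set_arr_eqI[OF category.Cmp_hom[OF category_set_cat g' h_hom] FA_hom[OF m]])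
      fix z assume z: "z \<in> FO U ?w"
      then obtain p ds where p: "p \<in> FO U (par \<Sigma> \<sigma>)" and ds: "ds \<in> args (fst D) (ins \<Sigma> \<sigma>)" and z_eq: "z = pair p (tup ds)"
        using args_obj_iff[OF a(1) \<sigma>] a(2) by auto
      have ds': "ds \<in> args (\<lambda>s. FO U (a s)) (ins \<Sigma> \<sigma>)"
        using ds args_FO_pow_func[OF sigD(1)[OF \<sigma>], of a] a(2) by simp
      have map2_eq: "map2 (\<lambda>s. app (FA classical_forget k s)) (ins \<Sigma> \<sigma>) ds = map2 (\<lambda>s d. app (FA U (f s)) d) (ins \<Sigma> \<sigma>) ds"
        using Uf sigD(1)[OF \<sigma>] by (intro map2_args_cong[OF ds]) auto
      have in_B: "map2 (\<lambda>s. app (FA classical_forget k s)) (ins \<Sigma> \<sigma>) ds \<in> args (FO (pow_func S U) (fst B)) (ins \<Sigma> \<sigma>)"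
        using und.sorted_hom_in[OF k_hom] sigD(1)[OF \<sigma>] by (intro map2_in_args[OF ds]) auto
      have "app (h \<cdot>\<^bsub>set_cat\<^esub> g) z = app h (snd D (\<sigma>, p) ds)"
        using app_Cmp_set_cat[OF g' h_hom z] app_g[OF p ds] z_eq by simp
      also have "\<dots> = snd (und_alg U S \<Sigma> B) (\<sigma>, p) (map2 (\<lambda>s. app (FA classical_forget k s)) (ins \<Sigma> \<sigma>) ds)"
        using und.sorted_hom_op[OF k_hom, of "(\<sigma>, p)" ds] \<sigma> p ds h by simp
      also have "\<dots> = app (FA U (snd B \<sigma>)) (pair p (tup (map2 (\<lambda>s d. app (FA U (f s)) d) (ins \<Sigma> \<sigma>) ds)))"
        using und_alg_op[OF \<sigma> p in_B] by (simp only: map2_eq)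
      also have "\<dots> = app (FA U ?m) z"
        using U_app_Cmp[OF arg(1) op_hom[OF B \<sigma>] z] arg(2)[OF _ p ds'] z_eq by simp
      finally show "app (h \<cdot>\<^bsub>set_cat\<^esub> g) z = app (FA U ?m) z" .
    qed
    then show "adm ?w c (h \<cdot>\<^bsub>set_cat\<^esub> g)"
      using admI[OF m] c by simp
  qed
  have A: "?A \<in> algebras V U M S \<Sigma>"
    by (rule lift_alg[OF a(1) D' a(2) adm_op])
  have und_A: "und_alg U S \<Sigma> ?A = D"
    by (rule und_lift_alg[OF a(1) D' a(2) adm_op])
  \<comment> \<open>The equations hold because satisfaction depends on the underlying algebra only,
    which is the model \<open>D\<close>.\<close>
  have A_Obj: "?A \<in> Obj Alg"
    using A und_A D by (simp add: Obj_theory_cat)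
  have fst_A: "fst ?A = a"
    by (simp add: lift_alg_def)
  have adm_A: "admissible Alg uAlg (und_func U S \<Sigma>) ?A B k" if Bk: "(B, k) \<in> K" for B k
    unfolding admissible_und_iff[OF A_Obj KB[OF Bk]] und_A fst_A
    using Kk[OF Bk] a(3)[of "fst B" "FA classical_forget k"] Bk by force
  have init_A: "admissible Alg uAlg (und_func U S \<Sigma>) w ?A g"
    if w: "w \<in> Obj Alg" and g: "g \<in> hom uAlg (und_alg U S \<Sigma> w) D"
      and gK: "\<And>B k. (B, k) \<in> K \<Longrightarrow> admissible Alg uAlg (und_func U S \<Sigma>) w B (k \<cdot>\<^bsub>uAlg\<^esub> g)" for w g
  proof -
    have "admissible (pow_cat S V) (pow_cat S set_cat) (pow_func S U) (fst w) a (FA classical_forget g)"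
    proof (rule a(4))
      show "fst w \<in> Obj (pow_cat S V)"
        using w carrier_Obj by (simp add: Obj_theory_cat)
      show "FA classical_forget g \<in> hom (pow_cat S set_cat) (FO (pow_func S U) (fst w)) (fst D)"
        using forget_hom[OF g] by simp
      fix c h assume "(c, h) \<in> ?K"
      then obtain B k where Bk: "(B, k) \<in> K" "c = fst B" "h = FA classical_forget k"
        by auto
      then show "admissible (pow_cat S V) (pow_cat S set_cat) (pow_func S U) (fst w) c
          (h \<cdot>\<^bsub>pow_cat S set_cat\<^esub> FA classical_forget g)"
        using gK[OF Bk(1)] forget_Cmp[OF g Kk[OF Bk(1)]] unfolding admissible_und_iff[OF w KB[OF Bk(1)]] by simp
    qed
    then show ?thesis
      using g unfolding admissible_und_iff[OF w A_Obj] und_A fst_A by blast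
  qed
  have "initial_lift_domain Alg uAlg (und_func U S \<Sigma>) D K ?A"
    unfolding initial_lift_domain_def initial_source_def
  proof (intro conjI ballI A_Obj)
    show "FO (und_func U S \<Sigma>) ?A = D"
      by (simp add: und_func_def und_A)
    show "case x of (B, k) \<Rightarrow> admissible Alg uAlg (und_func U S \<Sigma>) ?A B k" if "x \<in> K" for x
      using that adm_A by auto
    fix w g assume w: "w \<in> Obj Alg" and g: "g \<in> hom uAlg (FO (und_func U S \<Sigma>) w) (FO (und_func U S \<Sigma>) ?A)"
    have g': "g \<in> hom uAlg (und_alg U S \<Sigma> w) D"
      using g by (simp add: und_func_def und_A)
    show "admissible Alg uAlg (und_func U S \<Sigma>) w ?A g \<longleftrightarrow>
        (\<forall>(B, k) \<in> K. admissible Alg uAlg (und_func U S \<Sigma>) w B (k \<cdot>\<^bsub>uAlg\<^esub> g))"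
      using init_A[OF w g'] und_functor.admissible_Cmp[OF _ adm_A] by blast
  qed
  then show ?thesis
    using that pow_init fst_A by simp
qed

text \<open>Faithfulness comes from the power of \<open>U\<close> on carriers. For amnesticity, the
  fibre order on algebras restricts to carriers, where it is antisymmetric, and
  \<open>alg_eqI\<close> adds the operations.\<close>

lemma topological_und_func: "topological Alg uAlg (und_func U S \<Sigma>)"
proof
  show "faithful Alg (und_func U S \<Sigma>)"
    unfolding faithful_def
  proof (intro allI ballI impI)
    fix A B k l assume "k \<in> hom Alg A B" "l \<in> hom Alg A B" "FA (und_func U S \<Sigma>) k = FA (und_func U S \<Sigma>) l"
    then show "k = l"
      by (auto simp: hom_theory_cat_iff hom_alg_cat_iff und_func_def dest: pow.faithfulD)
  qed
next
  fix A B assume AB: "A \<in> Obj Alg" "B \<in> Obj Alg"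
    "fib_le Alg uAlg (und_func U S \<Sigma>) A B" "fib_le Alg uAlg (und_func U S \<Sigma>) B A"
  have le: "fib_le (pow_cat S V) (pow_cat S set_cat) (pow_func S U) (fst A) (fst B)"
    and eq: "und_alg U S \<Sigma> A = und_alg U S \<Sigma> B"
    if "A \<in> Obj Alg" "B \<in> Obj Alg" "fib_le Alg uAlg (und_func U S \<Sigma>) A B" for A B
  proof -
    show eq: "und_alg U S \<Sigma> A = und_alg U S \<Sigma> B"
      using that(3) by (simp add: fib_le_def und_func_def)
    have "FA classical_forget (Id uAlg (und_alg U S \<Sigma> A)) = Id (pow_cat S set_cat) (FO (pow_func S U) (fst A))"
      using is_functor.FA_Id[OF cls.is_functor_classical_forget, of "und_alg U S \<Sigma> A"] that(1)
      by (simp add: Obj_theory_cat)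
    moreover have "admissible Alg uAlg (und_func U S \<Sigma>) A B (Id uAlg (und_alg U S \<Sigma> A))"
      using that(3) unfolding fib_le_def FO_und_func by blast
    ultimately show "fib_le (pow_cat S V) (pow_cat S set_cat) (pow_func S U) (fst A) (fst B)"
      using arg_cong[OF eq, of fst] unfolding fib_le_def admissible_und_iff[OF that(1,2)] by simp
  qed
  show "A = B"
  proof (rule alg_eqI)
    show "A \<in> algebras V U M S \<Sigma>" "B \<in> algebras V U M S \<Sigma>"
      using AB by (auto simp: Obj_theory_cat)
    then show "fst A = fst B"
      using pow.amnestic carrier_Obj le AB by blast
    show "und_alg U S \<Sigma> A = und_alg U S \<Sigma> B"
      using eq AB by blast
  qed
next
  fix D K assume "structured_source Alg uAlg (und_func U S \<Sigma>) D K"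
  then show "\<exists>A. initial_lift_domain Alg uAlg (und_func U S \<Sigma>) D K A"
    using theory_initial_lift by blast
qed

text \<open>An arbitrary initial lift equals the constructed one, for which the carrier is known to
  be initial.\<close>

lemma forget_initial_lift:
  assumes "structured_source Alg uAlg (und_func U S \<Sigma>) D K"
    and "initial_lift_domain Alg uAlg (und_func U S \<Sigma>) D K A"
  shows "initial_lift_domain (pow_cat S V) (pow_cat S set_cat) (pow_func S U) (FO classical_forget D)
      ((\<lambda>(B, k). (FO theory_forget B, FA classical_forget k)) ` K) (FO theory_forget A)"
proof -
  obtain A' where "initial_lift_domain Alg uAlg (und_func U S \<Sigma>) D K A'"
    "initial_lift_domain (pow_cat S V) (pow_cat S set_cat) (pow_func S U) (fst D)
      ((\<lambda>(B, k). (fst B, FA classical_forget k)) ` K) (fst A')"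
    using theory_initial_lift[OF assms(1)] .
  then show ?thesis
    using topological.initial_lift_domain_unique[OF topological_und_func assms(2)]
    by (simp add: theory_forget_def struct_forget_def)
qed

lemma forget_square:
  "func_eq Alg (classical_forget \<circ>\<^sub>F und_func U S \<Sigma>) (pow_func S U \<circ>\<^sub>F theory_forget)"
  by (auto simp: func_eq_def comp_func_def und_func_def theory_forget_def struct_forget_def classical_forget_def
      theory_cat_def full_subcat_def)

text \<open>Folding turns the generic left adjoint and counit of the classical universal arrows into
  \<open>free_func\<close> and \<open>free_counit\<close>.\<close>

lemmas theory_taut_lift = taut_lift[OF topological_und_func pow_topological is_functor_theory_forget
    cls.free.universal_arrows_axioms forget_square forget_initial_lift, folded cls.free_func_eq cls.free_counit_eq]

end

theorem theorem4p3p1: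
  fixes V :: "('v, 'm) cat"
    and U :: "('v, 'm, 'u::set_universe set, 'u set_arrow) func"
    and M :: "('v, 'm) monoidal"
    and S :: "'u set"
    and \<Sigma> :: "('u, 'v) esig"
    and E :: "('u, 'v, 'm) eeqn set"
  assumes "topological V set_cat U"
    and "symmetric_monoidal V M"
    and "strict_symmetric_monoidal_functor V M set_cat set_cartesian U"
    and "small S"
    and "equational_theory V U M S \<Sigma> E"
  shows "\<exists>F \<eta> \<epsilon>.
    adjunction_lifting
      (theory_cat V U M S \<Sigma> E) (pow_cat S V) F theory_forget \<eta> \<epsilon>
      (classical_theory_cat S (und_sig U \<Sigma>) (und_eqns V U M S \<Sigma> E)) (pow_cat S set_cat)
        (free_func S (und_sig U \<Sigma>) (und_eqns V U M S \<Sigma> E) enc_op_symbol) classical_forget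
        (free_unit S (und_sig U \<Sigma>) (und_eqns V U M S \<Sigma> E) enc_op_symbol)
        (free_counit S (und_sig U \<Sigma>) (und_eqns V U M S \<Sigma> E) enc_op_symbol)
      (und_func U S \<Sigma>) (pow_func S U) \<and>
    func_eq (pow_cat S V) (und_func U S \<Sigma> \<circ>\<^sub>F F)
      (free_func S (und_sig U \<Sigma>) (und_eqns V U M S \<Sigma> E) enc_op_symbol \<circ>\<^sub>F pow_func S U) \<and>
    (\<forall>X \<in> Obj (pow_cat S V).
      (\<forall>B. initial_lift_domain (theory_cat V U M S \<Sigma> E)
             (classical_theory_cat S (und_sig U \<Sigma>) (und_eqns V U M S \<Sigma> E)) (und_func U S \<Sigma>)
             (free_alg S (und_sig U \<Sigma>) (und_eqns V U M S \<Sigma> E) enc_op_symbol (FO (pow_func S U) X))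
             {(A, und_sharp V U M S \<Sigma> E X A f) | A f. (A, f) \<in> comma V U M S \<Sigma> E X} B
           \<longleftrightarrow> B = FO F X) \<and>
      (\<forall>Z. initial_lift_domain (pow_cat S V) (pow_cat S set_cat) (pow_func S U)
             (quotient_carrier S
                (term_carrier S (und_sig U \<Sigma>) enc_op_symbol (\<lambda>y. y) (FO (pow_func S U) X))
                (free_congruence S (und_sig U \<Sigma>) (und_eqns V U M S \<Sigma> E) enc_op_symbol
                   (FO (pow_func S U) X)))
             {(FO theory_forget A, FA classical_forget (und_sharp V U M S \<Sigma> E X A f)) | A f.
                (A, f) \<in> comma V U M S \<Sigma> E X} Z
           \<longleftrightarrow> Z = FO theory_forget (FO F X)))"
proof -
  interpret enriched_theory V U M S \<Sigma> E
    using assms by (auto simp: enriched_theory_def enriched_theory_axioms_def enriched_signature_def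
        enriched_signature_axioms_def enriching_def enriching_axioms_def equational_theory_def)
  \<comment> \<open>Unfolded, the comma objects with their extensions are the source used in
    \<open>taut_lift\<close>.\<close>
  have source: "{(A, und_sharp V U M S \<Sigma> E X A f) | A f. (A, f) \<in> comma V U M S \<Sigma> E X} =
      {(a, sharp S (und_sig U \<Sigma>) (und_eqns V U M S \<Sigma> E) enc_op_symbol (FO (pow_func S U) X)
        (FO (und_func U S \<Sigma>) a) (FA (pow_func S U) f)) | a f. a \<in> Obj Alg \<and> f \<in> hom (pow_cat S V) X (FO theory_forget a)}"
    for X
    by (simp add: comma_def und_sharp_def und_func_def)
  have carrier_source: "{(FO theory_forget A, FA classical_forget (und_sharp V U M S \<Sigma> E X A f)) | A f.
        (A, f) \<in> comma V U M S \<Sigma> E X} = (\<lambda>(c, f). (FO theory_forget c, FA classical_forget f)) `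
      {(A, und_sharp V U M S \<Sigma> E X A f) | A f. (A, f) \<in> comma V U M S \<Sigma> E X}" for X
  proof (intro set_eqI iffI)
    fix z assume "z \<in> {(FO theory_forget A, FA classical_forget (und_sharp V U M S \<Sigma> E X A f)) | A f.
        (A, f) \<in> comma V U M S \<Sigma> E X}"
    then obtain A f where "(A, f) \<in> comma V U M S \<Sigma> E X"
      "z = (FO theory_forget A, FA classical_forget (und_sharp V U M S \<Sigma> E X A f))"
      by blast
    then show "z \<in> (\<lambda>(c, f). (FO theory_forget c, FA classical_forget f)) `
      {(A, und_sharp V U M S \<Sigma> E X A f) | A f. (A, f) \<in> comma V U M S \<Sigma> E X}"
      by (intro image_eqI[of _ _ "(A, und_sharp V U M S \<Sigma> E X A f)"]) (simp, blast)
  next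
    fix z assume "z \<in> (\<lambda>(c, f). (FO theory_forget c, FA classical_forget f)) `
      {(A, und_sharp V U M S \<Sigma> E X A f) | A f. (A, f) \<in> comma V U M S \<Sigma> E X}"
    then obtain A f where "(A, f) \<in> comma V U M S \<Sigma> E X"
      "z = (\<lambda>(c, f). (FO theory_forget c, FA classical_forget f)) (A, und_sharp V U M S \<Sigma> E X A f)"
      by blast
    then show "z \<in> {(FO theory_forget A, FA classical_forget (und_sharp V U M S \<Sigma> E X A f)) | A f.
        (A, f) \<in> comma V U M S \<Sigma> E X}"
      unfolding prod.case by blast
  qed
  \<comment> \<open>The carrier of the free model is the quotient of terms by definition, so the
    last claim is the carrier part of \<open>taut_lift\<close>.\<close>
  have carrier: "quotient_carrier S (term_carrier S (und_sig U \<Sigma>) enc_op_symbol (\<lambda>y. y) Y)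
        (free_congruence S (und_sig U \<Sigma>) (und_eqns V U M S \<Sigma> E) enc_op_symbol Y)
      = FO classical_forget (free_alg S (und_sig U \<Sigma>) (und_eqns V U M S \<Sigma> E) enc_op_symbol Y)" for Y
    by (simp add: free_alg_def fst_quotient_alg free_sig_alg_def)
  show ?thesis
    unfolding carrier_source carrier source by (rule theory_taut_lift)
qed

end
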